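(* For each group $\Gamma\in\{\mathsf{T},\mathsf{O},\mathsf{I}\}$, the conjugacy classes of monomorphisms $\rho:\Gamma\hookrightarrow G_2(\mathbb{C})$ are classified by the character of the representation of $\Gamma$ on the $7$-dimensional space $V$ obtained by restriction along $\rho$. That is, the map sending the conjugacy class of $\rho$ to the character $\gamma\mapsto \operatorname{tr}(\rho(\gamma)|_V)$ is a well-defined bijection from the set of $G_2(\mathbb{C})$-conjugacy classes of monomorphisms $\Gamma\hookrightarrow G_2(\mathbb{C})$ onto the following set of characters: \begin{itemize} \item for $\Gamma=\mathsf{T}$: $\{\chi_1+2\chi_4\}$; \item for $\Gamma=\mathsf{O}$: $\{\chi_1+2\chi_4,\ \chi_2+\chi_4+\chi_5\}$; \item for $\Gamma=\mathsf{I}$: $\{\chi_1+2\chi_2,\ \chi_1+2\chi_3,\ \chi_2+\chi_4,\ \chi_3+\chi_4\}$. \end{itemize} Here, for each $\Gamma$, the $\chi_i$ are the irreducible characters of that $\Gamma$ as given in the context.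
   Context: $V$ denotes the $7$-dimensional faithful (irreducible) representation of the simple complex Lie algebra $\mathfrak{g}_2(\mathbb{C})$ of type $G_2$. The exponentials of $\mathfrak{g}_2(\mathbb{C})$ acting on $V$ generate the Lie group $G_2(\mathbb{C})\subset \mathrm{SO}(V)$, which is isomorphic to $\mathrm{Aut}(\mathfrak{g}_2(\mathbb{C}))$ via the adjoint representation. Two homomorphisms $\rho_1,\rho_2:\Gamma\to G_2(\mathbb{C})$ are conjugate if there is $g\in G_2(\mathbb{C})$ with $\rho_2(\gamma)=g\rho_1(\gamma)g^{-1}$ for all $\gamma\in\Gamma$. A monomorphism is an injective group homomorphism. The groups $\mathsf{T},\mathsf{O},\mathsf{I}$ (tetrahedral, octahedral, icosahedral; isomorphic to $A_4$, $S_4$, $A_5$ respectively) are given by the presentation $$\Gamma=\langle\gamma_a,\gamma_b,\gamma_c\mid \gamma_a^n=\gamma_b^3=\gamma_c^2=\gamma_a\gamma_b\gamma_c=1\rangle$$ with $n=3,4,5$ respectively. Their irreducible characters are labelled as follows, where $\zeta=e^{2\pi i/3}$ and $\phi^{\pm}=\frac{1\pm\sqrt5}{2}$. For $\mathsf{T}$, values on the classes $[1],[\gamma_a],[\gamma_c],[\gamma_b]$: $\chi_1=(1,1,1,1)$, $\chi_2=(1,\zeta^2,1,\zeta)$, $\chi_3=(1,\zeta,1,\zeta^2)$, $\chi_4=(3,0,-1,0)$. For $\mathsf{O}$, values on the classes $[1],[\gamma_c],[\gamma_b],[\gamma_a^2],[\gamma_a]$: $\chi_1=(1,1,1,1,1)$,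 $\chi_2=(1,-1,1,1,-1)$, $\chi_3=(2,0,-1,2,0)$, $\chi_4=(3,-1,0,-1,1)$, $\chi_5=(3,1,0,-1,-1)$. For $\mathsf{I}$, values on the classes $[1],[\gamma_b],[\gamma_c],[\gamma_a],[\gamma_a^2]$: $\chi_1=(1,1,1,1,1)$, $\chi_2=(3,0,-1,\phi^-,\phi^+)$, $\chi_3=(3,0,-1,\phi^+,\phi^-)$, $\chi_4=(4,1,0,-1,-1)$, $\chi_5=(5,-1,1,0,0)$. *)

theory Defs
  imports "HOL-Analysis.Analysis" "HOL-Algebra.Elementary_Groups"
begin

section \<open>The Lie algebra of type $G_2$ on its 7-dimensional representation\<close>

definition matrix_unit :: "'n \<Rightarrow> 'n \<Rightarrow> complex^'n^'n" where
  "matrix_unit i j = (\<chi> k l. if k = i \<and> l = j then 1 else 0)"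

definition lie_bracket :: "complex^'n^'n \<Rightarrow> complex^'n^'n \<Rightarrow> complex^'n^'n" where
  "lie_bracket A B = A ** B - B ** A"

text \<open>The complex Lie subalgebra of all square matrices generated by \<open>S\<close>.\<close>

inductive_set lie_generated :: "(complex^'n^'n) set \<Rightarrow> (complex^'n^'n) set"
  for S :: "(complex^'n^'n) set" where
  base: "A \<in> S \<Longrightarrow> A \<in> lie_generated S"
| zero: "0 \<in> lie_generated S"
| add: "A \<in> lie_generated S \<Longrightarrow> B \<in> lie_generated S \<Longrightarrow> A + B \<in> lie_generated S"
| scale: "A \<in> lie_generated S \<Longrightarrow> (\<chi> i j. c * A $ i $ j) \<in> lie_generated S"
| bracket: "A \<in> lie_generated S \<Longrightarrow> B \<in> lie_generated S \<Longrightarrow> lie_bracket A B \<in> lie_generated S"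

text \<open>
  \<open>V\<close> is \<open>complex^7\<close>. With \<open>\<alpha>1\<close> the short and \<open>\<alpha>2\<close> the long simple root, the coordinates
  1, ..., 7 (in the type \<open>7\<close> the numeral 7 is 0) are a basis of weight vectors for the weights
  \<open>2\<alpha>1+\<alpha>2, \<alpha>1+\<alpha>2, \<alpha>1, 0, -\<alpha>1, -\<alpha>1-\<alpha>2, -2\<alpha>1-\<alpha>2\<close>; the Chevalley generators act as follows.
\<close>

definition g2_e1 :: "complex^7^7" where
  "g2_e1 = matrix_unit 1 2 + 2 *\<^sub>R matrix_unit 3 4 + matrix_unit 4 5 + matrix_unit 6 7"

definition g2_f1 :: "complex^7^7" where
  "g2_f1 = matrix_unit 2 1 + matrix_unit 4 3 + 2 *\<^sub>R matrix_unit 5 4 + matrix_unit 7 6"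

definition g2_e2 :: "complex^7^7" where
  "g2_e2 = matrix_unit 2 3 + matrix_unit 5 6"

definition g2_f2 :: "complex^7^7" where
  "g2_f2 = matrix_unit 3 2 + matrix_unit 6 5"

definition g2 :: "(complex^7^7) set" where
  "g2 = lie_generated {g2_e1, g2_e2, g2_f1, g2_f2}"

text \<open>
  The generators satisfy the Serre relations for the Cartan matrix
  \<open>a11 = a22 = 2\<close>, \<open>a12 = -3\<close>, \<open>a21 = -1\<close> (where \<open>[h\<^sub>i, e\<^sub>j] = a\<^sub>i\<^sub>j e\<^sub>j\<close>). By Serre's theorem \<open>g2\<close> is
  therefore a nonzero quotient of the simple Lie algebra of type \<open>G\<^sub>2\<close>, hence isomorphic to it.
\<close>

lemma g2_serre_relations:
  defines "h1 \<equiv> lie_bracket g2_e1 g2_f1" and "h2 \<equiv> lie_bracket g2_e2 g2_f2"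
  shows "lie_bracket h1 h2 = 0"
    and "lie_bracket g2_e1 g2_f2 = 0" and "lie_bracket g2_e2 g2_f1 = 0"
    and "lie_bracket h1 g2_e1 = 2 *\<^sub>R g2_e1" and "lie_bracket h1 g2_e2 = (-3) *\<^sub>R g2_e2"
    and "lie_bracket h2 g2_e1 = - g2_e1" and "lie_bracket h2 g2_e2 = 2 *\<^sub>R g2_e2"
    and "lie_bracket h1 g2_f1 = (-2) *\<^sub>R g2_f1" and "lie_bracket h1 g2_f2 = 3 *\<^sub>R g2_f2"
    and "lie_bracket h2 g2_f1 = g2_f1" and "lie_bracket h2 g2_f2 = (-2) *\<^sub>R g2_f2"
    and "(lie_bracket g2_e1 ^^ 4) g2_e2 = 0" and "(lie_bracket g2_e2 ^^ 2) g2_e1 = 0"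
    and "(lie_bracket g2_f1 ^^ 4) g2_f2 = 0" and "(lie_bracket g2_f2 ^^ 2) g2_f1 = 0"
proof -
  have mult: "matrix_unit i j ** matrix_unit k l = (if j = k then matrix_unit i l else 0)"
    for i j k l :: 7
  proof -
    have "(\<Sum>m\<in>UNIV. (if p = i \<and> m = j then 1 else 0) * (if m = k \<and> q = l then 1 else 0))
        = (if j = k \<and> p = i \<and> q = l then 1 else (0::complex))" for p q
    proof -
      have "(\<Sum>m\<in>UNIV. (if p = i \<and> m = j then 1 else 0) * (if m = k \<and> q = l then 1 else 0))
          = (\<Sum>m\<in>UNIV. if m = j then (if p = i \<and> j = k \<and> q = l then 1 else (0::complex)) else 0)"
        by (rule sum.cong) auto
      then show ?thesis by simp
    qed
    then show ?thesis by (simp add: matrix_unit_def matrix_matrix_mult_def vec_eq_iff)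
  qed
  have scl: "(a *\<^sub>R A) ** B = a *\<^sub>R (A ** B)" "A ** (a *\<^sub>R B) = a *\<^sub>R (A ** B)"
    for a :: real and A B :: "complex^7^7"
    by (simp_all add: matrix_matrix_mult_def vec_eq_iff scaleR_sum_right)
  have z: "A ** 0 = 0" "0 ** A = 0" for A :: "complex^7^7"
    by (simp_all add: matrix_matrix_mult_def vec_eq_iff)
  have dist: "(A + B) ** C = A ** C + B ** C" "(A - B) ** C = A ** C - B ** C" 
       "A ** (B + C) = A ** B + A ** C"  "A ** (B - C) = A ** B - A ** C"
       "(- A) ** B = - (A ** B)" "A ** (- B) = - (A ** B)" for A B C :: "complex^7^7"
    by (simp_all add: matrix_matrix_mult_def vec_eq_iff algebra_simps sum.distrib sum_subtractf
          sum_negf)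
  have num: "numeral w * A = numeral w *\<^sub>R A" for w and A :: "complex^7^7"
    by (simp add: vec_eq_iff scaleR_conv_of_real[where 'a = complex])
  note rules = num mult scl z dist lie_bracket_def g2_e1_def g2_e2_def g2_f1_def g2_f2_def
    scaleR_add_right scaleR_diff_right
  have h1: "h1 = matrix_unit 1 1 - matrix_unit 2 2 + 2 *\<^sub>R matrix_unit 3 3
      - 2 *\<^sub>R matrix_unit 5 5 + matrix_unit 6 6 - matrix_unit 7 7"
    unfolding h1_def by (simp add: rules)
  have h2: "h2 = matrix_unit 2 2 - matrix_unit 3 3 + matrix_unit 5 5 - matrix_unit 6 6"
    unfolding h2_def by (simp add: rules)
  show "lie_bracket h1 h2 = 0"
    "lie_bracket g2_e1 g2_f2 = 0" "lie_bracket g2_e2 g2_f1 = 0"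
    "lie_bracket h1 g2_e1 = 2 *\<^sub>R g2_e1" "lie_bracket h1 g2_e2 = (-3) *\<^sub>R g2_e2"
    "lie_bracket h2 g2_e1 = - g2_e1" "lie_bracket h2 g2_e2 = 2 *\<^sub>R g2_e2"
    "lie_bracket h1 g2_f1 = (-2) *\<^sub>R g2_f1" "lie_bracket h1 g2_f2 = 3 *\<^sub>R g2_f2"
    "lie_bracket h2 g2_f1 = g2_f1" "lie_bracket h2 g2_f2 = (-2) *\<^sub>R g2_f2"
    "(lie_bracket g2_e1 ^^ 4) g2_e2 = 0" "(lie_bracket g2_e2 ^^ 2) g2_e1 = 0"
    "(lie_bracket g2_f1 ^^ 4) g2_f2 = 0" "(lie_bracket g2_f2 ^^ 2) g2_f1 = 0"
    by (simp_all add: h1 h2 rules eval_nat_numeral, 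
        simp_all add: vec_eq_iff matrix_unit_def scaleR_conv_of_real[where 'a = complex])
qed

lemma g2_irreducible:
  fixes W :: "(complex^7) set"
  assumes W: "vec.subspace W" and inv: "\<And>A v. A \<in> g2 \<Longrightarrow> v \<in> W \<Longrightarrow> A *v v \<in> W"
  shows "W = {0} \<or> W = UNIV"
proof (cases "W = {0}")
  case False
  define E where "E v = (g2_e1 + g2_e2) *v v" for v
  define F where "F v = (g2_f1 + g2_f2) *v v" for v
  have "g2_e1 + g2_e2 \<in> g2" "g2_f1 + g2_f2 \<in> g2"
    unfolding g2_def by (intro lie_generated.add lie_generated.base; simp)+
  then have EW: "E v \<in> W" and FW: "F v \<in> W" if "v \<in> W" for v
    using inv that by (auto simp: E_def F_def)
  have sc: "c *s v \<in> W" if "v \<in> W" for c v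
    using W that by (simp add: vec.subspace_scale)
  have unit: "matrix_unit i j *v v = v $ j *s axis i 1" for i j :: 7 and v
    by (simp add: matrix_unit_def matrix_vector_mult_def vec_eq_iff axis_def if_distrib
        if_distribR sum.delta cong: if_cong)
  have add: "(A + B) *v v = A *v v + B *v v" "(a *\<^sub>R A) *v v = a *\<^sub>R (A *v v)"
    for A B :: "complex^7^7" and v and a :: real
    by (simp_all add: matrix_vector_mult_def vec_eq_iff algebra_simps sum.distrib scaleR_sum_right)
  have E: "E v $ 1 = v $ 2" "E v $ 2 = v $ 3" "E v $ 3 = 2 * v $ 4" "E v $ 4 = v $ 5"
    "E v $ 5 = v $ 6" "E v $ 6 = v $ 7" "E v $ 7 = 0" for v
    by (simp_all add: E_def g2_e1_def g2_e2_def add unit axis_def scaleR_conv_of_real[where 'a = complex])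
  have F: "F (axis 1 1) = axis 2 1" "F (axis 2 1) = axis 3 1" "F (axis 3 1) = axis 4 1"
    "F (axis 4 1) = 2 *s axis 5 1" "F (axis 5 1) = axis 6 1" "F (axis 6 1) = axis 7 1"
    by (simp_all add: F_def g2_f1_def g2_f2_def add unit vec_eq_iff)
       (simp_all add: axis_def scaleR_conv_of_real[where 'a = complex])
  have UNIV7: "(UNIV :: 7 set) = {1, 2, 3, 4, 5, 6, 7}"
  proof -
    have "card {1, 2, 3, 4, 5, 6, 7 :: 7} = 7" by simp
    then show ?thesis by (intro card_subset_eq[symmetric]) auto
  qed
  have all7: "(\<forall>i::7. P i) \<longleftrightarrow> P 1 \<and> P 2 \<and> P 3 \<and> P 4 \<and> P 5 \<and> P 6 \<and> P 7" for P
    using UNIV7 by (metis UNIV_I insertE singletonD)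
  have 1: "axis 1 1 \<in> W" if "v \<in> W" "v $ 1 \<noteq> 0" "\<forall>i. i \<noteq> 1 \<longrightarrow> v $ i = 0" for v
  proof -
    have "inverse (v $ 1) *s v = axis 1 1"
      using that by (auto simp: vec_eq_iff axis_def)
    with sc[OF that(1)] show ?thesis by metis
  qed
  have top: "axis 1 1 \<in> W" if vW: "v \<in> W" and v0: "v \<noteq> 0" for v
  proof -
    have step: "axis 1 1 \<in> W" if "v \<in> W" "E v = 0" "v \<noteq> 0" for v
    proof (rule 1[of v])
      have "E v $ i = 0" for i using that(2) by simp
      from this[of 1] this[of 2] this[of 3] this[of 4] this[of 5] this[of 6]
      have *: "v $ 2 = 0" "v $ 3 = 0" "v $ 4 = 0" "v $ 5 = 0" "v $ 6 = 0" "v $ 7 = 0"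
        unfolding E by simp_all
      with that(3) show "v $ 1 \<noteq> 0" "\<forall>i. i \<noteq> 1 \<longrightarrow> v $ i = 0"
        unfolding vec_eq_iff all7 by simp_all
    qed (fact that(1))
    have nil: "(E ^^ 7) v = 0"
      unfolding vec_eq_iff all7 by (simp add: eval_nat_numeral E)
    have EWn: "(E ^^ n) v \<in> W" for n
      by (induction n) (auto simp: vW EW)
    define n where "n = (LEAST n. (E ^^ n) v = 0)"
    have n: "(E ^^ n) v = 0" unfolding n_def using nil by (rule LeastI)
    then obtain m where m: "n = Suc m" using v0 by (cases n) auto
    have "(E ^^ m) v \<noteq> 0" using not_less_Least[of m "\<lambda>n. (E ^^ n) v = 0"] m unfolding n_def by auto
    with step[OF EWn[of m]] n m show ?thesis by simp
  qed
  obtain v where "v \<in> W" "v \<noteq> 0"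
    using False W vec.subspace_0 by blast
  then have a1: "axis 1 1 \<in> W" by (rule top)
  have a2: "axis 2 1 \<in> W" using FW[OF a1] by (simp add: F)
  have a3: "axis 3 1 \<in> W" using FW[OF a2] by (simp add: F)
  have a4: "axis 4 1 \<in> W" using FW[OF a3] by (simp add: F)
  have "(1/2) *s (2 *s axis 5 1) \<in> W" using FW[OF a4] sc by (simp only: F)
  then have a5: "axis 5 1 \<in> W" by (simp add: vector_smult_assoc)
  have a6: "axis 6 1 \<in> W" using FW[OF a5] by (simp add: F)
  have a7: "axis 7 1 \<in> W" using FW[OF a6] by (simp only: F)
  have ax: "axis i 1 \<in> W" for i :: 7
    using a1 a2 a3 a4 a5 a6 a7 all7[of "\<lambda>i. axis i 1 \<in> W"] by blast
  have "v \<in> W" for v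
  proof -
    have "(\<Sum>i\<in>UNIV. v $ i *s axis i 1) \<in> W"
      by (intro vec.subspace_sum[OF W] sc ax)
    then show ?thesis by (simp add: basis_expansion)
  qed
  then show ?thesis by blast
qed simp


section \<open>The Lie group\<close>

definition matrix_exp :: "complex^'n^'n \<Rightarrow> complex^'n^'n" where
  "matrix_exp A = (\<Sum>k. ((**) A ^^ k) (mat 1) /\<^sub>R fact k)"

definition GL :: "(complex^'n^'n) monoid" where
  "GL = units_of \<lparr>carrier = UNIV, monoid.mult = (**), one = mat 1\<rparr>"

text \<open>Matrix exponentials are invertible, so the intersection with \<open>carrier GL\<close> in
  \<open>subgroup_generated\<close> removes nothing.\<close>

definition G2 :: "(complex^7^7) monoid" where
  "G2 = subgroup_generated GL (matrix_exp ` g2)"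


section \<open>Groups given by generators and relators\<close>

text \<open>Words over a set of letters; \<open>(x, True)\<close> stands for \<open>x\<close> and \<open>(x, False)\<close> for its inverse.\<close>

inductive word_cong :: "('x \<times> bool) list set \<Rightarrow> ('x \<times> bool) list \<Rightarrow> ('x \<times> bool) list \<Rightarrow> bool"
  for R :: "('x \<times> bool) list set" where
  refl: "word_cong R u u"
| sym: "word_cong R u v \<Longrightarrow> word_cong R v u"
| trans: "word_cong R u v \<Longrightarrow> word_cong R v w \<Longrightarrow> word_cong R u w"
| cancel: "word_cong R (u @ [(x, s), (x, \<not> s)] @ v) (u @ v)"
| relator: "r \<in> R \<Longrightarrow> word_cong R (u @ r @ v) (u @ v)"

definition word_class :: "('x \<times> bool) list set \<Rightarrow> ('x \<times> bool) list \<Rightarrow> ('x \<times> bool) list set" where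
  "word_class R u = {v. word_cong R u v}"

definition presented_group :: "('x \<times> bool) list set \<Rightarrow> ('x \<times> bool) list set monoid" where
  "presented_group R =
    \<lparr>carrier = range (word_class R),
     monoid.mult = (\<lambda>X Y. \<Union>u\<in>X. \<Union>v\<in>Y. word_class R (u @ v)),
     one = word_class R []\<rparr>"

lemma word_cong_append:
  "word_cong R u u' \<Longrightarrow> word_cong R v v' \<Longrightarrow> word_cong R (u @ v) (u' @ v')"
proof -
  have l: "word_cong R (w @ u) (w @ u')" if "word_cong R u u'" for u u' w
    using that
  proof induction
    case (cancel u x s v)
    then show ?case using word_cong.cancel[of R "w @ u"] by simp
  next
    case (trans u v w)
    from trans.IH show ?case by (rule word_cong.trans)
  next
    case (relator r u v)
    then show ?case using word_cong.relator[of r R "w @ u"] by simp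
  qed (auto intro: word_cong.refl word_cong.sym)
  have r: "word_cong R (u @ w) (u' @ w)" if "word_cong R u u'" for u u' w
    using that
  proof induction
    case (cancel u x s v)
    then show ?case using word_cong.cancel[of R u x s "v @ w"] by simp
  next
    case (trans u v w)
    from trans.IH show ?case by (rule word_cong.trans)
  next
    case (relator r u v)
    then show ?case using word_cong.relator[of r R u "v @ w"] by simp
  qed (auto intro: word_cong.refl word_cong.sym)
  assume "word_cong R u u'" "word_cong R v v'"
  from r[OF this(1)] l[OF this(2)] show ?thesis by (rule word_cong.trans)
qed

lemma word_class_eq_iff: "word_class R u = word_class R v \<longleftrightarrow> word_cong R u v"
  unfolding word_class_def set_eq_iff mem_Collect_eq
  by (metis word_cong.refl word_cong.sym word_cong.trans)

lemma word_class_mult: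
  "word_class R u \<otimes>\<^bsub>presented_group R\<^esub> word_class R v = word_class R (u @ v)"
proof -
  have "word_class R (u' @ v') = word_class R (u @ v)"
    if "u' \<in> word_class R u" "v' \<in> word_class R v" for u' v'
    using that unfolding word_class_eq_iff unfolding word_class_def mem_Collect_eq
    by (intro word_cong_append word_cong.sym[of R u] word_cong.sym[of R v])
  moreover have "w \<in> word_class R w" for w
    by (simp add: word_class_def word_cong.refl)
  ultimately have "(\<Union>u'\<in>word_class R u. \<Union>v'\<in>word_class R v. word_class R (u' @ v'))
      = word_class R (u @ v)"
    by blast
  then show ?thesis by (simp add: presented_group_def)
qed

lemma group_presented_group: "group (presented_group R)"
proof (rule groupI)
  let ?G = "presented_group R" and ?i = "\<lambda>u. rev (map (\<lambda>(x, s). (x, \<not> s)) u)"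
  have car: "carrier ?G = range (word_class R)" and one: "\<one>\<^bsub>?G\<^esub> = word_class R []"
    by (simp_all add: presented_group_def)
  show "\<one>\<^bsub>?G\<^esub> \<in> carrier ?G"
    by (simp add: car one)
  have inv: "word_cong R (?i u @ u) []" for u
  proof (induction u)
    case (Cons a u)
    obtain x s where a: "a = (x, s)" by (cases a)
    have "word_cong R (?i u @ [(x, \<not> s), (x, \<not> \<not> s)] @ u) (?i u @ u)"
      by (rule word_cong.cancel)
    from word_cong.trans[OF this Cons] show ?case by (simp add: a)
  qed (simp add: word_cong.refl)
  fix x assume x: "x \<in> carrier ?G"
  then obtain u where u: "x = word_class R u" by (auto simp: car)
  have "word_class R (?i u) \<otimes>\<^bsub>?G\<^esub> x = \<one>\<^bsub>?G\<^esub>"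
    unfolding u one word_class_mult word_class_eq_iff by (rule inv)
  then show "\<exists>y\<in>carrier ?G. y \<otimes>\<^bsub>?G\<^esub> x = \<one>\<^bsub>?G\<^esub>"
    unfolding car by blast
  show "\<one>\<^bsub>?G\<^esub> \<otimes>\<^bsub>?G\<^esub> x = x"
    by (simp add: u one word_class_mult)
  fix y assume "y \<in> carrier ?G"
  then obtain v where v: "y = word_class R v" by (auto simp: car)
  show "x \<otimes>\<^bsub>?G\<^esub> y \<in> carrier ?G"
    by (simp add: u v word_class_mult car)
  fix z assume "z \<in> carrier ?G"
  then obtain w where w: "z = word_class R w" by (auto simp: car)
  show "x \<otimes>\<^bsub>?G\<^esub> y \<otimes>\<^bsub>?G\<^esub> z = x \<otimes>\<^bsub>?G\<^esub> (y \<otimes>\<^bsub>?G\<^esub> z)"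
    by (simp add: u v w word_class_mult)
qed

datatype generator = Ga | Gb | Gc

type_synonym polyhedral = "(generator \<times> bool) list set"

definition polyhedral_relators :: "nat \<Rightarrow> (generator \<times> bool) list set" where
  "polyhedral_relators n =
    {replicate n (Ga, True), replicate 3 (Gb, True), replicate 2 (Gc, True),
     [(Ga, True), (Gb, True), (Gc, True)]}"

definition polyhedral_group :: "nat \<Rightarrow> polyhedral monoid" where
  "polyhedral_group n = presented_group (polyhedral_relators n)"

definition gen :: "nat \<Rightarrow> generator \<Rightarrow> polyhedral" where
  "gen n x = word_class (polyhedral_relators n) [(x, True)]"

abbreviation "tetrahedral \<equiv> polyhedral_group 3"
abbreviation "octahedral \<equiv> polyhedral_group 4"
abbreviation "icosahedral \<equiv> polyhedral_group 5"


section \<open>Characters\<close>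

text \<open>
  The class function with the given values at representatives of the conjugacy classes
  (meaningful if \<open>reps\<close> contains exactly one element of each class).
\<close>

definition class_function :: "('g, 'b) monoid_scheme \<Rightarrow> 'g list \<Rightarrow> complex list \<Rightarrow> 'g \<Rightarrow> complex" where
  "class_function G reps vals = (\<lambda>x\<in>carrier G. THE v. \<exists>i < length reps.
     v = vals ! i \<and> (\<exists>g\<in>carrier G. x = g \<otimes>\<^bsub>G\<^esub> reps ! i \<otimes>\<^bsub>G\<^esub> inv\<^bsub>G\<^esub> g))"

definition zeta :: complex where "zeta = exp (2 * of_real pi * \<i> / 3)"

definition phi_plus :: complex where "phi_plus = of_real ((1 + sqrt 5) / 2)"

definition phi_minus :: complex where "phi_minus = of_real ((1 - sqrt 5) / 2)"

text \<open>In the following three definitions \<open>i\<close> is the (1-based) label of the irreducible character.\<close>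

definition chi_T :: "nat \<Rightarrow> polyhedral \<Rightarrow> complex" where
  "chi_T i = class_function tetrahedral [\<one>\<^bsub>tetrahedral\<^esub>, gen 3 Ga, gen 3 Gc, gen 3 Gb]
    ([[1, 1, 1, 1],
      [1, zeta\<^sup>2, 1, zeta],
      [1, zeta, 1, zeta\<^sup>2],
      [3, 0, -1, 0]] ! (i - 1))"

definition chi_O :: "nat \<Rightarrow> polyhedral \<Rightarrow> complex" where
  "chi_O i = class_function octahedral
    [\<one>\<^bsub>octahedral\<^esub>, gen 4 Gc, gen 4 Gb, gen 4 Ga [^]\<^bsub>octahedral\<^esub> (2::nat), gen 4 Ga]
    ([[1, 1, 1, 1, 1],
      [1, -1, 1, 1, -1],
      [2, 0, -1, 2, 0],
      [3, -1, 0, -1, 1],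
      [3, 1, 0, -1, -1]] ! (i - 1))"

definition chi_I :: "nat \<Rightarrow> polyhedral \<Rightarrow> complex" where
  "chi_I i = class_function icosahedral
    [\<one>\<^bsub>icosahedral\<^esub>, gen 5 Gb, gen 5 Gc, gen 5 Ga, gen 5 Ga [^]\<^bsub>icosahedral\<^esub> (2::nat)]
    ([[1, 1, 1, 1, 1],
      [3, 0, -1, phi_minus, phi_plus],
      [3, 0, -1, phi_plus, phi_minus],
      [4, 1, 0, -1, -1],
      [5, -1, 1, 0, 0]] ! (i - 1))"

definition rep_character :: "('g, 'b) monoid_scheme \<Rightarrow> ('g \<Rightarrow> complex^'n^'n) \<Rightarrow> 'g \<Rightarrow> complex" where
  "rep_character G \<rho> = (\<lambda>x\<in>carrier G. trace (\<rho> x))"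


section \<open>Conjugacy of monomorphisms\<close>

text \<open>
  Library homomorphisms are arbitrary off the carrier; since conjugacy is tested on the carrier
  only, homomorphisms that agree on the carrier lie in the same class.
\<close>

definition mon_conj :: "('g, 'b) monoid_scheme \<Rightarrow> ('h, 'c) monoid_scheme \<Rightarrow> ('g \<Rightarrow> 'h) rel" where
  "mon_conj G H = {(\<rho>1, \<rho>2). \<rho>1 \<in> mon G H \<and> \<rho>2 \<in> mon G H \<and>
     (\<exists>h\<in>carrier H. \<forall>x\<in>carrier G. \<rho>2 x = h \<otimes>\<^bsub>H\<^esub> \<rho>1 x \<otimes>\<^bsub>H\<^esub> inv\<^bsub>H\<^esub> h)}"

end

theory Submission
  imports Defs
begin

text \<open>
  \<open>G2\<close> is the group \<open>zaut\<close> of all automorphisms of the complexified cross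
  product on \<open>V\<close>: such an automorphism can be moved by root elements until it fixes the
  zero weight vector, and the stabiliser of that vector is \<open>SL\<^sub>3\<close>, which is
  generated by transvections. In a copy of \<open>A\<^sub>4\<close> inside \<open>zaut\<close>, the
  Klein four-group fixes a vector of norm one, unique up to sign; moving it to the zero weight
  vector puts the group into \<open>SL\<^sub>3\<close>, where it becomes the standard one after
  diagonalisation. So all copies of \<open>A\<^sub>4\<close> are conjugate. The octahedral and the
  icosahedral group are generated by \<open>A\<^sub>4\<close> and one more involution
  \<open>t\<close> that inverts the element \<open>s\<close> of order 3 permuting the coordinates
  cyclically. In block form \<open>t\<close> consists of circulants, and the remaining relations
  become polynomial equations with two, respectively four, solutions up to the finite centraliser of
  the standard \<open>A\<^sub>4\<close>. Their traces separate the solutions and give the stated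
  characters.
\<close>

section \<open>Zorn coordinates and the cross product\<close>

text \<open>\<open>V\<close> consists of the complex octonions of trace zero: the product of
  \<open>v\<close> and \<open>w\<close> is the scalar \<open>qform v w\<close> plus the vector
  \<open>cprod v w\<close>. On the other side the obstacle is that the polyhedral groups are given
  by relators only, so neither their orders nor their classes are known. Rewriting with the relators
  bounds them from above: every element is conjugate to a listed representative. Homomorphisms into
  \<open>G2\<close> bound them from below, as the trace is constant on classes: an element of trace
  other than 7 lies outside the kernel, and representatives with different traces are not conjugate,
  which makes \<open>class_function\<close> meaningful. In \<open>octahedral\<close> the classes of
  \<open>gen 4 Gc\<close> and of the square of \<open>gen 4 Ga\<close> share the trace -1; a sign
  character tells them apart. In \<open>tetrahedral\<close> those of \<open>gen 3 Ga\<close> and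
  \<open>gen 3 Gb\<close> share the trace 1, but \<chi>1 and \<chi>4 agree on them. Traces also
  enter the icosahedral equations: conjugate elements have images of equal trace, so the traces of
  \<open>t\<close> and \<open>t a\<close> are forced to be those of \<open>std_a\<close> and
  \<open>std_s\<close>, which yields linear equations.\<close>

lemma UNIV_7: "(UNIV :: 7 set) = {1, 2, 3, 4, 5, 6, 7}"
proof -
  have "card {1, 2, 3, 4, 5, 6, 7 :: 7} = 7" by simp
  then show ?thesis by (intro card_subset_eq[symmetric]) auto
qed

lemma forall_7: "(\<forall>i::7. P i) \<longleftrightarrow> P 1 \<and> P 2 \<and> P 3 \<and> P 4 \<and> P 5 \<and> P 6 \<and> P 7"
  using UNIV_7 by (metis UNIV_I insertE singletonD)

lemma sum_7: "(\<Sum>i\<in>(UNIV :: 7 set). f i) = f 1 + f 2 + f 3 + f 4 + f 5 + f 6 + (f 7 :: 'a :: comm_monoid_add)"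
  unfolding UNIV_7 by (simp add: ac_simps)

text \<open>
  \<open>zorn a x y\<close> splits \<open>V\<close> under the subalgebra \<open>sl\<^sub>3\<close> of the long roots: \<open>a\<close> is the coordinate of weight
  0, the \<open>x\<^sub>i\<close> belong to three short weights with sum 0 and the \<open>y\<^sub>i\<close> to their negatives.
\<close>

definition zorn :: "complex \<Rightarrow> complex \<Rightarrow> complex \<Rightarrow> complex \<Rightarrow> complex \<Rightarrow> complex \<Rightarrow> complex \<Rightarrow> complex^7" where
  "zorn a x1 x2 x3 y1 y2 y3 = (\<chi> i. if i = 4 then a else if i = 3 then x1 else if i = 2 then x2
     else if i = 7 then x3 else if i = 5 then y1 else if i = 6 then - y2 else y3)"

lemma zorn_nth:
  "zorn a x1 x2 x3 y1 y2 y3 $ 1 = y3" "zorn a x1 x2 x3 y1 y2 y3 $ 2 = x2"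
  "zorn a x1 x2 x3 y1 y2 y3 $ 3 = x1" "zorn a x1 x2 x3 y1 y2 y3 $ 4 = a"
  "zorn a x1 x2 x3 y1 y2 y3 $ 5 = y1" "zorn a x1 x2 x3 y1 y2 y3 $ 6 = - y2"
  "zorn a x1 x2 x3 y1 y2 y3 $ 7 = x3"
  by (simp_all add: zorn_def)

lemma zorn_coords: "v = zorn (v $ 4) (v $ 3) (v $ 2) (v $ 7) (v $ 5) (- v $ 6) (v $ 1)"
  by (simp add: vec_eq_iff forall_7 zorn_nth)

lemma zorn_cases:
  obtains a x1 x2 x3 y1 y2 y3 where "v = zorn a x1 x2 x3 y1 y2 y3"
  using zorn_coords by blast

lemma zorn_eq_iff:
  "zorn a x1 x2 x3 y1 y2 y3 = zorn a' x1' x2' x3' y1' y2' y3' \<longleftrightarrow>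
   a = a' \<and> x1 = x1' \<and> x2 = x2' \<and> x3 = x3' \<and> y1 = y1' \<and> y2 = y2' \<and> y3 = y3'"
  by (auto simp: vec_eq_iff forall_7 zorn_nth)

lemma zorn_arith:
  "zorn a x1 x2 x3 y1 y2 y3 + zorn a' x1' x2' x3' y1' y2' y3' =
   zorn (a + a') (x1 + x1') (x2 + x2') (x3 + x3') (y1 + y1') (y2 + y2') (y3 + y3')"
  "zorn a x1 x2 x3 y1 y2 y3 - zorn a' x1' x2' x3' y1' y2' y3' =
   zorn (a - a') (x1 - x1') (x2 - x2') (x3 - x3') (y1 - y1') (y2 - y2') (y3 - y3')"
  "- zorn a x1 x2 x3 y1 y2 y3 = zorn (- a) (- x1) (- x2) (- x3) (- y1) (- y2) (- y3)"
  "c *s zorn a x1 x2 x3 y1 y2 y3 = zorn (c * a) (c * x1) (c * x2) (c * x3) (c * y1) (c * y2) (c * y3)"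
  "0 = zorn 0 0 0 0 0 0 0"
  by (auto simp: vec_eq_iff forall_7 zorn_nth algebra_simps)

text \<open>In Zorn coordinates this is \<open>a a'\<close> minus half of
  \<open>x y' + y x'\<close>, so the norm of a vector is its octonion square
  \<open>a^2 - x y\<close>. The signs at coordinates 2 and 6 come from coordinate 6 being
  \<open>- y2\<close>.\<close>

definition qform :: "complex^7 \<Rightarrow> complex^7 \<Rightarrow> complex" where
  "qform v w = v $ 4 * w $ 4 - (v $ 3 * w $ 5 + v $ 5 * w $ 3 - v $ 2 * w $ 6 - v $ 6 * w $ 2
     + v $ 7 * w $ 1 + v $ 1 * w $ 7) / 2"

text \<open>The vector part of the octonion product. Raw coordinates allow it to be differentiated
  entry by entry later; \<open>cprod_zorn\<close> is the readable form, with \<open>x\<close>-part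
  \<open>a x' - a' x + y \<times> y'\<close> and \<open>y\<close>-part
  \<open>a' y - a y' + x \<times> x'\<close>.\<close>

definition cprod :: "complex^7 \<Rightarrow> complex^7 \<Rightarrow> complex^7" where
  "cprod v w = zorn
     (- (v $ 3 * w $ 5 - v $ 2 * w $ 6 + v $ 7 * w $ 1 - v $ 5 * w $ 3 + v $ 6 * w $ 2 - v $ 1 * w $ 7) / 2)
     (v $ 4 * w $ 3 - w $ 4 * v $ 3 - v $ 6 * w $ 1 + v $ 1 * w $ 6)
     (v $ 4 * w $ 2 - w $ 4 * v $ 2 + v $ 1 * w $ 5 - v $ 5 * w $ 1)
     (v $ 4 * w $ 7 - w $ 4 * v $ 7 - v $ 5 * w $ 6 + v $ 6 * w $ 5)
     (w $ 4 * v $ 5 - v $ 4 * w $ 5 + v $ 2 * w $ 7 - v $ 7 * w $ 2)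
     (v $ 4 * w $ 6 - w $ 4 * v $ 6 + v $ 7 * w $ 3 - v $ 3 * w $ 7)
     (w $ 4 * v $ 1 - v $ 4 * w $ 1 + v $ 3 * w $ 2 - v $ 2 * w $ 3)"

text \<open>Being scalar valued, it reduces invariance of the product along a one-parameter group to
  the constancy of one complex function.\<close>

definition triple :: "complex^7 \<Rightarrow> complex^7 \<Rightarrow> complex^7 \<Rightarrow> complex" where
  "triple u v w = qform (cprod u v) w"

lemma qform_zorn:
  "qform (zorn a x1 x2 x3 y1 y2 y3) (zorn a' x1' x2' x3' y1' y2' y3') =
   a * a' - (x1 * y1' + x2 * y2' + x3 * y3' + y1 * x1' + y2 * x2' + y3 * x3') / 2"
  by (simp add: qform_def zorn_nth algebra_simps)

lemma cprod_zorn: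
  "cprod (zorn a x1 x2 x3 y1 y2 y3) (zorn a' x1' x2' x3' y1' y2' y3') = zorn
     (- (x1 * y1' + x2 * y2' + x3 * y3' - y1 * x1' - y2 * x2' - y3 * x3') / 2)
     (a * x1' - a' * x1 + y2 * y3' - y3 * y2')
     (a * x2' - a' * x2 + y3 * y1' - y1 * y3')
     (a * x3' - a' * x3 + y1 * y2' - y2 * y1')
     (a' * y1 - a * y1' + x2 * x3' - x3 * x2')
     (a' * y2 - a * y2' + x3 * x1' - x1 * x3')
     (a' * y3 - a * y3' + x1 * x2' - x2 * x1')"
  by (simp add: cprod_def zorn_nth zorn_eq_iff algebra_simps)

lemma qform_commute: "qform v w = qform w v"
  by (simp add: qform_def algebra_simps)

lemma qform_linear:
  "qform (v + v') w = qform v w + qform v' w" "qform (v - v') w = qform v w - qform v' w"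
  "qform (- v) w = - qform v w" "qform (c *s v) w = c * qform v w" "qform 0 w = 0"
  "qform w (v + v') = qform w v + qform w v'" "qform w (v - v') = qform w v - qform w v'"
  "qform w (- v) = - qform w v" "qform w (c *s v) = c * qform w v" "qform w 0 = 0"
  by (simp_all add: qform_def field_simps)

lemma cprod_linear:
  "cprod (v + v') w = cprod v w + cprod v' w" "cprod (v - v') w = cprod v w - cprod v' w"
  "cprod (- v) w = - cprod v w" "cprod (c *s v) w = c *s cprod v w" "cprod 0 w = 0"
  "cprod w (v + v') = cprod w v + cprod w v'" "cprod w (v - v') = cprod w v - cprod w v'"
  "cprod w (- v) = - cprod w v" "cprod w (c *s v) = c *s cprod w v" "cprod w 0 = 0"
  by (simp_all add: vec_eq_iff forall_7 cprod_def zorn_nth field_simps)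

lemmas triple_linear = triple_def qform_linear cprod_linear

lemma qform_nondegenerate:
  assumes "\<And>w. qform v w = 0" shows "v = 0"
proof -
  obtain a x1 x2 x3 y1 y2 y3 where v: "v = zorn a x1 x2 x3 y1 y2 y3" by (rule zorn_cases)
  note * = assms[unfolded v]
  from *[of "zorn 1 0 0 0 0 0 0"] *[of "zorn 0 1 0 0 0 0 0"] *[of "zorn 0 0 1 0 0 0 0"]
    *[of "zorn 0 0 0 1 0 0 0"] *[of "zorn 0 0 0 0 1 0 0"] *[of "zorn 0 0 0 0 0 1 0"]
    *[of "zorn 0 0 0 0 0 0 1"]
  show ?thesis by (simp add: v qform_zorn zorn_arith(5) zorn_eq_iff)
qed

text \<open>The alternative law \<open>v (v w) = (v v) w\<close> of the octonions with scalar parts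
  separated. It makes multiplication by a vector of norm one injective on the orthogonal complement
  of that vector.\<close>

lemma cprod_cprod: "cprod v (cprod v w) = qform v v *s w - qform v w *s v"
proof -
  obtain a x1 x2 x3 y1 y2 y3 where v: "v = zorn a x1 x2 x3 y1 y2 y3" by (rule zorn_cases)
  obtain a' x1' x2' x3' y1' y2' y3' where w: "w = zorn a' x1' x2' x3' y1' y2' y3'" by (rule zorn_cases)
  show ?thesis
    unfolding v w qform_zorn cprod_zorn zorn_arith zorn_eq_iff
    by (intro conjI; simp add: field_simps)
qed

section \<open>Automorphisms of the form and the cross product\<close>

definition zunit :: "complex^7" where "zunit = zorn 1 0 0 0 0 0 0"

definition zaut :: "(complex^7^7) set" where
  "zaut = {M. (\<forall>v w. qform (M *v v) (M *v w) = qform v w) \<and>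
              (\<forall>v w. cprod (M *v v) (M *v w) = M *v cprod v w)}"

lemma zautD:
  assumes "M \<in> zaut"
  shows "qform (M *v v) (M *v w) = qform v w" "cprod (M *v v) (M *v w) = M *v cprod v w"
  using assms by (auto simp: zaut_def)

lemma isometry_invertible:
  fixes M :: "complex^7^7"
  assumes "\<And>v w. qform (M *v v) (M *v w) = qform v w"
  shows "invertible M"
proof -
  have "x = 0" if "M *v x = 0" for x
  proof (rule qform_nondegenerate)
    fix w show "qform x w = 0" using assms[of x w] that by (simp add: qform_linear)
  qed
  then show ?thesis
    using invertible_left_inverse matrix_left_invertible_ker by blast
qed

lemma zaut_invertible: "M \<in> zaut \<Longrightarrow> invertible M"
  by (rule isometry_invertible) (rule zautD)

text \<open>An isometry is surjective, so the vector \<open>M (v \<times> w)\<close> can be tested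
  against all \<open>z = M (N z)\<close>; nondegeneracy then turns the scalar identity for
  \<open>triple\<close> into the vector identity for \<open>cprod\<close>.\<close>

lemma zautI_triple:
  assumes Q: "\<And>v w. qform (M *v v) (M *v w) = qform v w"
    and T: "\<And>u v w. triple (M *v u) (M *v v) (M *v w) = triple u v w"
  shows "M \<in> zaut"
proof -
  obtain N where N: "M ** N = mat 1"
    using isometry_invertible[OF Q] by (auto simp: invertible_def)
  have MN: "M *v (N *v w) = w" for w
    using N by (simp add: matrix_vector_mul_assoc)
  have "cprod (M *v v) (M *v w) = M *v cprod v w" for v w
  proof -
    have "qform (cprod (M *v v) (M *v w) - M *v cprod v w) z = 0" for z
    proof -
      have "qform (cprod (M *v v) (M *v w)) z = qform (cprod v w) (N *v z)"
        using T[of v w "N *v z"] by (simp add: triple_def MN)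
      also have "\<dots> = qform (M *v cprod v w) z"
        using Q[of "cprod v w" "N *v z"] by (simp add: MN)
      finally show ?thesis by (simp add: qform_linear)
    qed
    then show ?thesis using qform_nondegenerate by fastforce
  qed
  with Q show ?thesis by (simp add: zaut_def)
qed

lemma matrix_vector_simps:
  fixes A B :: "complex^'n^'m"
  shows "(A + B) *v v = A *v v + B *v v" "(A - B) *v v = A *v v - B *v v"
    "(- A) *v v = - (A *v v)" "0 *v v = (0 :: complex^'m)"
    "(c *\<^sub>R A) *v v = complex_of_real c *s (A *v v)" "(\<chi> i j. d * A $ i $ j) *v v = d *s (A *v v)"
    "A *v (v + w) = A *v v + A *v w" "A *v (v - w) = A *v v - A *v w"
    "A *v (- v) = - (A *v v)" "A *v 0 = (0 :: complex^'m)" "A *v (e *s v) = e *s (A *v v)"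
  by (simp_all add: matrix_vector_mult_def vec_eq_iff algebra_simps sum.distrib sum_distrib_left
        sum_subtractf sum_negf scaleR_conv_of_real[where 'a = complex])

lemma matrix_vector_mul_zorn:
  "M *v zorn a x1 x2 x3 y1 y2 y3 = a *s (M *v zorn 1 0 0 0 0 0 0)
     + x1 *s (M *v zorn 0 1 0 0 0 0 0) + x2 *s (M *v zorn 0 0 1 0 0 0 0) + x3 *s (M *v zorn 0 0 0 1 0 0 0)
     + y1 *s (M *v zorn 0 0 0 0 1 0 0) + y2 *s (M *v zorn 0 0 0 0 0 1 0) + y3 *s (M *v zorn 0 0 0 0 0 0 1)"
proof -
  have "zorn a x1 x2 x3 y1 y2 y3 = a *s zorn 1 0 0 0 0 0 0
     + x1 *s zorn 0 1 0 0 0 0 0 + x2 *s zorn 0 0 1 0 0 0 0 + x3 *s zorn 0 0 0 1 0 0 0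
     + y1 *s zorn 0 0 0 0 1 0 0 + y2 *s zorn 0 0 0 0 0 1 0 + y3 *s zorn 0 0 0 0 0 0 1"
    by (simp add: zorn_arith)
  then show ?thesis by (simp only: matrix_vector_simps)
qed

lemma matrix_eq_zornI:
  fixes M N :: "complex^7^7"
  assumes "\<And>a x1 x2 x3 y1 y2 y3. M *v zorn a x1 x2 x3 y1 y2 y3 = N *v zorn a x1 x2 x3 y1 y2 y3"
  shows "M = N"
  using assms zorn_cases matrix_eq by metis

lemma zaut_mult: "M \<in> zaut \<Longrightarrow> N \<in> zaut \<Longrightarrow> M ** N \<in> zaut"
  by (simp add: zaut_def flip: matrix_vector_mul_assoc)

lemma zaut_one: "mat 1 \<in> zaut"
  by (simp add: zaut_def)

lemma zaut_inverse:
  assumes "M \<in> zaut" and N: "M ** N = mat 1"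
  shows "N \<in> zaut"
proof -
  have "N ** M = mat 1" using N by (simp add: matrix_left_right_inverse)
  then have NM: "N *v (M *v v) = v" "M *v (N *v v) = v" for v
    using N by (simp_all add: matrix_vector_mul_assoc)
  show ?thesis unfolding zaut_def
  proof (intro CollectI conjI allI)
    fix v w
    show "qform (N *v v) (N *v w) = qform v w"
      using zautD(1)[OF assms(1), of "N *v v" "N *v w"] by (simp add: NM)
    show "cprod (N *v v) (N *v w) = N *v cprod v w"
      using arg_cong[OF zautD(2)[OF assms(1), of "N *v v" "N *v w"], of "(*v) N"] by (simp add: NM)
  qed
qed

text \<open>The \<open>x\<^sub>i\<close> generate the whole algebra, hence determine an automorphism.\<close>

lemma zaut_eqI:
  assumes M: "M \<in> zaut" and N: "N \<in> zaut"
    and 1: "M *v zorn 0 1 0 0 0 0 0 = N *v zorn 0 1 0 0 0 0 0"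
    and 2: "M *v zorn 0 0 1 0 0 0 0 = N *v zorn 0 0 1 0 0 0 0"
    and 3: "M *v zorn 0 0 0 1 0 0 0 = N *v zorn 0 0 0 1 0 0 0"
  shows "M = N"
proof -
  have c: "M *v cprod v w = N *v cprod v w" if "M *v v = N *v v" "M *v w = N *v w" for v w
    using that zautD(2)[OF M, of v w] zautD(2)[OF N, of v w] by simp
  have y1: "M *v zorn 0 0 0 0 1 0 0 = N *v zorn 0 0 0 0 1 0 0"
    using c[OF 2 3] by (simp add: cprod_zorn)
  have y2: "M *v zorn 0 0 0 0 0 1 0 = N *v zorn 0 0 0 0 0 1 0"
    using c[OF 3 1] by (simp add: cprod_zorn)
  have y3: "M *v zorn 0 0 0 0 0 0 1 = N *v zorn 0 0 0 0 0 0 1"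
    using c[OF 1 2] by (simp add: cprod_zorn)
  have "cprod ((-2) *s zorn 0 1 0 0 0 0 0) (zorn 0 0 0 0 1 0 0) = zorn 1 0 0 0 0 0 0"
    by (simp add: cprod_zorn zorn_arith)
  moreover have "M *v cprod ((-2) *s zorn 0 1 0 0 0 0 0) (zorn 0 0 0 0 1 0 0)
      = N *v cprod ((-2) *s zorn 0 1 0 0 0 0 0) (zorn 0 0 0 0 1 0 0)"
    by (rule c) (use 1 y1 in \<open>simp_all add: matrix_vector_simps\<close>)
  ultimately have u: "M *v zorn 1 0 0 0 0 0 0 = N *v zorn 1 0 0 0 0 0 0"
    by simp
  show ?thesis
    by (rule matrix_eq_zornI) (subst (1 2) matrix_vector_mul_zorn, simp only: 1 2 3 y1 y2 y3 u)
qed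

section \<open>Exponentials of derivations\<close>

text \<open>The entries of \<open>exp (z A)\<close> as power series in one complex variable, so that
  the scalar theorems on convergence and termwise differentiation apply.\<close>

definition exp_series :: "complex^'n^'n \<Rightarrow> complex \<Rightarrow> complex^'n^'n" where
  "exp_series A z = (\<chi> i j. \<Sum>k. ((**) A ^^ k) (mat 1) $ i $ j / fact k * z ^ k)"

text \<open>The sum of the norms of all entries dominates every row sum, so each further factor
  \<open>A\<close> costs at most one factor of this size. The entries of the exponential are thereby
  dominated by a scalar exponential series.\<close>

lemma matrix_power_entry_bound:
  fixes A :: "complex^'n^'n"
  shows "norm (((**) A ^^ k) (mat 1) $ i $ j) \<le> (\<Sum>i\<in>UNIV. \<Sum>j\<in>UNIV. norm (A $ i $ j)) ^ k"
proof (induction k arbitrary: i j)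
  case (Suc k)
  let ?K = "\<Sum>i\<in>UNIV. \<Sum>j\<in>UNIV. norm (A $ i $ j)"
  have "norm (((**) A ^^ Suc k) (mat 1) $ i $ j) \<le> (\<Sum>l\<in>UNIV. norm (A $ i $ l) * ?K ^ k)"
    by (simp add: matrix_matrix_mult_def)
      (intro sum_norm_le, simp add: norm_mult mult_left_mono Suc)
  also have "\<dots> = (\<Sum>l\<in>UNIV. norm (A $ i $ l)) * ?K ^ k"
    by (simp add: sum_distrib_right)
  also have "\<dots> \<le> ?K * ?K ^ k"
    by (intro mult_right_mono zero_le_power sum_nonneg member_le_sum[of i UNIV "\<lambda>i. \<Sum>j\<in>UNIV. norm (A $ i $ j)"])
      (auto intro: sum_nonneg)
  finally show ?case by simp
qed (simp add: mat_def)

lemma summable_exp_series: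
  fixes A :: "complex^'n^'n"
  shows "summable (\<lambda>k. ((**) A ^^ k) (mat 1) $ i $ j / fact k * z ^ k)"
proof (rule summable_comparison_test')
  let ?K = "\<Sum>i\<in>UNIV. \<Sum>j\<in>UNIV. norm (A $ i $ j)"
  show "summable (\<lambda>k. (?K * norm z) ^ k / fact k)"
    using summable_exp_generic[of "?K * norm z"] by (simp add: field_simps)
  fix k
  show "norm (((**) A ^^ k) (mat 1) $ i $ j / fact k * z ^ k) \<le> (?K * norm z) ^ k / fact k"
    using matrix_power_entry_bound[where A = A and k = k and i = i and j = j]
    by (simp add: norm_mult norm_divide norm_power power_mult_distrib divide_right_mono mult_right_mono sum_nonneg)
qed

lemma matrix_exp_eq: "matrix_exp A = exp_series A 1"
proof -
  have "(\<lambda>k. ((**) A ^^ k) (mat 1) /\<^sub>R fact k) sums exp_series A 1"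
    unfolding sums_def
  proof (intro vec_tendstoI)
    fix i j
    have "(\<lambda>k. ((**) A ^^ k) (mat 1) $ i $ j / fact k) sums (exp_series A 1 $ i $ j)"
      using summable_sums[OF summable_exp_series[of A i j 1]] by (simp add: exp_series_def)
    then show "((\<lambda>n. (\<Sum>k<n. ((**) A ^^ k) (mat 1) /\<^sub>R fact k) $ i $ j) \<longlongrightarrow> exp_series A 1 $ i $ j) sequentially"
      by (simp add: sums_def scaleR_conv_of_real[where 'a = complex] field_simps)
  qed
  then show ?thesis unfolding matrix_exp_def by (rule sums_unique[symmetric])
qed

lemma exp_series_0: "exp_series A 0 = mat 1"
proof -
  have "(\<Sum>k. ((**) A ^^ k) (mat 1) $ i $ j / fact k * 0 ^ k) = mat 1 $ i $ j" for i j
    using powser_zero[of "\<lambda>k. ((**) A ^^ k) (mat 1) $ i $ j / fact k"] by simp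
  then show ?thesis by (simp add: exp_series_def vec_eq_iff)
qed

text \<open>The differential equation of the exponential: differentiation shifts the coefficients by
  one, and the shift is one more factor \<open>A\<close> on the left.\<close>

lemma DERIV_exp_series:
  fixes A :: "complex^'n^'n"
  shows "((\<lambda>z. exp_series A z $ i $ j) has_field_derivative (A ** exp_series A z) $ i $ j) (at z)"
proof -
  let ?a = "\<lambda>i j k. ((**) A ^^ k) (mat 1) $ i $ j / fact k"
  have d: "diffs (?a i j) n = (\<Sum>l\<in>UNIV. A $ i $ l * ?a l j n)" for n
  proof -
    have "diffs (?a i j) n = ((**) A ^^ Suc n) (mat 1) $ i $ j / fact n"
      using of_nat_neq_0[where 'a = complex, of n] by (simp add: diffs_def del: of_nat_Suc funpow.simps)
    then show ?thesis
      by (simp add: matrix_matrix_mult_def sum_divide_distrib)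
  qed
  have "((\<lambda>z. \<Sum>k. ?a i j k * z ^ k) has_field_derivative (\<Sum>k. diffs (?a i j) k * z ^ k)) (at z)"
    by (rule termdiffs_strong_converges_everywhere) (rule summable_exp_series)
  also have "(\<Sum>k. diffs (?a i j) k * z ^ k) = (\<Sum>k. \<Sum>l\<in>UNIV. A $ i $ l * (?a l j k * z ^ k))"
    by (simp only: d sum_distrib_right mult.assoc)
  also have "\<dots> = (\<Sum>l\<in>UNIV. \<Sum>k. A $ i $ l * (?a l j k * z ^ k))"
    by (intro suminf_sum summable_mult summable_exp_series)
  also have "\<dots> = (\<Sum>l\<in>UNIV. A $ i $ l * (\<Sum>k. ?a l j k * z ^ k))"
    by (intro sum.cong[OF HOL.refl] suminf_mult summable_exp_series)
  also have "\<dots> = (A ** exp_series A z) $ i $ j"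
    by (simp add: matrix_matrix_mult_def exp_series_def)
  finally show ?thesis by (simp add: exp_series_def)
qed

lemma DERIV_exp_series_vector:
  fixes A :: "complex^'n^'n"
  shows "((\<lambda>z. (exp_series A z *v v) $ i) has_field_derivative (A *v (exp_series A z *v v)) $ i) (at z)"
proof -
  have "((\<lambda>z. \<Sum>j\<in>UNIV. exp_series A z $ i $ j * v $ j) has_field_derivative
     (\<Sum>j\<in>UNIV. (A ** exp_series A z) $ i $ j * v $ j)) (at z)"
    by (intro DERIV_sum DERIV_cmult_right DERIV_exp_series)
  then show ?thesis
    by (simp only: matrix_vector_mul_assoc) (simp add: matrix_vector_mult_def)
qed

section \<open>Derivations, and their exponentials as automorphisms\<close>

definition zder :: "(complex^7^7) set" where
  "zder = {D. (\<forall>v w. qform (D *v v) w + qform v (D *v w) = 0) \<and>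
     (\<forall>u v w. triple (D *v u) v w + triple u (D *v v) w + triple u v (D *v w) = 0)}"

text \<open>The two conditions in \<open>zder\<close> say that \<open>qform\<close> and
  \<open>triple\<close>, evaluated on vectors transported by \<open>exp_series D z\<close>, have
  derivative 0 in \<open>z\<close>. Hence their values at 1 and at 0 agree.\<close>

lemma matrix_exp_zder_in_zaut:
  assumes D: "D \<in> zder" shows "matrix_exp D \<in> zaut"
proof -
  let ?E = "exp_series D"
  note der = DERIV_exp_series_vector[of D]
  have Q: "qform (?E z *v v) (?E z *v w) = qform v w" for z v w
  proof -
    have "((\<lambda>z. qform (?E z *v v) (?E z *v w)) has_field_derivative
       qform (D *v (?E z *v v)) (?E z *v w) + qform (?E z *v v) (D *v (?E z *v w))) (at z)" for z
      unfolding qform_def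
      by (rule derivative_eq_intros der HOL.refl zero_neq_numeral[symmetric])+ (simp add: field_simps)
    then have "((\<lambda>z. qform (?E z *v v) (?E z *v w)) has_field_derivative 0) (at z)" for z
      using D by (simp add: zder_def)
    then have "\<exists>c. \<forall>z\<in>UNIV. qform (?E z *v v) (?E z *v w) = c"
      by (intro has_field_derivative_zero_constant) simp_all
    then have "qform (?E z *v v) (?E z *v w) = qform (?E 0 *v v) (?E 0 *v w)" by auto
    then show ?thesis by (simp add: exp_series_0)
  qed
  have T: "triple (?E z *v u) (?E z *v v) (?E z *v w) = triple u v w" for z u v w
  proof -
    have "((\<lambda>z. triple (?E z *v u) (?E z *v v) (?E z *v w)) has_field_derivative
       triple (D *v (?E z *v u)) (?E z *v v) (?E z *v w) + triple (?E z *v u) (D *v (?E z *v v)) (?E z *v w)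
       + triple (?E z *v u) (?E z *v v) (D *v (?E z *v w))) (at z)" for z
      unfolding triple_def qform_def cprod_def zorn_nth
      by (rule derivative_eq_intros der HOL.refl zero_neq_numeral[symmetric])+ (simp add: field_simps)
    then have "((\<lambda>z. triple (?E z *v u) (?E z *v v) (?E z *v w)) has_field_derivative 0) (at z)" for z
      using D by (simp add: zder_def)
    then have "\<exists>c. \<forall>z\<in>UNIV. triple (?E z *v u) (?E z *v v) (?E z *v w) = c"
      by (intro has_field_derivative_zero_constant) simp_all
    then have "triple (?E z *v u) (?E z *v v) (?E z *v w) = triple (?E 0 *v u) (?E 0 *v v) (?E 0 *v w)"
      by auto
    then show ?thesis by (simp add: exp_series_0)
  qed
  show ?thesis unfolding matrix_exp_eq using Q T by (rule zautI_triple)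
qed

lemma matrix_unit_vector: "matrix_unit i j *v v = v $ j *s axis i 1"
  by (simp add: matrix_unit_def matrix_vector_mult_def vec_eq_iff axis_def if_distrib
      if_distribR sum.delta cong: if_cong)

lemma axis_zorn:
  "axis 1 1 = zorn 0 0 0 0 0 0 1" "axis 2 1 = zorn 0 0 1 0 0 0 0" "axis 3 1 = zorn 0 1 0 0 0 0 0"
  "axis 4 1 = zorn 1 0 0 0 0 0 0" "axis 5 1 = zorn 0 0 0 0 1 0 0" "axis 6 1 = zorn 0 0 0 0 0 (-1) 0"
  "axis 7 1 = zorn 0 0 0 1 0 0 0"
  unfolding vec_eq_iff forall_7 zorn_nth by (simp_all add: axis_def)

lemma g2_generators_zorn:
  "g2_e1 *v zorn a x1 x2 x3 y1 y2 y3 = zorn y1 (2 * a) 0 0 0 (- x3) x2"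
  "g2_e2 *v zorn a x1 x2 x3 y1 y2 y3 = zorn 0 0 x1 0 (- y2) 0 0"
  "g2_f1 *v zorn a x1 x2 x3 y1 y2 y3 = zorn x1 0 y3 (- y2) (2 * a) 0 0"
  "g2_f2 *v zorn a x1 x2 x3 y1 y2 y3 = zorn 0 x2 0 0 0 (- y1) 0"
  by (simp_all add: g2_e1_def g2_e2_def g2_f1_def g2_f2_def matrix_vector_simps matrix_unit_vector
      axis_zorn zorn_arith zorn_nth)

lemma lie_bracket_vector: "lie_bracket A B *v v = A *v (B *v v) - B *v (A *v v)"
  by (simp add: lie_bracket_def matrix_vector_simps matrix_vector_mul_assoc)

lemma zder_generator:
  assumes "D \<in> {g2_e1, g2_e2, g2_f1, g2_f2}" shows "D \<in> zder"
proof -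
  have "qform (D *v v) w + qform v (D *v w) = 0" for v w
  proof -
    obtain a x1 x2 x3 y1 y2 y3 where v: "v = zorn a x1 x2 x3 y1 y2 y3" by (rule zorn_cases)
    obtain a' x1' x2' x3' y1' y2' y3' where w: "w = zorn a' x1' x2' x3' y1' y2' y3'" by (rule zorn_cases)
    show ?thesis using assms
      by (elim insertE) (simp_all add: v w g2_generators_zorn qform_zorn field_simps)
  qed
  moreover have "triple (D *v u) v w + triple u (D *v v) w + triple u v (D *v w) = 0" for u v w
  proof -
    obtain b z1 z2 z3 t1 t2 t3 where u: "u = zorn b z1 z2 z3 t1 t2 t3" by (rule zorn_cases)
    obtain a x1 x2 x3 y1 y2 y3 where v: "v = zorn a x1 x2 x3 y1 y2 y3" by (rule zorn_cases)
    obtain a' x1' x2' x3' y1' y2' y3' where w: "w = zorn a' x1' x2' x3' y1' y2' y3'" by (rule zorn_cases)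
    show ?thesis using assms
      by (elim insertE) (simp_all add: u v w g2_generators_zorn triple_def qform_zorn cprod_zorn field_simps)
  qed
  ultimately show ?thesis by (simp add: zder_def)
qed

lemma g2_subset_zder: "g2 \<subseteq> zder"
proof
  \<comment> \<open>As rewrite rules these clear the first argument. In the bracket case all terms
    then carry \<open>u\<close> (or \<open>v\<close>) untouched in front, and they cancel in
    pairs.\<close>
  have Q: "qform (C *v v) w = - qform v (C *v w)"
    and T: "triple (C *v u) v w = - triple u (C *v v) w - triple u v (C *v w)"
    if "C \<in> zder" for C u v w
    using that unfolding zder_def by (auto simp: eq_neg_iff_add_eq_0 algebra_simps)
  have lin: "triple (u - u') v w = triple u v w - triple u' v w"
    "triple u (v - v') w = triple u v w - triple u v' w"
    "triple u v (w - w') = triple u v w - triple u v w'"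
    "triple (u + u') v w = triple u v w + triple u' v w"
    "triple u (v + v') w = triple u v w + triple u v' w"
    "triple u v (w + w') = triple u v w + triple u v w'"
    "triple (c *s u) v w = c * triple u v w" "triple u (c *s v) w = c * triple u v w"
    "triple u v (c *s w) = c * triple u v w" for u v w u' v' w' c
    by (simp_all add: triple_linear)
  fix D assume "D \<in> g2"
  then show "D \<in> zder" unfolding g2_def
  proof induction
    case (base A)
    then show ?case by (rule zder_generator)
  next
    case (add A B)
    show ?case unfolding zder_def mem_Collect_eq matrix_vector_simps lin qform_linear
      by (simp add: Q[OF add.IH(1)] Q[OF add.IH(2)] T[OF add.IH(1)] T[OF add.IH(2)])
  next
    case (scale A c)
    show ?case unfolding zder_def mem_Collect_eq matrix_vector_simps lin qform_linear
      by (simp add: Q[OF scale.IH] T[OF scale.IH] right_diff_distrib)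
  next
    case (bracket A B)
    show ?case unfolding zder_def mem_Collect_eq lie_bracket_vector lin qform_linear
      by (simp add: Q[OF bracket.IH(1)] Q[OF bracket.IH(2)] T[OF bracket.IH(1)] T[OF bracket.IH(2)])
  qed (simp add: zder_def matrix_vector_simps triple_linear)
qed

text \<open>Root vectors act on \<open>V\<close> with cube zero, so the exponentials of their
  multiples are polynomials of degree at most 2.\<close>

lemma matrix_exp_nilpotent:
  fixes N :: "complex^'n^'n"
  assumes "N ** (N ** N) = 0"
  shows "matrix_exp N *v v = v + N *v v + (1/2) *s (N *v (N *v v))"
proof -
  have 0: "((**) N ^^ k) (mat 1) = 0" if "k \<notin> {..2}" for k
  proof -
    have "3 \<le> k" using that by simp
    then show ?thesis
    proof (induction k rule: dec_induct)
      case base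
      then show ?case using assms by (simp add: eval_nat_numeral)
    qed (simp add: matrix_matrix_mult_def vec_eq_iff)
  qed
  have "matrix_exp N = (\<Sum>k\<le>2. ((**) N ^^ k) (mat 1) /\<^sub>R fact k)"
    unfolding matrix_exp_def by (intro suminf_finite) (auto simp: 0)
  also have "\<dots> = mat 1 + N + (1/2) *\<^sub>R (N ** N)"
    by (simp add: eval_nat_numeral)
  finally show ?thesis
    by (simp add: matrix_vector_simps matrix_vector_mul_assoc)
qed

section \<open>The group is the full automorphism group of the cross product\<close>

lemma group_GL: "group (GL :: (complex^'n^'n) monoid)"
proof -
  have "monoid \<lparr>carrier = UNIV, monoid.mult = (**), one = mat 1 :: complex^'n^'n\<rparr>"
    by unfold_locales (auto simp: matrix_mul_assoc)
  then show ?thesis unfolding GL_def by (rule monoid.units_group)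
qed

lemma carrier_GL: "carrier GL = {M :: complex^'n^'n. invertible M}"
  by (auto simp: GL_def units_of_def Units_def invertible_def)

lemma group_G2: "group G2"
  unfolding G2_def by (rule group.group_subgroup_generated[OF group_GL])

lemma G2_mult: "x \<otimes>\<^bsub>G2\<^esub> y = x ** y"
  by (simp add: G2_def GL_def units_of_def subgroup_generated_def)

lemma G2_one: "\<one>\<^bsub>G2\<^esub> = mat 1"
  by (simp add: G2_def GL_def units_of_def subgroup_generated_def)

lemma G2_closed: "x \<in> carrier G2 \<Longrightarrow> y \<in> carrier G2 \<Longrightarrow> x ** y \<in> carrier G2"
  using monoid.m_closed[OF group.is_monoid[OF group_G2]] by (simp add: G2_mult)

lemma G2_inverse:
  assumes "x \<in> carrier G2"
  shows "inv\<^bsub>G2\<^esub> x \<in> carrier G2" "x ** inv\<^bsub>G2\<^esub> x = mat 1" "inv\<^bsub>G2\<^esub> x ** x = mat 1"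
  using group.inv_closed[OF group_G2 assms] group.r_inv[OF group_G2 assms]
    group.l_inv[OF group_G2 assms] by (simp_all add: G2_mult G2_one)

lemma matrix_exp_in_G2: "A \<in> g2 \<Longrightarrow> matrix_exp A \<in> carrier G2"
  using zaut_invertible[OF matrix_exp_zder_in_zaut] g2_subset_zder
  by (auto simp: G2_def carrier_subgroup_generated carrier_GL intro!: generate.incl)

lemma G2_subset_zaut: "carrier G2 \<subseteq> zaut"
proof
  fix M assume "M \<in> carrier G2"
  then have "M \<in> generate GL (carrier GL \<inter> matrix_exp ` g2)"
    by (simp add: G2_def carrier_subgroup_generated)
  then show "M \<in> zaut"
  proof induction
    case one
    then show ?case by (simp add: GL_def units_of_def zaut_one)
  next
    case (incl h)
    then show ?case using g2_subset_zder matrix_exp_zder_in_zaut by blast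
  next
    case (inv h)
    then have "h \<otimes>\<^bsub>GL\<^esub> inv\<^bsub>GL\<^esub> h = \<one>\<^bsub>GL\<^esub>"
      by (intro group.r_inv[OF group_GL]) auto
    then have "h ** inv\<^bsub>GL\<^esub> h = mat 1" by (simp add: GL_def units_of_def)
    moreover have "h \<in> zaut"
      using inv g2_subset_zder matrix_exp_zder_in_zaut by blast
    ultimately show ?case using zaut_inverse by blast
  next
    case (eng h1 h2)
    then show ?case by (simp add: GL_def units_of_def zaut_mult)
  qed
qed

section \<open>Transitivity by means of root elements\<close>

definition fixing :: "(complex^7) set \<Rightarrow> (complex^7^7) set" where
  "fixing K = {h \<in> carrier G2. \<forall>k\<in>K. h *v k = k}"

lemma fixing_mult: "g \<in> fixing K \<Longrightarrow> h \<in> fixing K \<Longrightarrow> g ** h \<in> fixing K"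
  by (simp add: fixing_def G2_closed flip: matrix_vector_mul_assoc)

lemma fixing_zautD: "h \<in> fixing K \<Longrightarrow> h \<in> zaut"
  using G2_subset_zaut by (auto simp: fixing_def)

text \<open>The set \<open>K\<close> holds the vectors already in place: further vectors are moved
  only by elements that leave these alone.\<close>

definition reach :: "(complex^7) set \<Rightarrow> complex^7 \<Rightarrow> complex^7 \<Rightarrow> bool" where
  "reach K v w \<longleftrightarrow> (\<exists>h\<in>fixing K. h *v v = w)"

lemma reach_trans [trans]: "reach K u v \<Longrightarrow> reach K v w \<Longrightarrow> reach K u w"
  unfolding reach_def using fixing_mult by (metis matrix_vector_mul_assoc)

lemma reach_mono: "reach K v w \<Longrightarrow> L \<subseteq> K \<Longrightarrow> reach L v w"
  by (auto simp: reach_def fixing_def)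

lemma root_element:
  assumes N: "N \<in> g2" and nil: "\<And>v. N *v (N *v (N *v v)) = 0"
  obtains h where "h \<in> carrier G2" "\<And>v. h *v v = v + t *s (N *v v) + (t^2 / 2) *s (N *v (N *v v))"
proof
  let ?N = "(\<chi> i j. t * N $ i $ j)"
  have "?N \<in> g2" using N unfolding g2_def by (rule lie_generated.scale)
  then show "matrix_exp ?N \<in> carrier G2" by (rule matrix_exp_in_G2)
  have "?N ** (?N ** ?N) = 0"
    by (rule matrix_eq_zornI) (simp add: nil matrix_vector_simps flip: matrix_vector_mul_assoc)
  then show "matrix_exp ?N *v v = v + t *s (N *v v) + (t^2 / 2) *s (N *v (N *v v))" for v
    by (simp add: matrix_exp_nilpotent matrix_vector_simps power2_eq_square)
qed

lemma g2_bracket: "A \<in> g2 \<Longrightarrow> B \<in> g2 \<Longrightarrow> lie_bracket A B \<in> g2"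
  unfolding g2_def by (rule lie_generated.bracket)

lemma g2_scale: "A \<in> g2 \<Longrightarrow> (\<chi> i j. c * A $ i $ j) \<in> g2"
  unfolding g2_def by (rule lie_generated.scale)

text \<open>The first and the fourth are the Chevalley generators \<open>g2_e1\<close> and
  \<open>g2_f1\<close>. Up to signs the six formulas are one formula under cyclic shifts of the
  indices and the exchange of \<open>x\<close> and \<open>y\<close>.\<close>

lemma short_roots_in_g2:
  "\<exists>N\<in>g2. \<forall>a x1 x2 x3 y1 y2 y3. N *v zorn a x1 x2 x3 y1 y2 y3 = zorn y1 (2 * a) 0 0 0 (- x3) x2"
  "\<exists>N\<in>g2. \<forall>a x1 x2 x3 y1 y2 y3. N *v zorn a x1 x2 x3 y1 y2 y3 = zorn y2 0 (2 * a) 0 x3 0 (- x1)"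
  "\<exists>N\<in>g2. \<forall>a x1 x2 x3 y1 y2 y3. N *v zorn a x1 x2 x3 y1 y2 y3 = zorn y3 0 0 (2 * a) (- x2) x1 0"
  "\<exists>N\<in>g2. \<forall>a x1 x2 x3 y1 y2 y3. N *v zorn a x1 x2 x3 y1 y2 y3 = zorn x1 0 y3 (- y2) (2 * a) 0 0"
  "\<exists>N\<in>g2. \<forall>a x1 x2 x3 y1 y2 y3. N *v zorn a x1 x2 x3 y1 y2 y3 = zorn x2 (- y3) 0 y1 0 (2 * a) 0"
  "\<exists>N\<in>g2. \<forall>a x1 x2 x3 y1 y2 y3. N *v zorn a x1 x2 x3 y1 y2 y3 = zorn x3 y2 (- y1) 0 0 0 (2 * a)"
proof -
  have gen: "g2_e1 \<in> g2" "g2_e2 \<in> g2" "g2_f1 \<in> g2" "g2_f2 \<in> g2"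
    by (auto simp: g2_def intro: lie_generated.base)
  define p2 where "p2 = lie_bracket g2_e2 g2_e1"
  define m2 where "m2 = lie_bracket g2_f1 g2_f2"
  \<comment> \<open>Two short roots whose sum is short have structure constant 2 or -2; the factors
    \<open>-1/2\<close> and \<open>1/2\<close> remove it.\<close>
  define p3 where "p3 = (\<chi> i j. (-1/2) * lie_bracket g2_f1 m2 $ i $ j)"
  define m3 where "m3 = (\<chi> i j. (1/2) * lie_bracket g2_e1 p2 $ i $ j)"
  note rules = lie_bracket_vector matrix_vector_simps g2_generators_zorn zorn_arith zorn_eq_iff
  have in_g2: "p2 \<in> g2" "m2 \<in> g2" "p3 \<in> g2" "m3 \<in> g2"
    unfolding p2_def m2_def p3_def m3_def by (intro g2_scale g2_bracket gen)+
  have p2: "p2 *v zorn a x1 x2 x3 y1 y2 y3 = zorn y2 0 (2 * a) 0 x3 0 (- x1)" for a x1 x2 x3 y1 y2 y3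
    unfolding p2_def by (simp add: rules)
  have m2: "m2 *v zorn a x1 x2 x3 y1 y2 y3 = zorn x2 (- y3) 0 y1 0 (2 * a) 0" for a x1 x2 x3 y1 y2 y3
    unfolding m2_def by (simp add: rules)
  have p3: "p3 *v zorn a x1 x2 x3 y1 y2 y3 = zorn y3 0 0 (2 * a) (- x2) x1 0" for a x1 x2 x3 y1 y2 y3
    unfolding p3_def matrix_vector_simps by (simp add: rules m2)
  have m3: "m3 *v zorn a x1 x2 x3 y1 y2 y3 = zorn x3 y2 (- y1) 0 0 0 (2 * a)" for a x1 x2 x3 y1 y2 y3
    unfolding m3_def matrix_vector_simps by (simp add: rules p2)
  show "\<exists>N\<in>g2. \<forall>a x1 x2 x3 y1 y2 y3. N *v zorn a x1 x2 x3 y1 y2 y3 = zorn y1 (2 * a) 0 0 0 (- x3) x2"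
    "\<exists>N\<in>g2. \<forall>a x1 x2 x3 y1 y2 y3. N *v zorn a x1 x2 x3 y1 y2 y3 = zorn x1 0 y3 (- y2) (2 * a) 0 0"
    using gen g2_generators_zorn by blast+
  show "\<exists>N\<in>g2. \<forall>a x1 x2 x3 y1 y2 y3. N *v zorn a x1 x2 x3 y1 y2 y3 = zorn y2 0 (2 * a) 0 x3 0 (- x1)"
    "\<exists>N\<in>g2. \<forall>a x1 x2 x3 y1 y2 y3. N *v zorn a x1 x2 x3 y1 y2 y3 = zorn y3 0 0 (2 * a) (- x2) x1 0"
    "\<exists>N\<in>g2. \<forall>a x1 x2 x3 y1 y2 y3. N *v zorn a x1 x2 x3 y1 y2 y3 = zorn x2 (- y3) 0 y1 0 (2 * a) 0"
    "\<exists>N\<in>g2. \<forall>a x1 x2 x3 y1 y2 y3. N *v zorn a x1 x2 x3 y1 y2 y3 = zorn x3 y2 (- y1) 0 0 0 (2 * a)"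
    using in_g2 p2 m2 p3 m3 by blast+
qed

text \<open>A long root is the difference of the weights of some \<open>x_i\<close> and
  \<open>x_j\<close>, hence a sum of two short roots. Here the structure constant is 3 in absolute
  value, which explains the factor on the right-hand side.\<close>

lemma long_root_in_g2:
  assumes P: "P \<in> g2" and M: "M \<in> g2"
    and bracket: "\<And>a x1 x2 x3 y1 y2 y3. P *v (M *v zorn a x1 x2 x3 y1 y2 y3) - M *v (P *v zorn a x1 x2 x3 y1 y2 y3)
      = 3 *s F a x1 x2 x3 y1 y2 y3"
  shows "\<exists>N\<in>g2. \<forall>a x1 x2 x3 y1 y2 y3. N *v zorn a x1 x2 x3 y1 y2 y3 = F a x1 x2 x3 y1 y2 y3"
proof -
  have "(\<chi> i j. (1/3) * lie_bracket P M $ i $ j) \<in> g2"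
    by (intro g2_scale g2_bracket P M)
  moreover have "(\<chi> i j. (1/3) * lie_bracket P M $ i $ j) *v zorn a x1 x2 x3 y1 y2 y3
      = F a x1 x2 x3 y1 y2 y3" for a x1 x2 x3 y1 y2 y3
    unfolding matrix_vector_simps lie_bracket_vector bracket by (simp add: vector_smult_assoc)
  ultimately show ?thesis by blast
qed

lemma long_roots_in_g2:
  "\<exists>N\<in>g2. \<forall>a x1 x2 x3 y1 y2 y3. N *v zorn a x1 x2 x3 y1 y2 y3 = zorn 0 x2 0 0 0 (- y1) 0"
  "\<exists>N\<in>g2. \<forall>a x1 x2 x3 y1 y2 y3. N *v zorn a x1 x2 x3 y1 y2 y3 = zorn 0 x3 0 0 0 0 (- y1)"
  "\<exists>N\<in>g2. \<forall>a x1 x2 x3 y1 y2 y3. N *v zorn a x1 x2 x3 y1 y2 y3 = zorn 0 0 x1 0 (- y2) 0 0"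
  "\<exists>N\<in>g2. \<forall>a x1 x2 x3 y1 y2 y3. N *v zorn a x1 x2 x3 y1 y2 y3 = zorn 0 0 x3 0 0 0 (- y2)"
  "\<exists>N\<in>g2. \<forall>a x1 x2 x3 y1 y2 y3. N *v zorn a x1 x2 x3 y1 y2 y3 = zorn 0 0 0 x1 (- y3) 0 0"
  "\<exists>N\<in>g2. \<forall>a x1 x2 x3 y1 y2 y3. N *v zorn a x1 x2 x3 y1 y2 y3 = zorn 0 0 0 x2 0 (- y3) 0"
proof -
  obtain P1 P2 P3 M1 M2 M3 where g2: "P1 \<in> g2" "P2 \<in> g2" "P3 \<in> g2" "M1 \<in> g2" "M2 \<in> g2" "M3 \<in> g2" and N:
    "\<And>a x1 x2 x3 y1 y2 y3. P1 *v zorn a x1 x2 x3 y1 y2 y3 = zorn y1 (2 * a) 0 0 0 (- x3) x2"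
    "\<And>a x1 x2 x3 y1 y2 y3. P2 *v zorn a x1 x2 x3 y1 y2 y3 = zorn y2 0 (2 * a) 0 x3 0 (- x1)"
    "\<And>a x1 x2 x3 y1 y2 y3. P3 *v zorn a x1 x2 x3 y1 y2 y3 = zorn y3 0 0 (2 * a) (- x2) x1 0"
    "\<And>a x1 x2 x3 y1 y2 y3. M1 *v zorn a x1 x2 x3 y1 y2 y3 = zorn x1 0 y3 (- y2) (2 * a) 0 0"
    "\<And>a x1 x2 x3 y1 y2 y3. M2 *v zorn a x1 x2 x3 y1 y2 y3 = zorn x2 (- y3) 0 y1 0 (2 * a) 0"
    "\<And>a x1 x2 x3 y1 y2 y3. M3 *v zorn a x1 x2 x3 y1 y2 y3 = zorn x3 y2 (- y1) 0 0 0 (2 * a)"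
    using short_roots_in_g2 by metis
  show "\<exists>N\<in>g2. \<forall>a x1 x2 x3 y1 y2 y3. N *v zorn a x1 x2 x3 y1 y2 y3 = zorn 0 x2 0 0 0 (- y1) 0"
    by (rule long_root_in_g2[OF g2(1,5)]) (simp add: N zorn_arith)
  show "\<exists>N\<in>g2. \<forall>a x1 x2 x3 y1 y2 y3. N *v zorn a x1 x2 x3 y1 y2 y3 = zorn 0 x3 0 0 0 0 (- y1)"
    by (rule long_root_in_g2[OF g2(1,6)]) (simp add: N zorn_arith)
  show "\<exists>N\<in>g2. \<forall>a x1 x2 x3 y1 y2 y3. N *v zorn a x1 x2 x3 y1 y2 y3 = zorn 0 0 x1 0 (- y2) 0 0"
    by (rule long_root_in_g2[OF g2(2,4)]) (simp add: N zorn_arith)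
  show "\<exists>N\<in>g2. \<forall>a x1 x2 x3 y1 y2 y3. N *v zorn a x1 x2 x3 y1 y2 y3 = zorn 0 0 x3 0 0 0 (- y2)"
    by (rule long_root_in_g2[OF g2(2,6)]) (simp add: N zorn_arith)
  show "\<exists>N\<in>g2. \<forall>a x1 x2 x3 y1 y2 y3. N *v zorn a x1 x2 x3 y1 y2 y3 = zorn 0 0 0 x1 (- y3) 0 0"
    by (rule long_root_in_g2[OF g2(3,4)]) (simp add: N zorn_arith)
  show "\<exists>N\<in>g2. \<forall>a x1 x2 x3 y1 y2 y3. N *v zorn a x1 x2 x3 y1 y2 y3 = zorn 0 0 0 x2 0 (- y3) 0"
    by (rule long_root_in_g2[OF g2(3,5)]) (simp add: N zorn_arith)
qed

text \<open>\<open>F\<close> is the action of \<open>N\<close> and \<open>F'\<close> that of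
  \<open>1 + t N + t^2 N^2 / 2\<close>. Both side conditions quantify over every \<open>N\<close>
  acting by \<open>F\<close>, so that plain rewriting evaluates the iterates of
  \<open>N\<close>.\<close>

lemma root_element_zorn:
  assumes "\<exists>N\<in>g2. \<forall>a x1 x2 x3 y1 y2 y3. N *v zorn a x1 x2 x3 y1 y2 y3 = F a x1 x2 x3 y1 y2 y3"
    and "\<And>a x1 x2 x3 y1 y2 y3 N. (\<And>a x1 x2 x3 y1 y2 y3. N *v zorn a x1 x2 x3 y1 y2 y3 = F a x1 x2 x3 y1 y2 y3)
       \<Longrightarrow> N *v (N *v F a x1 x2 x3 y1 y2 y3) = 0"
    and "\<And>a x1 x2 x3 y1 y2 y3 N. (\<And>a x1 x2 x3 y1 y2 y3. N *v zorn a x1 x2 x3 y1 y2 y3 = F a x1 x2 x3 y1 y2 y3)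
       \<Longrightarrow> zorn a x1 x2 x3 y1 y2 y3 + t *s F a x1 x2 x3 y1 y2 y3 + (t^2 / 2) *s (N *v F a x1 x2 x3 y1 y2 y3)
         = F' a x1 x2 x3 y1 y2 y3"
  shows "\<exists>h\<in>carrier G2. \<forall>a x1 x2 x3 y1 y2 y3. h *v zorn a x1 x2 x3 y1 y2 y3 = F' a x1 x2 x3 y1 y2 y3"
proof -
  obtain N where N: "N \<in> g2" "\<And>a x1 x2 x3 y1 y2 y3. N *v zorn a x1 x2 x3 y1 y2 y3 = F a x1 x2 x3 y1 y2 y3"
    using assms(1) by blast
  have "N *v (N *v (N *v v)) = 0" for v
    using assms(2)[OF N(2)] N(2) by (cases v rule: zorn_cases) simp
  from root_element[OF N(1) this] obtain h where
    "h \<in> carrier G2" "\<And>v. h *v v = v + t *s (N *v v) + (t^2 / 2) *s (N *v (N *v v))" by metis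
  then have h: "h \<in> carrier G2"
    "\<And>v. h *v v = v + t *s (N *v v) + (t^2 / 2) *s (N *v (N *v v))" by blast+
  have "h *v zorn a x1 x2 x3 y1 y2 y3 = F' a x1 x2 x3 y1 y2 y3" for a x1 x2 x3 y1 y2 y3
    unfolding h(2) N(2) by (rule assms(3)[OF N(2)])
  with h(1) show ?thesis by blast
qed

text \<open>Quadratic in \<open>t\<close>, because a short root leads from its negative through the
  weight 0 to itself. The long root elements below are transvections and linear in
  \<open>t\<close>.\<close>

lemma short_root_elements:
  "\<exists>h\<in>carrier G2. \<forall>a x1 x2 x3 y1 y2 y3. h *v zorn a x1 x2 x3 y1 y2 y3
    = zorn (a + t * y1) (x1 + 2 * t * a + t^2 * y1) x2 x3 y1 (y2 - t * x3) (y3 + t * x2)"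
  "\<exists>h\<in>carrier G2. \<forall>a x1 x2 x3 y1 y2 y3. h *v zorn a x1 x2 x3 y1 y2 y3
    = zorn (a + t * x1) x1 (x2 + t * y3) (x3 - t * y2) (y1 + 2 * t * a + t^2 * x1) y2 y3"
  "\<exists>h\<in>carrier G2. \<forall>a x1 x2 x3 y1 y2 y3. h *v zorn a x1 x2 x3 y1 y2 y3
    = zorn (a + t * x2) (x1 - t * y3) x2 (x3 + t * y1) y1 (y2 + 2 * t * a + t^2 * x2) y3"
  "\<exists>h\<in>carrier G2. \<forall>a x1 x2 x3 y1 y2 y3. h *v zorn a x1 x2 x3 y1 y2 y3
    = zorn (a + t * x3) (x1 + t * y2) (x2 - t * y1) x3 y1 y2 (y3 + 2 * t * a + t^2 * x3)"
  by - (rule root_element_zorn[OF short_roots_in_g2(1), where t = t], simp add: zorn_arith zorn_eq_iff, simp add: zorn_arith zorn_eq_iff,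
      rule root_element_zorn[OF short_roots_in_g2(4), where t = t], simp add: zorn_arith zorn_eq_iff, simp add: zorn_arith zorn_eq_iff,
      rule root_element_zorn[OF short_roots_in_g2(5), where t = t], simp add: zorn_arith zorn_eq_iff, simp add: zorn_arith zorn_eq_iff,
      rule root_element_zorn[OF short_roots_in_g2(6), where t = t], simp add: zorn_arith zorn_eq_iff, simp add: zorn_arith zorn_eq_iff)

lemma long_root_elements:
  "\<exists>h\<in>carrier G2. \<forall>a x1 x2 x3 y1 y2 y3. h *v zorn a x1 x2 x3 y1 y2 y3
    = zorn a (x1 + t * x2) x2 x3 y1 (y2 - t * y1) y3"
  "\<exists>h\<in>carrier G2. \<forall>a x1 x2 x3 y1 y2 y3. h *v zorn a x1 x2 x3 y1 y2 y3
    = zorn a (x1 + t * x3) x2 x3 y1 y2 (y3 - t * y1)"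
  "\<exists>h\<in>carrier G2. \<forall>a x1 x2 x3 y1 y2 y3. h *v zorn a x1 x2 x3 y1 y2 y3
    = zorn a x1 (x2 + t * x1) x3 (y1 - t * y2) y2 y3"
  "\<exists>h\<in>carrier G2. \<forall>a x1 x2 x3 y1 y2 y3. h *v zorn a x1 x2 x3 y1 y2 y3
    = zorn a x1 (x2 + t * x3) x3 y1 y2 (y3 - t * y2)"
  "\<exists>h\<in>carrier G2. \<forall>a x1 x2 x3 y1 y2 y3. h *v zorn a x1 x2 x3 y1 y2 y3
    = zorn a x1 x2 (x3 + t * x1) (y1 - t * y3) y2 y3"
  "\<exists>h\<in>carrier G2. \<forall>a x1 x2 x3 y1 y2 y3. h *v zorn a x1 x2 x3 y1 y2 y3
    = zorn a x1 x2 (x3 + t * x2) y1 (y2 - t * y3) y3"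
  by - (rule root_element_zorn[OF long_roots_in_g2(1), where t = t], simp add: zorn_arith zorn_eq_iff, simp add: zorn_arith zorn_eq_iff,
      rule root_element_zorn[OF long_roots_in_g2(2), where t = t], simp add: zorn_arith zorn_eq_iff, simp add: zorn_arith zorn_eq_iff,
      rule root_element_zorn[OF long_roots_in_g2(3), where t = t], simp add: zorn_arith zorn_eq_iff, simp add: zorn_arith zorn_eq_iff,
      rule root_element_zorn[OF long_roots_in_g2(4), where t = t], simp add: zorn_arith zorn_eq_iff, simp add: zorn_arith zorn_eq_iff,
      rule root_element_zorn[OF long_roots_in_g2(5), where t = t], simp add: zorn_arith zorn_eq_iff, simp add: zorn_arith zorn_eq_iff,
      rule root_element_zorn[OF long_roots_in_g2(6), where t = t], simp add: zorn_arith zorn_eq_iff, simp add: zorn_arith zorn_eq_iff)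

lemma reach_rootI:
  assumes "\<exists>h\<in>carrier G2. \<forall>a x1 x2 x3 y1 y2 y3. h *v zorn a x1 x2 x3 y1 y2 y3 = F a x1 x2 x3 y1 y2 y3"
    and "F a x1 x2 x3 y1 y2 y3 = w"
    and "\<forall>v\<in>K. \<exists>a x1 x2 x3 y1 y2 y3. v = zorn a x1 x2 x3 y1 y2 y3 \<and> F a x1 x2 x3 y1 y2 y3 = v"
  shows "reach K (zorn a x1 x2 x3 y1 y2 y3) w"
  using assms unfolding reach_def fixing_def by (smt (verit) mem_Collect_eq)

lemma reach_refl: "reach K v v"
proof -
  have "mat 1 \<in> carrier G2"
    using monoid.one_closed[OF group.is_monoid[OF group_G2]] by (simp add: G2_one)
  then show ?thesis unfolding reach_def fixing_def by (intro bexI[of _ "mat 1"]) auto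
qed

lemma reach_long:
  "reach {zunit} (zorn a x1 x2 x3 y1 y2 y3) (zorn a (x1 + t * x2) x2 x3 y1 (y2 - t * y1) y3)"
  "reach {zunit} (zorn a x1 x2 x3 y1 y2 y3) (zorn a (x1 + t * x3) x2 x3 y1 y2 (y3 - t * y1))"
  "reach {zunit} (zorn a x1 x2 x3 y1 y2 y3) (zorn a x1 (x2 + t * x1) x3 (y1 - t * y2) y2 y3)"
  "reach {zunit} (zorn a x1 x2 x3 y1 y2 y3) (zorn a x1 x2 (x3 + t * x1) (y1 - t * y3) y2 y3)"
  by (rule reach_rootI[OF long_root_elements(1)[of t]] reach_rootI[OF long_root_elements(2)[of t]]
      reach_rootI[OF long_root_elements(3)[of t]] reach_rootI[OF long_root_elements(5)[of t]];
      force simp: zunit_def zorn_eq_iff)+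

text \<open>Of the transvections, these add no multiple of \<open>x1\<close> to another coordinate
  and hence fix the first basis vector of the \<open>x\<close>-space as well as
  \<open>zunit\<close>.\<close>

lemma reach_long_1:
  "reach {zunit, zorn 0 1 0 0 0 0 0} (zorn a x1 x2 x3 y1 y2 y3) (zorn a (x1 + t * x2) x2 x3 y1 (y2 - t * y1) y3)"
  "reach {zunit, zorn 0 1 0 0 0 0 0} (zorn a x1 x2 x3 y1 y2 y3) (zorn a (x1 + t * x3) x2 x3 y1 y2 (y3 - t * y1))"
  "reach {zunit, zorn 0 1 0 0 0 0 0} (zorn a x1 x2 x3 y1 y2 y3) (zorn a x1 (x2 + t * x3) x3 y1 y2 (y3 - t * y2))"
  "reach {zunit, zorn 0 1 0 0 0 0 0} (zorn a x1 x2 x3 y1 y2 y3) (zorn a x1 x2 (x3 + t * x2) y1 (y2 - t * y3) y3)"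
  by (rule reach_rootI[OF long_root_elements(1)[of t]] reach_rootI[OF long_root_elements(2)[of t]]
      reach_rootI[OF long_root_elements(4)[of t]] reach_rootI[OF long_root_elements(6)[of t]];
      force simp: zunit_def zorn_eq_iff)+

lemma reach_long_2:
  "reach {zunit, zorn 0 1 0 0 0 0 0, zorn 0 0 1 0 0 0 0} (zorn a x1 x2 x3 y1 y2 y3) (zorn a (x1 + t * x3) x2 x3 y1 y2 (y3 - t * y1))"
  "reach {zunit, zorn 0 1 0 0 0 0 0, zorn 0 0 1 0 0 0 0} (zorn a x1 x2 x3 y1 y2 y3) (zorn a x1 (x2 + t * x3) x3 y1 y2 (y3 - t * y2))"
  by (rule reach_rootI[OF long_root_elements(2)[of t]] reach_rootI[OF long_root_elements(4)[of t]];
      force simp: zunit_def zorn_eq_iff)+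

lemma reach_short:
  "reach {} (zorn a x1 x2 x3 y1 y2 y3) (zorn (a + t * y1) (x1 + 2 * t * a + t^2 * y1) x2 x3 y1 (y2 - t * x3) (y3 + t * x2))"
  "reach {} (zorn a x1 x2 x3 y1 y2 y3) (zorn (a + t * x1) x1 (x2 + t * y3) (x3 - t * y2) (y1 + 2 * t * a + t^2 * x1) y2 y3)"
  "reach {} (zorn a x1 x2 x3 y1 y2 y3) (zorn (a + t * x2) (x1 - t * y3) x2 (x3 + t * y1) y1 (y2 + 2 * t * a + t^2 * x2) y3)"
  "reach {} (zorn a x1 x2 x3 y1 y2 y3) (zorn (a + t * x3) (x1 + t * y2) (x2 - t * y1) x3 y1 y2 (y3 + 2 * t * a + t^2 * x3))"
  by (rule reach_rootI[OF short_root_elements(1)[of t]] reach_rootI[OF short_root_elements(2)[of t]]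
      reach_rootI[OF short_root_elements(3)[of t]] reach_rootI[OF short_root_elements(4)[of t]];
      simp)+

text \<open>If another \<open>x\<close>-coordinate is nonzero, a multiple of it turns
  \<open>x1\<close> into 1, after which \<open>x1\<close> clears the rest; if only \<open>x1\<close>
  is nonzero, it is first copied to \<open>x2\<close>. The \<open>y\<close>-coordinates change along
  the way, whence the existential quantifier.\<close>

lemma reach_first_axis:
  assumes "x1 \<noteq> 0 \<or> x2 \<noteq> 0 \<or> x3 \<noteq> 0"
  shows "\<exists>y1' y2' y3'. reach {zunit} (zorn a x1 x2 x3 y1 y2 y3) (zorn a 1 0 0 y1' y2' y3')"
proof -
  have clear: "\<exists>y1' y2' y3'. reach {zunit} (zorn a 1 x2 x3 y1 y2 y3) (zorn a 1 0 0 y1' y2' y3')"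
    for x2 x3 y1 y2 y3
    using reach_trans[OF reach_long(3)[of a 1 x2 x3 y1 y2 y3 "- x2"] reach_long(4)[where t = "- x3"]]
    by auto
  have two: "\<exists>y1' y2' y3'. reach {zunit} (zorn a x1 x2 x3 y1 y2 y3) (zorn a 1 0 0 y1' y2' y3')"
    if "x2 \<noteq> 0" for x1 x2 x3 y1 y2 y3
    using reach_long(1)[of a x1 x2 x3 y1 y2 y3 "(1 - x1) / x2"] clear reach_trans that
    by simp blast
  consider "x2 \<noteq> 0" | "x3 \<noteq> 0" | "x1 \<noteq> 0" "x2 = 0" using assms by blast
  then show ?thesis
  proof cases
    case 1 then show ?thesis by (rule two)
  next
    case 2
    then show ?thesis
      using reach_long(2)[of a x1 x2 x3 y1 y2 y3 "(1 - x1) / x3"] clear reach_trans by simp blast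
  next
    case 3
    then show ?thesis
      using reach_long(3)[of a x1 x2 x3 y1 y2 y3 1] two[of x1] reach_trans by simp blast
  qed
qed

lemma reach_unit:
  assumes "qform v v = 1"
  shows "reach {} v zunit"
proof -
  have Q: "qform w w = 1" if "reach {} v w" for w
    using that assms fixing_zautD zautD(1) unfolding reach_def by metis
  obtain a x1 x2 x3 y1 y2 y3 where v: "v = zorn a x1 x2 x3 y1 y2 y3" by (rule zorn_cases)
  have "\<exists>a x1 x2 x3 y1 y2 y3. reach {} v (zorn a x1 x2 x3 y1 y2 y3) \<and> (x1 \<noteq> 0 \<or> x2 \<noteq> 0 \<or> x3 \<noteq> 0)"
  proof (cases "x1 = 0 \<and> x2 = 0 \<and> x3 = 0")
    case True
    then have "a \<noteq> 0" using assms by (auto simp: v qform_zorn)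
    \<comment> \<open>With \<open>x = 0\<close> the root element of parameter \<open>t\<close> puts
      \<open>2 t a + t^2 y1\<close> into \<open>x1\<close>. Since \<open>a\<close> is nonzero,
      \<open>t = 1\<close> and \<open>t = -1\<close> cannot both give 0.\<close>
    then have "2 * a + y1 \<noteq> 0 \<or> y1 - 2 * a \<noteq> 0"
      by (auto simp: add_eq_0_iff)
    moreover have "reach {} v (zorn (a + y1) (2 * a + y1) 0 0 y1 y2 y3)"
      "reach {} v (zorn (a - y1) (y1 - 2 * a) 0 0 y1 y2 y3)"
      using reach_short(1)[of a x1 x2 x3 y1 y2 y3 1] reach_short(1)[of a x1 x2 x3 y1 y2 y3 "-1"] True
      by (simp_all add: v)
    ultimately show ?thesis by blast
  next
    case False
    then show ?thesis using reach_refl v by blast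
  qed
  then obtain a y1 y2 y3 where "reach {} v (zorn a 1 0 0 y1 y2 y3)"
    using reach_first_axis reach_mono[OF _ empty_subsetI] reach_trans by meson
  \<comment> \<open>This adds \<open>t x1 = 1 - a\<close> to the coordinate of weight 0. It spoils
    \<open>x2\<close> and \<open>x3\<close>, which are repaired next by elements that keep that
    coordinate.\<close>
  from reach_trans[OF this reach_short(2)[where t = "1 - a"]]
  obtain x2 x3 y1 y2 y3 where "reach {} v (zorn 1 1 x2 x3 y1 y2 y3)" by auto
  then obtain y1 y2 y3 where r: "reach {} v (zorn 1 1 0 0 y1 y2 y3)"
    using reach_first_axis[of 1] reach_mono[OF _ empty_subsetI] reach_trans zero_neq_one by metis
  \<comment> \<open>The norm now reads \<open>1 - y1\<close>. With \<open>y1 = 0\<close> the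
    parameter \<open>-1/2\<close> lowers \<open>x1\<close> by 1 and changes nothing else.\<close>
  from Q[OF r] have "y1 = 0" by (simp add: qform_zorn)
  with reach_trans[OF r reach_short(1)[where t = "- 1 / 2"]]
  have r: "reach {} v (zorn 1 0 0 0 0 y2 y3)" by simp
  show ?thesis
  proof (cases "y2 = 0")
    case True
    with reach_trans[OF r reach_short(4)[where t = "- y3 / 2"]] show ?thesis
      by (simp add: zunit_def)
  next
    case False
    have "reach {} v (zorn 1 0 0 0 0 y2 0)"
      using reach_trans[OF r reach_mono[OF reach_long_1(3)[where t = "y3 / y2"] empty_subsetI]] False by simp
    from reach_trans[OF this reach_short(3)[where t = "- y2 / 2"]] show ?thesis
      by (simp add: zunit_def)
  qed
qed

section \<open>The stabiliser of the zero weight vector\<close>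

lemma zaut_fixing_unit:
  assumes M: "M \<in> zaut" and u: "M *v zunit = zunit"
  obtains x1' x2' x3' where "M *v zorn 0 x1 x2 x3 0 0 0 = zorn 0 x1' x2' x3' 0 0 0"
proof -
  obtain a x1' x2' x3' y1 y2 y3 where w: "M *v zorn 0 x1 x2 x3 0 0 0 = zorn a x1' x2' x3' y1 y2 y3"
    by (rule zorn_cases)
  \<comment> \<open>Multiplication by \<open>zunit\<close> is 0 on its own line, 1 on the
    \<open>x\<close>-space and -1 on the \<open>y\<close>-space. An automorphism that fixes
    \<open>zunit\<close> commutes with it and so preserves the \<open>x\<close>-space.\<close>
  have "cprod zunit (M *v zorn 0 x1 x2 x3 0 0 0) = M *v cprod zunit (zorn 0 x1 x2 x3 0 0 0)"
    using zautD(2)[OF M, of zunit] by (simp add: u)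
  also have "\<dots> = M *v zorn 0 x1 x2 x3 0 0 0"
    by (simp add: zunit_def cprod_zorn)
  finally have "a = 0 \<and> y1 = 0 \<and> y2 = 0 \<and> y3 = 0"
    by (simp add: w zunit_def cprod_zorn zorn_eq_iff)
  with w that show thesis by simp
qed

text \<open>Elimination column by column: \<open>h1\<close>, \<open>h2\<close>, \<open>h3\<close>
  put the images of the three basis vectors of the \<open>x\<close>-space back into place, each
  without moving the earlier ones. By \<open>zaut_eqI\<close> the result is the identity.\<close>

lemma zaut_fixing_unit_in_G2:
  assumes M: "M \<in> zaut" and u: "M *v zunit = zunit"
  shows "M \<in> carrier G2"
proof -
  let ?x1 = "zorn 0 1 0 0 0 0 0" and ?x2 = "zorn 0 0 1 0 0 0 0" and ?x3 = "zorn 0 0 0 1 0 0 0"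
  have inj: "N *v v = N *v w \<Longrightarrow> v = w" if "N \<in> zaut" for N and v w :: "complex^7"
    using zaut_invertible[OF that] by (metis inj_matrix_vector_mult injD)
  obtain b1 b2 b3 where b: "M *v ?x1 = zorn 0 b1 b2 b3 0 0 0"
    using zaut_fixing_unit[OF M u] by blast
  have "M *v ?x1 \<noteq> M *v 0"
    using inj[OF M, of ?x1 0] by (auto simp: zorn_arith(5) zorn_eq_iff)
  then have "b1 \<noteq> 0 \<or> b2 \<noteq> 0 \<or> b3 \<noteq> 0"
    unfolding b matrix_vector_simps by (auto simp: zorn_arith(5))
  from reach_first_axis[OF this, of 0 0 0 0] obtain h1 y1 y2 y3 where h1: "h1 \<in> fixing {zunit}"
    and h1b: "h1 *v zorn 0 b1 b2 b3 0 0 0 = zorn 0 1 0 0 y1 y2 y3"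
    unfolding reach_def by blast
  define M1 where "M1 = h1 ** M"
  have M1: "M1 \<in> zaut" "M1 *v zunit = zunit"
    unfolding M1_def using h1 M u fixing_zautD[OF h1]
    by (auto simp: zaut_mult fixing_def simp flip: matrix_vector_mul_assoc)
  have M1x1: "M1 *v ?x1 = ?x1"
    using zaut_fixing_unit[OF M1, of 1 0 0]
    by (auto simp: M1_def b h1b zorn_eq_iff simp flip: matrix_vector_mul_assoc)
  obtain c1 c2 c3 where c: "M1 *v ?x2 = zorn 0 c1 c2 c3 0 0 0"
    using zaut_fixing_unit[OF M1] by blast
  have "c2 \<noteq> 0 \<or> c3 \<noteq> 0"
  proof (rule ccontr)
    assume "\<not> ?thesis"
    then have "M1 *v ?x2 = c1 *s ?x1"
      by (simp add: c zorn_arith(4))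
    also have "\<dots> = M1 *v (c1 *s ?x1)"
      by (simp only: matrix_vector_simps M1x1)
    finally have "M1 *v ?x2 = M1 *v (c1 *s ?x1)" .
    from inj[OF M1(1) this] show False by (simp add: zorn_arith zorn_eq_iff)
  qed
  have "reach {zunit, ?x1} (zorn 0 c1 c2 c3 0 0 0) ?x2"
  proof -
    have *: "reach {zunit, ?x1} (zorn 0 c1 c2 c3 0 0 0) ?x2" if "c3 \<noteq> 0" for c1 c2 c3
    proof -
      have "reach {zunit, ?x1} (zorn 0 c1 c2 c3 0 0 0) (zorn 0 c1 1 c3 0 0 0)"
        using reach_long_1(3)[of 0 c1 c2 c3 0 0 0 "(1 - c2) / c3"] that by simp
      also have "reach {zunit, ?x1} \<dots> (zorn 0 c1 1 0 0 0 0)"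
        using reach_long_1(4)[of 0 c1 1 c3 0 0 0 "- c3"] by simp
      also have "reach {zunit, ?x1} \<dots> (zorn 0 0 1 0 0 0 0)"
        using reach_long_1(1)[of 0 c1 1 0 0 0 0 "- c1"] by simp
      finally show ?thesis .
    qed
    show ?thesis
    proof (cases "c3 = 0")
      case True
      with \<open>c2 \<noteq> 0 \<or> c3 \<noteq> 0\<close> have "c2 \<noteq> 0" by simp
      from reach_trans[OF reach_long_1(4)[of 0 c1 c2 c3 0 0 0 1]] *[of c2] this True show ?thesis by simp
    qed (rule *)
  qed
  then obtain h2 where h2: "h2 \<in> fixing {zunit, ?x1}" and h2c: "h2 *v zorn 0 c1 c2 c3 0 0 0 = ?x2"
    unfolding reach_def by blast
  define M2 where "M2 = h2 ** M1"
  have M2: "M2 \<in> zaut" "M2 *v zunit = zunit" "M2 *v ?x1 = ?x1" "M2 *v ?x2 = ?x2"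
    unfolding M2_def using h2 M1 M1x1 fixing_zautD[OF h2] c h2c
    by (auto simp: zaut_mult fixing_def simp flip: matrix_vector_mul_assoc)
  obtain d1 d2 d3 where d: "M2 *v ?x3 = zorn 0 d1 d2 d3 0 0 0"
    using zaut_fixing_unit[OF M2(1,2)] by blast
  \<comment> \<open>On the \<open>x\<close>-space \<open>triple\<close> is a multiple of the
    determinant, so its invariance leaves only 1 for the last diagonal entry.\<close>
  have "triple (M2 *v ?x1) (M2 *v ?x2) (M2 *v ?x3) = triple ?x1 ?x2 ?x3"
    by (simp add: triple_def zautD[OF M2(1)])
  then have d3: "d3 = 1"
    by (simp add: M2 d triple_def cprod_zorn qform_zorn)
  have "reach {zunit, ?x1, ?x2} (zorn 0 d1 d2 d3 0 0 0) ?x3"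
  proof -
    have "reach {zunit, ?x1, ?x2} (zorn 0 d1 d2 d3 0 0 0) (zorn 0 0 d2 1 0 0 0)"
      using reach_long_2(1)[of 0 d1 d2 d3 0 0 0 "- d1"] d3 by simp
    also have "reach {zunit, ?x1, ?x2} \<dots> ?x3"
      using reach_long_2(2)[of 0 0 d2 1 0 0 0 "- d2"] by simp
    finally show ?thesis .
  qed
  then obtain h3 where h3: "h3 \<in> fixing {zunit, ?x1, ?x2}" and h3d: "h3 *v zorn 0 d1 d2 d3 0 0 0 = ?x3"
    unfolding reach_def by blast
  have "h3 ** M2 = mat 1"
    using h3 fixing_zautD[OF h3] M2 d h3d
    by (intro zaut_eqI) (auto simp: zaut_mult zaut_one fixing_def simp flip: matrix_vector_mul_assoc)
  then have one: "(h3 ** h2 ** h1) ** M = mat 1"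
    by (simp add: M2_def M1_def matrix_mul_assoc)
  have H: "h3 ** h2 ** h1 \<in> carrier G2"
    using h1 h2 h3 by (simp add: fixing_def G2_closed)
  have "M = inv\<^bsub>G2\<^esub> (h3 ** h2 ** h1) ** (h3 ** h2 ** h1) ** M"
    by (simp only: G2_inverse[OF H] matrix_mul_lid)
  also have "\<dots> = inv\<^bsub>G2\<^esub> (h3 ** h2 ** h1) ** ((h3 ** h2 ** h1) ** M)"
    by (rule matrix_mul_assoc[symmetric])
  also have "\<dots> = inv\<^bsub>G2\<^esub> (h3 ** h2 ** h1)"
    by (simp only: one matrix_mul_rid)
  finally have "M = inv\<^bsub>G2\<^esub> (h3 ** h2 ** h1)" .
  with G2_inverse(1)[OF H] show ?thesis by simp
qed

theorem carrier_G2: "carrier G2 = zaut"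
proof
  show "zaut \<subseteq> carrier G2"
  proof
    fix M assume M: "M \<in> zaut"
    then have "qform (M *v zunit) (M *v zunit) = 1"
      by (simp add: zautD zunit_def qform_zorn)
    then obtain h where h: "h \<in> carrier G2" "h *v (M *v zunit) = zunit"
      using reach_unit unfolding reach_def fixing_def by blast
    then have "h ** M \<in> carrier G2"
      using M G2_subset_zaut
      by (intro zaut_fixing_unit_in_G2) (auto simp: zaut_mult simp flip: matrix_vector_mul_assoc)
    then have "inv\<^bsub>G2\<^esub> h ** (h ** M) \<in> carrier G2"
      using G2_inverse(1)[OF h(1)] by (rule G2_closed[rotated])
    then show "M \<in> carrier G2" by (simp add: matrix_mul_assoc G2_inverse[OF h(1)])
  qed
qed (rule G2_subset_zaut)

section \<open>Tetrahedral subgroups in standard position\<close>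

definition zmat :: "complex^7 \<Rightarrow> complex^7 \<Rightarrow> complex^7 \<Rightarrow> complex^7 \<Rightarrow> complex^7 \<Rightarrow> complex^7 \<Rightarrow> complex^7 \<Rightarrow> complex^7^7" where
  "zmat U X1 X2 X3 Y1 Y2 Y3 = matrix (\<lambda>v. v $ 4 *s U + v $ 3 *s X1 + v $ 2 *s X2 + v $ 7 *s X3
    + v $ 5 *s Y1 + (- v $ 6) *s Y2 + v $ 1 *s Y3)"

lemma zmat_zorn:
  "zmat U X1 X2 X3 Y1 Y2 Y3 *v zorn a x1 x2 x3 y1 y2 y3 = a *s U
     + x1 *s X1 + x2 *s X2 + x3 *s X3 + y1 *s Y1 + y2 *s Y2 + y3 *s Y3"
proof -
  let ?f = "\<lambda>v :: complex^7. v $ 4 *s U + v $ 3 *s X1 + v $ 2 *s X2 + v $ 7 *s X3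
    + v $ 5 *s Y1 + (- v $ 6) *s Y2 + v $ 1 *s Y3"
  have "Vector_Spaces.linear (*s) (*s) ?f"
    by unfold_locales (simp_all add: vec_eq_iff algebra_simps)
  then show ?thesis
    by (simp add: zmat_def matrix_works zorn_nth)
qed

lemma zautI_zorn:
  assumes "\<And>a x1 x2 x3 y1 y2 y3 a' x1' x2' x3' y1' y2' y3'.
     qform (M *v zorn a x1 x2 x3 y1 y2 y3) (M *v zorn a' x1' x2' x3' y1' y2' y3')
     = qform (zorn a x1 x2 x3 y1 y2 y3) (zorn a' x1' x2' x3' y1' y2' y3')"
    and "\<And>a x1 x2 x3 y1 y2 y3 a' x1' x2' x3' y1' y2' y3'.
     cprod (M *v zorn a x1 x2 x3 y1 y2 y3) (M *v zorn a' x1' x2' x3' y1' y2' y3')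
     = M *v cprod (zorn a x1 x2 x3 y1 y2 y3) (zorn a' x1' x2' x3' y1' y2' y3')"
  shows "M \<in> zaut"
  unfolding zaut_def
proof (intro CollectI conjI allI)
  fix v w
  obtain a x1 x2 x3 y1 y2 y3 where v: "v = zorn a x1 x2 x3 y1 y2 y3" by (rule zorn_cases)
  obtain a' x1' x2' x3' y1' y2' y3' where w: "w = zorn a' x1' x2' x3' y1' y2' y3'" by (rule zorn_cases)
  show "qform (M *v v) (M *v w) = qform v w" "cprod (M *v v) (M *v w) = M *v cprod v w"
    unfolding v w by (rule assms)+
qed

text \<open>The matrix with columns \<open>p\<close>, \<open>q\<close>, \<open>r\<close> on the
  \<open>x\<close>-space. On the \<open>y\<close>-space it acts by the cofactor matrix, which for
  determinant one is the inverse transpose; its columns are the cross products of the columns of the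
  first.\<close>

definition sl3 :: "complex \<Rightarrow> complex \<Rightarrow> complex \<Rightarrow> complex \<Rightarrow> complex \<Rightarrow> complex \<Rightarrow> complex \<Rightarrow> complex \<Rightarrow> complex \<Rightarrow> complex^7^7" where
  "sl3 p1 p2 p3 q1 q2 q3 r1 r2 r3 = zmat zunit (zorn 0 p1 p2 p3 0 0 0) (zorn 0 q1 q2 q3 0 0 0) (zorn 0 r1 r2 r3 0 0 0)
     (zorn 0 0 0 0 (q2 * r3 - q3 * r2) (q3 * r1 - q1 * r3) (q1 * r2 - q2 * r1))
     (zorn 0 0 0 0 (r2 * p3 - r3 * p2) (r3 * p1 - r1 * p3) (r1 * p2 - r2 * p1))
     (zorn 0 0 0 0 (p2 * q3 - p3 * q2) (p3 * q1 - p1 * q3) (p1 * q2 - p2 * q1))"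

lemma sl3_zorn:
  "sl3 p1 p2 p3 q1 q2 q3 r1 r2 r3 *v zorn a x1 x2 x3 y1 y2 y3 = zorn a
     (p1 * x1 + q1 * x2 + r1 * x3) (p2 * x1 + q2 * x2 + r2 * x3) (p3 * x1 + q3 * x2 + r3 * x3)
     ((q2 * r3 - q3 * r2) * y1 + (r2 * p3 - r3 * p2) * y2 + (p2 * q3 - p3 * q2) * y3)
     ((q3 * r1 - q1 * r3) * y1 + (r3 * p1 - r1 * p3) * y2 + (p3 * q1 - p1 * q3) * y3)
     ((q1 * r2 - q2 * r1) * y1 + (r1 * p2 - r2 * p1) * y2 + (p1 * q2 - p2 * q1) * y3)"
  by (simp add: sl3_def zmat_zorn zunit_def zorn_arith zorn_eq_iff algebra_simps)

definition det3 :: "complex \<Rightarrow> complex \<Rightarrow> complex \<Rightarrow> complex \<Rightarrow> complex \<Rightarrow> complex \<Rightarrow> complex \<Rightarrow> complex \<Rightarrow> complex \<Rightarrow> complex" where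
  "det3 p1 p2 p3 q1 q2 q3 r1 r2 r3 =
    p1 * (q2 * r3 - q3 * r2) + p2 * (q3 * r1 - q1 * r3) + p3 * (q1 * r2 - q2 * r1)"

lemma sl3_in_zaut:
  assumes "det3 p1 p2 p3 q1 q2 q3 r1 r2 r3 = 1"
  shows "sl3 p1 p2 p3 q1 q2 q3 r1 r2 r3 \<in> zaut"
proof (rule zautI_zorn, goal_cases)
  case (1 a x1 x2 x3 y1 y2 y3 a' x1' x2' x3' y1' y2' y3')
  let ?d = "det3 p1 p2 p3 q1 q2 q3 r1 r2 r3"
  \<comment> \<open>With the determinant kept as a factor, this is a polynomial identity valid for
    every matrix; the value 1 is inserted only afterwards.\<close>
  have "qform (sl3 p1 p2 p3 q1 q2 q3 r1 r2 r3 *v zorn a x1 x2 x3 y1 y2 y3)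
      (sl3 p1 p2 p3 q1 q2 q3 r1 r2 r3 *v zorn a' x1' x2' x3' y1' y2' y3')
     = a * a' - ?d * (x1 * y1' + x2 * y2' + x3 * y3' + y1 * x1' + y2 * x2' + y3 * x3') / 2"
    unfolding sl3_zorn qform_zorn det3_def by (simp add: field_simps)
  then show ?case by (simp add: assms qform_zorn)
next
  case (2 a x1 x2 x3 y1 y2 y3 a' x1' x2' x3' y1' y2' y3')
  let ?d = "det3 p1 p2 p3 q1 q2 q3 r1 r2 r3"
  have "cprod (sl3 p1 p2 p3 q1 q2 q3 r1 r2 r3 *v zorn a x1 x2 x3 y1 y2 y3)
      (sl3 p1 p2 p3 q1 q2 q3 r1 r2 r3 *v zorn a' x1' x2' x3' y1' y2' y3')
     = sl3 p1 p2 p3 q1 q2 q3 r1 r2 r3 *v zorn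
     (- ?d * (x1 * y1' + x2 * y2' + x3 * y3' - y1 * x1' - y2 * x2' - y3 * x3') / 2)
     (a * x1' - a' * x1 + ?d * (y2 * y3' - y3 * y2'))
     (a * x2' - a' * x2 + ?d * (y3 * y1' - y1 * y3'))
     (a * x3' - a' * x3 + ?d * (y1 * y2' - y2 * y1'))
     (a' * y1 - a * y1' + x2 * x3' - x3 * x2')
     (a' * y2 - a * y2' + x3 * x1' - x1 * x3')
     (a' * y3 - a * y3' + x1 * x2' - x2 * x1')"
    unfolding sl3_zorn cprod_zorn det3_def zorn_eq_iff by (intro conjI; simp add: field_simps)
  then show ?case unfolding assms cprod_zorn by (simp add: add_diff_eq)
qed

text \<open>The rotation group of a regular tetrahedron on the \<open>x\<close>-space: the diagonal
  sign matrices of determinant one and the cyclic permutation of the coordinates.\<close>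

definition std_a :: "complex^7^7" where "std_a = sl3 1 0 0 0 (-1) 0 0 0 (-1)"
definition std_b :: "complex^7^7" where "std_b = sl3 (-1) 0 0 0 1 0 0 0 (-1)"
definition std_s :: "complex^7^7" where "std_s = sl3 0 1 0 0 0 1 1 0 0"

lemma std_zorn:
  "std_a *v zorn a x1 x2 x3 y1 y2 y3 = zorn a x1 (- x2) (- x3) y1 (- y2) (- y3)"
  "std_b *v zorn a x1 x2 x3 y1 y2 y3 = zorn a (- x1) x2 (- x3) (- y1) y2 (- y3)"
  "std_s *v zorn a x1 x2 x3 y1 y2 y3 = zorn a x3 x1 x2 y3 y1 y2"
  by (simp_all add: std_a_def std_b_def std_s_def sl3_zorn)

lemma std_in_zaut: "std_a \<in> zaut" "std_b \<in> zaut" "std_s \<in> zaut"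
  unfolding std_a_def std_b_def std_s_def by (intro sl3_in_zaut, simp add: det3_def)+

text \<open>Conjugation by \<open>s\<close> takes \<open>a\<close> to \<open>b\<close> and
  \<open>b\<close> to \<open>a b\<close>. Every nontrivial normal subgroup of the alternating group
  on four letters contains the Klein four-group, so \<open>a \<noteq> mat 1\<close> expresses that
  the copy is faithful.\<close>

definition tetra :: "complex^7^7 \<Rightarrow> complex^7^7 \<Rightarrow> complex^7^7 \<Rightarrow> bool" where
  "tetra a b s \<longleftrightarrow> a \<in> zaut \<and> b \<in> zaut \<and> s \<in> zaut \<and> a ** a = mat 1 \<and> b ** b = mat 1 \<and> a ** b = b ** a \<and>
     a \<noteq> mat 1 \<and> s ** s ** s = mat 1 \<and> s ** a = b ** s \<and> s ** b = a ** b ** s"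

text \<open>Oriented so that \<open>s\<close> moves outwards past \<open>a\<close> and
  \<open>b\<close>.\<close>

lemma tetra_vector:
  assumes "tetra a b s"
  shows "a *v (a *v v) = v" "b *v (b *v v) = v" "b *v (a *v v) = a *v (b *v v)"
    "s *v (s *v (s *v v)) = v" "b *v (s *v v) = s *v (a *v v)" "a *v (b *v (s *v v)) = s *v (b *v v)"
    "a *v (s *v v) = s *v (a *v (b *v v))"
proof -
  have e: "a ** a = mat 1" "b ** b = mat 1" "b ** a = a ** b" "s ** (s ** s) = mat 1"
    "b ** s = s ** a" "a ** (b ** s) = s ** b"
    using assms by (simp_all add: tetra_def matrix_mul_assoc)
  then have "a ** s = s ** (a ** b)"
    by (metis matrix_mul_assoc matrix_mul_lid)
  note e = e this
  show "a *v (a *v v) = v" "b *v (b *v v) = v" "b *v (a *v v) = a *v (b *v v)"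
    "s *v (s *v (s *v v)) = v" "b *v (s *v v) = s *v (a *v v)" "a *v (b *v (s *v v)) = s *v (b *v v)"
    "a *v (s *v v) = s *v (a *v (b *v v))"
    using e[THEN arg_cong[where f = "\<lambda>M. M *v v"]] by (simp_all flip: matrix_vector_mul_assoc)
qed

lemma zaut_two_sided_inverse:
  assumes "h \<in> zaut"
  obtains h' where "h' \<in> zaut" "h ** h' = mat 1" "h' ** h = mat 1"
  using zaut_invertible[OF assms] zaut_inverse[OF assms] by (auto simp: invertible_def)

lemma tetra_conj:
  assumes t: "tetra a b s" and h: "h \<in> zaut" "h' \<in> zaut" "h ** h' = mat 1" "h' ** h = mat 1"
  shows "tetra (h ** a ** h') (h ** b ** h') (h ** s ** h')"
proof -
  have c: "(h ** x ** h') ** (h ** y ** h') = h ** (x ** y) ** h'" for x y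
    by (metis h(4) matrix_mul_assoc matrix_mul_lid)
  have "h ** a ** h' \<noteq> mat 1"
  proof
    assume "h ** a ** h' = mat 1"
    moreover have "(h' ** h) ** a ** (h' ** h) = h' ** (h ** a ** h') ** h"
      by (simp only: matrix_mul_assoc)
    ultimately have "a = mat 1" using h(4) by simp
    then show False using t by (simp add: tetra_def)
  qed
  with t h show ?thesis
    unfolding tetra_def c by (simp add: zaut_mult)
qed

text \<open>The form pairs each weight space of the Klein four-group with itself and is
  nondegenerate there. Of two isotropic vectors with nonzero pairing the sum is anisotropic, and a
  complex square root normalises it.\<close>

lemma zaut_eigen_unit:
  assumes "tetra a b s" and \<sigma>: "\<sigma> = 1 \<or> \<sigma> = -1" and \<tau>: "\<tau> = 1 \<or> \<tau> = -1"
    and v: "a *v v = \<sigma> *s v" "b *v v = \<tau> *s v" "v \<noteq> 0"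
  obtains w where "a *v w = \<sigma> *s w" "b *v w = \<tau> *s w" "qform w w = 1"
proof -
  note T = tetra_vector[OF assms(1)]
  have Z: "a \<in> zaut" "b \<in> zaut" using assms(1) by (auto simp: tetra_def)
  have sq: "\<sigma> * \<sigma> = 1" "\<tau> * \<tau> = 1" using \<sigma> \<tau> by auto
  obtain w' where w': "qform v w' \<noteq> 0" using qform_nondegenerate v(3) by blast
  \<comment> \<open>Four times the projection of \<open>w'\<close> to the weight space. As
    \<open>v\<close> has the same weight, the pairing with \<open>v\<close> is only multiplied by
    4.\<close>
  define w where "w = w' + \<sigma> *s (a *v w') + \<tau> *s (b *v w') + (\<sigma> * \<tau>) *s (a *v (b *v w'))"
  have w: "a *v w = \<sigma> *s w" "b *v w = \<tau> *s w"
    unfolding w_def matrix_vector_simps T vec.scale_right_distrib vec.scale_scale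
    using sq by (simp_all add: algebra_simps)
  have Qa: "qform v (a *v z) = \<sigma> * qform v z" and Qb: "qform v (b *v z) = \<tau> * qform v z" for z
    using zautD(1)[OF Z(1), of v "a *v z"] zautD(1)[OF Z(2), of v "b *v z"]
    by (simp_all add: T v qform_linear)
  have "qform v w = (1 + \<sigma> * \<sigma> + \<tau> * \<tau> + (\<sigma> * \<sigma>) * (\<tau> * \<tau>)) * qform v w'"
    unfolding w_def qform_linear Qa Qb by (simp add: algebra_simps)
  then have vw: "qform v w \<noteq> 0" using w' by (simp add: sq)
  have "\<exists>z. a *v z = \<sigma> *s z \<and> b *v z = \<tau> *s z \<and> qform z z \<noteq> 0"
  proof (cases "qform v v = 0 \<and> qform w w = 0")
    case True
    then have "qform (v + w) (v + w) = 2 * qform v w"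
      by (simp add: qform_linear qform_commute[of w v])
    with vw v w show ?thesis
      by (intro exI[of _ "v + w"]) (simp add: matrix_vector_simps vec.scale_right_distrib)
  qed (use v w in blast)
  then obtain z where z: "a *v z = \<sigma> *s z" "b *v z = \<tau> *s z" "qform z z \<noteq> 0" by blast
  have "csqrt (qform z z) * csqrt (qform z z) = qform z z"
    by (simp flip: power2_eq_square)
  with z show thesis
    by (intro that[of "(1 / csqrt (qform z z)) *s z"])
      (simp_all add: matrix_vector_simps qform_linear vector_smult_assoc mult.commute)
qed

text \<open>\<open>s\<close> permutes the three nontrivial weights of the Klein four-group
  cyclically, so all occur as soon as one does, and \<open>a \<noteq> mat 1\<close> provides
  one.\<close>

lemma tetra_nontrivial_eigen:
  assumes "tetra a b s" and "(\<sigma>, \<tau>) \<in> {(1, -1), (-1, 1), (-1, -1)}"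
  obtains w where "a *v w = \<sigma> *s w" "b *v w = \<tau> *s w" "qform w w = 1"
proof -
  note T = tetra_vector[OF assms(1)]
  have s0: "s *v v \<noteq> 0" if "v \<noteq> 0" for v
    using T(4)[of v] that by (auto simp: matrix_vector_simps)
  have s1: "a *v (s *v v) = -1 *s (s *v v)" "b *v (s *v v) = 1 *s (s *v v)"
    if "a *v v = 1 *s v" "b *v v = -1 *s v" for v
    using that by (simp_all add: T matrix_vector_simps)
  have s2: "a *v (s *v v) = -1 *s (s *v v)" "b *v (s *v v) = -1 *s (s *v v)"
    if "a *v v = -1 *s v" "b *v v = 1 *s v" for v
    using that by (simp_all add: T matrix_vector_simps)
  have s3: "a *v (s *v v) = 1 *s (s *v v)" "b *v (s *v v) = -1 *s (s *v v)"
    if "a *v v = -1 *s v" "b *v v = -1 *s v" for v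
    using that by (simp_all add: T matrix_vector_simps)
  obtain v where "a *v v \<noteq> v"
    using assms(1) unfolding tetra_def by (metis matrix_eq matrix_vector_mul_lid)
  define w where "w = v - a *v v"
  have w: "w \<noteq> 0" "a *v w = -1 *s w"
    using \<open>a *v v \<noteq> v\<close> by (simp_all add: w_def matrix_vector_simps T)
  let ?E = "\<lambda>\<sigma> \<tau>. \<exists>z. z \<noteq> 0 \<and> a *v z = \<sigma> *s z \<and> b *v z = \<tau> *s z"
  have "?E (-1) 1 \<or> ?E (-1) (-1)"
  proof (cases "w + b *v w = 0")
    case True
    then have "b *v w = -1 *s w" by (simp add: eq_neg_iff_add_eq_0 add.commute)
    with w show ?thesis by blast
  next
    case False
    with w(2) show ?thesis
      by (intro disjI1 exI[of _ "w + b *v w"])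
        (simp add: matrix_vector_simps T flip: T(3))
  qed
  then have "?E 1 (-1) \<and> ?E (-1) 1 \<and> ?E (-1) (-1)"
    using s0 s1 s2 s3 by meson
  with assms(2) have "?E \<sigma> \<tau>" by auto
  then show thesis
    using zaut_eigen_unit[OF assms(1), of \<sigma> \<tau>] assms(2) that by auto
qed

text \<open>
  Without a fixed vector of the Klein four-group, multiplication by a unit vector of a weight space
  would embed its orthogonal complement in that weight space into 0, so \<open>V\<close> would have dimension 3.
\<close>

lemma tetra_fixed_unit:
  assumes "tetra a b s"
  obtains e where "a *v e = e" "b *v e = e" "qform e e = 1"
proof -
  note T = tetra_vector[OF assms(1)]
  have Z: "a \<in> zaut" "b \<in> zaut" using assms(1) by (auto simp: tetra_def)
  obtain x where x: "a *v x = 1 *s x" "b *v x = -1 *s x" "qform x x = 1"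
    by (rule tetra_nontrivial_eigen[OF assms, of 1 "-1"]) auto
  obtain y where y: "a *v y = -1 *s y" "b *v y = 1 *s y" "qform y y = 1"
    by (rule tetra_nontrivial_eigen[OF assms, of "-1" 1]) auto
  obtain z where z: "a *v z = -1 *s z" "b *v z = -1 *s z" "qform z z = 1"
    by (rule tetra_nontrivial_eigen[OF assms, of "-1" "-1"]) auto
  have "\<exists>e. e \<noteq> 0 \<and> a *v e = 1 *s e \<and> b *v e = 1 *s e"
  proof (rule ccontr)
    assume "\<not> ?thesis"
    then have triv: "e = 0" if "a *v e = e" "b *v e = e" for e
      using that by auto
    have line: "v = qform w v *s w"
      if "a *v w = \<sigma> *s w" "b *v w = \<tau> *s w" "qform w w = 1" "a *v v = \<sigma> *s v" "b *v v = \<tau> *s v"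
        "\<sigma> * \<sigma> = 1" "\<tau> * \<tau> = 1" for v w \<sigma> \<tau>
    proof -
      let ?v = "v - qform w v *s w"
      have "cprod w v = 0"
      proof (rule triv)
        show "a *v cprod w v = cprod w v" "b *v cprod w v = cprod w v"
          using that(6,7) by (simp_all add: that(1,2,4,5) cprod_linear vector_smult_assoc flip: zautD(2)[OF Z(1)] zautD(2)[OF Z(2)])
      qed
      then have "cprod w (cprod w v) = 0" by (simp add: cprod_linear)
      then show ?thesis using that(3) by (simp add: cprod_cprod)
    qed
    have "v \<in> vec.span {x, y, z}" for v
    proof -
      define P where "P \<sigma> \<tau> = v + \<sigma> *s (a *v v) + \<tau> *s (b *v v) + (\<sigma> * \<tau>) *s (a *v (b *v v))" for \<sigma> \<tau>
      have P: "a *v P \<sigma> \<tau> = \<sigma> *s P \<sigma> \<tau>" "b *v P \<sigma> \<tau> = \<tau> *s P \<sigma> \<tau>" if "\<sigma> * \<sigma> = 1" "\<tau> * \<tau> = 1" for \<sigma> \<tau>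
        unfolding P_def matrix_vector_simps T vec.scale_right_distrib vec.scale_scale
        using that by (simp_all add: algebra_simps)
      have "P 1 1 = 0" using P[of 1 1] by (intro triv) auto
      moreover have "P 1 (-1) = qform x (P 1 (-1)) *s x"
        by (rule line[OF x P]) auto
      moreover have "P (-1) 1 = qform y (P (-1) 1) *s y"
        by (rule line[OF y P]) auto
      moreover have "P (-1) (-1) = qform z (P (-1) (-1)) *s z"
        by (rule line[OF z P]) auto
      moreover have "v = (1/4) *s (P 1 1 + P 1 (-1) + P (-1) 1 + P (-1) (-1))"
        by (simp add: P_def vec_eq_iff)
      ultimately have "v = (1/4) *s (0 + qform x (P 1 (-1)) *s x + qform y (P (-1) 1) *s y
          + qform z (P (-1) (-1)) *s z)" by metis
      moreover have "\<dots> \<in> vec.span {x, y, z}"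
        by (intro vec.span_scale vec.span_add vec.span_zero vec.span_base) auto
      ultimately show ?thesis by metis
    qed
    then have "vec.dim (UNIV :: (complex^7) set) \<le> card {x, y, z}"
      by (intro vec.dim_le_card) auto
    also have "\<dots> \<le> 3" by (simp add: card_insert_if)
    finally show False unfolding vec_dim_card by simp
  qed
  then obtain e where "e \<noteq> 0" "a *v e = 1 *s e" "b *v e = 1 *s e" by blast
  from zaut_eigen_unit[OF assms _ _ this(2,3,1)] obtain w where
    "a *v w = 1 *s w" "b *v w = 1 *s w" "qform w w = 1" by blast
  then show thesis by (intro that[of w]) auto
qed

lemma det3_nonzero:
  assumes "\<And>c1 c2 c3. c1 * p1 + c2 * q1 + c3 * r1 = 0 \<Longrightarrow> c1 * p2 + c2 * q2 + c3 * r2 = 0 \<Longrightarrow>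
    c1 * p3 + c2 * q3 + c3 * r3 = 0 \<Longrightarrow> c1 = 0 \<and> c2 = 0 \<and> c3 = 0"
  shows "det3 p1 p2 p3 q1 q2 q3 r1 r2 r3 \<noteq> 0"
proof -
  define A :: "complex^3^3" where "A = vector [vector [p1, q1, r1], vector [p2, q2, r2], vector [p3, q3, r3]]"
  have "x = 0" if "A *v x = 0" for x
    using assms[of "x $ 1" "x $ 2" "x $ 3"] that
    by (simp add: A_def vec_eq_iff forall_3 matrix_vector_mult_def sum_3 mult.commute)
  then have "det A \<noteq> 0"
    using matrix_left_invertible_ker invertible_left_inverse invertible_det_nz by blast
  then show ?thesis
    by (simp add: A_def det_3 det3_def algebra_simps)
qed

lemma tetra_diagonal:
  assumes t: "tetra a b s" and u: "a *v zunit = zunit" "b *v zunit = zunit"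
  obtains m where "m \<in> zaut" "a ** m = m ** std_a" "b ** m = m ** std_b"
proof -
  have Z: "a \<in> zaut" "b \<in> zaut" using t by (auto simp: tetra_def)
  have ex: "\<exists>p1 p2 p3. a *v zorn 0 p1 p2 p3 0 0 0 = \<sigma> *s zorn 0 p1 p2 p3 0 0 0 \<and>
      b *v zorn 0 p1 p2 p3 0 0 0 = \<tau> *s zorn 0 p1 p2 p3 0 0 0 \<and> \<not> (p1 = 0 \<and> p2 = 0 \<and> p3 = 0)"
    if "(\<sigma>, \<tau>) \<in> {(1, -1), (-1, 1), (-1, -1)}" for \<sigma> \<tau>
  proof -
    from tetra_nontrivial_eigen[OF t that] obtain w where
      w: "a *v w = \<sigma> *s w" "b *v w = \<tau> *s w" "qform w w = 1" by blast
    obtain c x1 x2 x3 y1 y2 y3 where wz: "w = zorn c x1 x2 x3 y1 y2 y3" by (rule zorn_cases)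
    have "qform zunit w = \<sigma> * qform zunit w" "qform zunit w = \<tau> * qform zunit w"
      using zautD(1)[OF Z(1), of zunit w] zautD(1)[OF Z(2), of zunit w] by (simp_all add: u w qform_linear)
    then have c: "c = 0" using that by (auto simp: wz zunit_def qform_zorn)
    \<comment> \<open>The projection of \<open>w\<close> to the \<open>x\<close>-space. It keeps the
      weight because \<open>a\<close> and \<open>b\<close> fix \<open>zunit\<close>, and it is
      nonzero because the norm of \<open>w\<close> is \<open>- x y = 1\<close>.\<close>
    have z: "zorn 0 x1 x2 x3 0 0 0 = (1/2) *s (w + cprod zunit w)"
      by (simp add: wz c zunit_def cprod_zorn zorn_arith)
    have "a *v cprod zunit w = \<sigma> *s cprod zunit w" "b *v cprod zunit w = \<tau> *s cprod zunit w"
      using zautD(2)[OF Z(1), of zunit w] zautD(2)[OF Z(2), of zunit w] by (simp_all add: u w cprod_linear)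
    then have "a *v zorn 0 x1 x2 x3 0 0 0 = \<sigma> *s zorn 0 x1 x2 x3 0 0 0"
      "b *v zorn 0 x1 x2 x3 0 0 0 = \<tau> *s zorn 0 x1 x2 x3 0 0 0"
      unfolding z by (simp_all add: matrix_vector_simps w vec.scale_right_distrib vector_smult_assoc mult.commute)
    moreover have "\<not> (x1 = 0 \<and> x2 = 0 \<and> x3 = 0)"
      using w(3) by (auto simp: wz c qform_zorn)
    ultimately show ?thesis by blast
  qed
  obtain p1 p2 p3 where p: "a *v zorn 0 p1 p2 p3 0 0 0 = 1 *s zorn 0 p1 p2 p3 0 0 0"
      "b *v zorn 0 p1 p2 p3 0 0 0 = (-1) *s zorn 0 p1 p2 p3 0 0 0" "\<not> (p1 = 0 \<and> p2 = 0 \<and> p3 = 0)"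
    using ex[of 1 "-1"] by blast
  obtain q1 q2 q3 where q: "a *v zorn 0 q1 q2 q3 0 0 0 = (-1) *s zorn 0 q1 q2 q3 0 0 0"
      "b *v zorn 0 q1 q2 q3 0 0 0 = 1 *s zorn 0 q1 q2 q3 0 0 0" "\<not> (q1 = 0 \<and> q2 = 0 \<and> q3 = 0)"
    using ex[of "-1" 1] by blast
  obtain r1 r2 r3 where r: "a *v zorn 0 r1 r2 r3 0 0 0 = (-1) *s zorn 0 r1 r2 r3 0 0 0"
      "b *v zorn 0 r1 r2 r3 0 0 0 = (-1) *s zorn 0 r1 r2 r3 0 0 0" "\<not> (r1 = 0 \<and> r2 = 0 \<and> r3 = 0)"
    using ex[of "-1" "-1"] by blast
  define d where "d = det3 p1 p2 p3 q1 q2 q3 r1 r2 r3"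
  have "d \<noteq> 0" unfolding d_def
  proof (rule det3_nonzero)
    fix c1 c2 c3
    assume "c1 * p1 + c2 * q1 + c3 * r1 = 0" "c1 * p2 + c2 * q2 + c3 * r2 = 0" "c1 * p3 + c2 * q3 + c3 * r3 = 0"
    then have 0: "c1 *s zorn 0 p1 p2 p3 0 0 0 + c2 *s zorn 0 q1 q2 q3 0 0 0 + c3 *s zorn 0 r1 r2 r3 0 0 0 = 0"
      (is "c1 *s ?p + c2 *s ?q + c3 *s ?r = 0")
      by (simp add: zorn_arith)
    have "a *v (c1 *s ?p + c2 *s ?q + c3 *s ?r) = 0" "b *v (c1 *s ?p + c2 *s ?q + c3 *s ?r) = 0"
      unfolding 0 by (simp_all add: matrix_vector_simps)
    then have "c1 *s ?p - c2 *s ?q - c3 *s ?r = 0" "- c1 *s ?p + c2 *s ?q - c3 *s ?r = 0"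
      unfolding matrix_vector_simps p q r by (simp_all add: vector_smult_assoc)
    note eqs = 0 this
    have "x = 0 \<and> y = 0 \<and> z = 0" if "x + y + z = 0" "x - y - z = 0" "- x + y - z = 0" for x y z :: complex
      using that by (auto simp: complex_eq_iff)
    from this[of "c1 * p1" "c2 * q1" "c3 * r1"] this[of "c1 * p2" "c2 * q2" "c3 * r2"]
      this[of "c1 * p3" "c2 * q3" "c3 * r3"]
    show "c1 = 0 \<and> c2 = 0 \<and> c3 = 0"
      using eqs p(3) q(3) r(3) unfolding zorn_arith zorn_eq_iff by auto
  qed
  \<comment> \<open>The columns are weight vectors, so \<open>m\<close> diagonalises
    \<open>a\<close> and \<open>b\<close>. Dividing one column by \<open>d\<close> makes the
    determinant 1.\<close>
  define m where "m = sl3 (p1 / d) (p2 / d) (p3 / d) q1 q2 q3 r1 r2 r3"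
  have mx: "m *v zorn 0 1 0 0 0 0 0 = zorn 0 (p1 / d) (p2 / d) (p3 / d) 0 0 0"
    "m *v zorn 0 0 1 0 0 0 0 = zorn 0 q1 q2 q3 0 0 0" "m *v zorn 0 0 0 1 0 0 0 = zorn 0 r1 r2 r3 0 0 0"
    by (simp_all add: m_def sl3_zorn zorn_arith)
  have "det3 (p1 / e) (p2 / e) (p3 / e) q1 q2 q3 r1 r2 r3 = d / e" for e
    by (simp add: det3_def d_def add_divide_distrib)
  then have "det3 (p1 / d) (p2 / d) (p3 / d) q1 q2 q3 r1 r2 r3 = 1" using \<open>d \<noteq> 0\<close> by simp
  then have m: "m \<in> zaut" unfolding m_def by (rule sl3_in_zaut)
  have neg: "m *v zorn 0 (-1) 0 0 0 0 0 = zorn 0 (- p1 / d) (- p2 / d) (- p3 / d) 0 0 0"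
    "m *v zorn 0 0 (-1) 0 0 0 0 = zorn 0 (-q1) (-q2) (-q3) 0 0 0" "m *v zorn 0 0 0 (-1) 0 0 0 = zorn 0 (-r1) (-r2) (-r3) 0 0 0"
    by (simp_all add: m_def sl3_zorn zorn_arith)
  have "zorn 0 (p1 / d) (p2 / d) (p3 / d) 0 0 0 = (1 / d) *s zorn 0 p1 p2 p3 0 0 0"
    by (simp add: zorn_arith(4))
  then have ab: "a *v zorn 0 (p1 / d) (p2 / d) (p3 / d) 0 0 0 = zorn 0 (p1 / d) (p2 / d) (p3 / d) 0 0 0"
    "b *v zorn 0 (p1 / d) (p2 / d) (p3 / d) 0 0 0 = zorn 0 (- p1 / d) (- p2 / d) (- p3 / d) 0 0 0"
    by (simp_all only: matrix_vector_simps p) (simp_all add: zorn_arith(4))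
  have "a ** m = m ** std_a"
    by (rule zaut_eqI) (use m Z std_in_zaut in \<open>simp_all add: zaut_mult mx neg std_zorn ab q r zorn_arith(4) flip: matrix_vector_mul_assoc\<close>)
  moreover have "b ** m = m ** std_b"
    by (rule zaut_eqI) (use m Z std_in_zaut in \<open>simp_all add: zaut_mult mx neg std_zorn ab q r zorn_arith(4) flip: matrix_vector_mul_assoc\<close>)
  ultimately show thesis using that m by blast
qed

lemma complex_eq_neg_self: "- x = x \<longleftrightarrow> x = 0" "x = - x \<longleftrightarrow> x = 0" for x :: complex
  by (auto simp: complex_eq_iff)

text \<open>The relations with \<open>std_a\<close> and \<open>std_b\<close> make \<open>s\<close> a
  monomial matrix along the cyclic permutation, and \<open>s^3 = 1\<close> makes the product of its
  entries 1. A diagonal matrix then conjugates all entries to 1.\<close>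

lemma tetra_cyclic:
  assumes t: "tetra std_a std_b s"
  obtains m where "m \<in> zaut" "m ** std_a = std_a ** m" "m ** std_b = std_b ** m" "m ** s = std_s ** m"
proof -
  note T = tetra_vector[OF t]
  have Z: "s \<in> zaut" using t by (auto simp: tetra_def)
  have "s *v zunit = std_a *v (s *v zunit)" "s *v zunit = std_b *v (s *v zunit)"
    unfolding T by (simp_all add: zunit_def std_zorn)
  then obtain l where l: "s *v zunit = l *s zunit"
    by (cases "s *v zunit" rule: zorn_cases) (auto simp: std_zorn zorn_eq_iff zunit_def zorn_arith)
  \<comment> \<open>The norm gives \<open>l^2 = 1\<close> and the order of \<open>s\<close> gives
    \<open>l^3 = 1\<close>.\<close>
  have "l * l = 1"
    using zautD(1)[OF Z, of zunit zunit] by (simp add: l qform_linear) (simp add: zunit_def qform_zorn)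
  moreover have "l * l * l = 1"
    using T(4)[of zunit] by (simp add: l matrix_vector_simps) (simp add: zunit_def zorn_arith zorn_eq_iff mult.assoc)
  ultimately have u: "s *v zunit = zunit" by (simp add: l)
  have "std_a *v (s *v zorn 0 1 0 0 0 0 0) = - (s *v zorn 0 1 0 0 0 0 0)"
    "std_b *v (s *v zorn 0 1 0 0 0 0 0) = s *v zorn 0 1 0 0 0 0 0"
    unfolding T std_zorn matrix_vector_simps(9)[symmetric] by (simp_all add: zorn_arith)
  moreover obtain c1 c2 c3 where "s *v zorn 0 1 0 0 0 0 0 = zorn 0 c1 c2 c3 0 0 0"
    using zaut_fixing_unit[OF Z u, of 1 0 0] by blast
  ultimately obtain l1 where l1: "s *v zorn 0 1 0 0 0 0 0 = l1 *s zorn 0 0 1 0 0 0 0"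
    by (simp add: std_zorn zorn_eq_iff zorn_arith(3,4) complex_eq_neg_self)
  have "std_a *v (s *v zorn 0 0 1 0 0 0 0) = - (s *v zorn 0 0 1 0 0 0 0)"
    "std_b *v (s *v zorn 0 0 1 0 0 0 0) = - (s *v zorn 0 0 1 0 0 0 0)"
    unfolding T std_zorn matrix_vector_simps(9)[symmetric] by (simp_all add: zorn_arith)
  moreover obtain c1 c2 c3 where "s *v zorn 0 0 1 0 0 0 0 = zorn 0 c1 c2 c3 0 0 0"
    using zaut_fixing_unit[OF Z u, of 0 1 0] by blast
  ultimately obtain l2 where l2: "s *v zorn 0 0 1 0 0 0 0 = l2 *s zorn 0 0 0 1 0 0 0"
    by (simp add: std_zorn zorn_eq_iff zorn_arith(3,4) complex_eq_neg_self)
  have "std_a *v (s *v zorn 0 0 0 1 0 0 0) = s *v zorn 0 0 0 1 0 0 0"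
    "std_b *v (s *v zorn 0 0 0 1 0 0 0) = - (s *v zorn 0 0 0 1 0 0 0)"
    unfolding T std_zorn matrix_vector_simps(9)[symmetric] by (simp_all add: zorn_arith)
  moreover obtain c1 c2 c3 where "s *v zorn 0 0 0 1 0 0 0 = zorn 0 c1 c2 c3 0 0 0"
    using zaut_fixing_unit[OF Z u, of 0 0 1] by blast
  ultimately obtain l3 where l3: "s *v zorn 0 0 0 1 0 0 0 = l3 *s zorn 0 1 0 0 0 0 0"
    by (simp add: std_zorn zorn_eq_iff zorn_arith(3,4) complex_eq_neg_self)
  have prod: "l1 * (l2 * l3) = 1"
    using T(4)[of "zorn 0 1 0 0 0 0 0"]
    by (simp only: l1 l2 l3 matrix_vector_simps) (simp add: zorn_arith zorn_eq_iff)
  then have nz: "l1 \<noteq> 0" "l2 \<noteq> 0" "l3 \<noteq> 0" by auto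
  \<comment> \<open>Comparing columns fixes the diagonal of \<open>m\<close> up to the common factor
    \<open>k\<close>; the determinant \<open>l1 * l2^2 * k^3\<close> has to be 1.\<close>
  obtain k where k: "1 / (l1 * l2^2) = k ^ 3"
    using exists_complex_root[of 3 "1 / (l1 * l2^2)"] by auto
  define m where "m = sl3 (l1 * l2 * k) 0 0 0 (l2 * k) 0 0 0 k"
  have "det3 (l1 * l2 * k) 0 0 0 (l2 * k) 0 0 0 k = l1 * l2^2 * k ^ 3"
    by (simp add: det3_def power2_eq_square power3_eq_cube)
  also have "\<dots> = 1" using nz by (simp flip: k)
  finally have m: "m \<in> zaut" unfolding m_def by (rule sl3_in_zaut)
  have prod': "l3 * (l1 * (l2 * k)) = k" using prod by (simp add: mult.commute mult.left_commute)
  have "m ** s = std_s ** m"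
    by (intro zaut_eqI) (use m Z std_in_zaut in
      \<open>simp_all add: zaut_mult l1 l2 l3 matrix_vector_simps flip: matrix_vector_mul_assoc\<close>,
      simp_all add: m_def sl3_zorn std_zorn zorn_arith mult.assoc prod')
  moreover have "m ** std_a = std_a ** m" "m ** std_b = std_b ** m"
    by (rule matrix_eq_zornI, simp add: m_def sl3_zorn std_zorn zorn_eq_iff flip: matrix_vector_mul_assoc)+
  ultimately show thesis using that m by blast
qed

lemma tetra_standard:
  assumes t: "tetra a b s"
  obtains h where "h \<in> zaut" "h ** a = std_a ** h" "h ** b = std_b ** h" "h ** s = std_s ** h"
proof -
  obtain e where e: "a *v e = e" "b *v e = e" "qform e e = 1" by (rule tetra_fixed_unit[OF t])
  then obtain h1 where h1: "h1 \<in> zaut" "h1 *v e = zunit"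
    using reach_unit[OF e(3)] carrier_G2 by (auto simp: reach_def fixing_def)
  obtain h1' where h1': "h1' \<in> zaut" "h1 ** h1' = mat 1" "h1' ** h1 = mat 1"
    using zaut_two_sided_inverse[OF h1(1)] .
  have h1e: "h1' *v zunit = e"
    using h1(2) h1'(3) by (metis matrix_vector_mul_assoc matrix_vector_mul_lid)
  define a1 b1 s1 where "a1 = h1 ** a ** h1'" and "b1 = h1 ** b ** h1'" and "s1 = h1 ** s ** h1'"
  have c1: "h1 ** a = a1 ** h1" "h1 ** b = b1 ** h1" "h1 ** s = s1 ** h1"
    unfolding a1_def b1_def s1_def using h1'(3) by (metis matrix_mul_assoc matrix_mul_rid)+
  have t1: "tetra a1 b1 s1"
    unfolding a1_def b1_def s1_def by (rule tetra_conj[OF t h1(1) h1'])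
  have "a1 *v zunit = zunit" "b1 *v zunit = zunit"
    by (simp_all add: a1_def b1_def h1e e h1(2) flip: matrix_vector_mul_assoc)
  then obtain m where m: "m \<in> zaut" "a1 ** m = m ** std_a" "b1 ** m = m ** std_b"
    using tetra_diagonal[OF t1] by blast
  obtain h2 where h2: "h2 \<in> zaut" "m ** h2 = mat 1" "h2 ** m = mat 1"
    using zaut_two_sided_inverse[OF m(1)] .
  have c2: "h2 ** a1 = std_a ** h2" "h2 ** b1 = std_b ** h2"
    using m h2 by (metis matrix_mul_assoc matrix_mul_lid matrix_mul_rid)+
  define s2 where "s2 = h2 ** s1 ** m"
  have c2s: "h2 ** s1 = s2 ** h2"
    unfolding s2_def using h2(2) by (metis matrix_mul_assoc matrix_mul_rid)
  have "h2 ** a1 ** m = std_a" "h2 ** b1 ** m = std_b"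
    using c2 h2(3) by (metis matrix_mul_assoc matrix_mul_rid)+
  with tetra_conj[OF t1 h2(1) m(1) h2(3,2)] have "tetra std_a std_b s2"
    by (simp add: s2_def)
  then obtain d where d: "d \<in> zaut" "d ** std_a = std_a ** d" "d ** std_b = std_b ** d" "d ** s2 = std_s ** d"
    using tetra_cyclic by blast
  have comp: "(d ** h2 ** h1) ** x = z ** (d ** h2 ** h1)"
    if "h1 ** x = y ** h1" "h2 ** y = w ** h2" "d ** w = z ** d" for x y w z
    using that by (metis matrix_mul_assoc)
  show thesis
    by (rule that[of "d ** h2 ** h1"])
      (use d h2 h1 comp c1 c2 c2s in \<open>auto simp: zaut_mult\<close>)
qed

section \<open>Extending a standard tetrahedral group by an involution\<close>

text \<open>In each 3 by 3 block the entry depends only on the sum of the indices modulo 3. The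
  block \<open>a\<close> acts both within the \<open>x\<close>-space and within the
  \<open>y\<close>-space, \<open>b\<close> leads from \<open>x\<close> to \<open>y\<close>,
  \<open>c\<close> from \<open>y\<close> to \<open>x\<close>. The entries \<open>- q / 2\<close> and
  \<open>- p / 2\<close> make the matrix self-adjoint for \<open>qform\<close>.\<close>

definition circ :: "complex \<Rightarrow> complex \<Rightarrow> complex \<Rightarrow> complex \<Rightarrow> complex \<Rightarrow> complex \<Rightarrow> complex \<Rightarrow> complex \<Rightarrow> complex \<Rightarrow>
    complex \<Rightarrow> complex \<Rightarrow> complex \<Rightarrow> complex^7^7" where
  "circ d p q a1 a2 a3 b1 b2 b3 c1 c2 c3 = zmat (zorn d p p p q q q)
     (zorn (- q / 2) a1 a2 a3 b1 b2 b3) (zorn (- q / 2) a2 a3 a1 b2 b3 b1) (zorn (- q / 2) a3 a1 a2 b3 b1 b2)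
     (zorn (- p / 2) c1 c2 c3 a1 a2 a3) (zorn (- p / 2) c2 c3 c1 a2 a3 a1) (zorn (- p / 2) c3 c1 c2 a3 a1 a2)"

lemma circ_zorn:
  "circ d p q a1 a2 a3 b1 b2 b3 c1 c2 c3 *v zorn e x1 x2 x3 y1 y2 y3 = zorn
     (d * e - q / 2 * (x1 + x2 + x3) - p / 2 * (y1 + y2 + y3))
     (p * e + a1 * x1 + a2 * x2 + a3 * x3 + c1 * y1 + c2 * y2 + c3 * y3)
     (p * e + a2 * x1 + a3 * x2 + a1 * x3 + c2 * y1 + c3 * y2 + c1 * y3)
     (p * e + a3 * x1 + a1 * x2 + a2 * x3 + c3 * y1 + c1 * y2 + c2 * y3)
     (q * e + b1 * x1 + b2 * x2 + b3 * x3 + a1 * y1 + a2 * y2 + a3 * y3)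
     (q * e + b2 * x1 + b3 * x2 + b1 * x3 + a2 * y1 + a3 * y2 + a1 * y3)
     (q * e + b3 * x1 + b1 * x2 + b2 * x3 + a3 * y1 + a1 * y2 + a2 * y3)"
  unfolding circ_def zmat_zorn zorn_arith zorn_eq_iff by (intro conjI; simp add: algebra_simps add_divide_distrib diff_divide_distrib)

text \<open>\<open>sts\<close> yields the cyclic pattern, one column of each triple determining the
  other two; an isometry of square one is self-adjoint, which identifies the remaining
  entries.\<close>

lemma circ_of_dihedral:
  assumes t: "t \<in> zaut" and tt: "t ** t = mat 1" and sts: "std_s ** t ** std_s = t"
  obtains d p q a1 a2 a3 b1 b2 b3 c1 c2 c3 where "t = circ d p q a1 a2 a3 b1 b2 b3 c1 c2 c3"
proof -
  have tv: "t *v (t *v v) = v" and sv: "std_s *v (t *v (std_s *v v)) = t *v v" for v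
    using arg_cong[OF tt, of "\<lambda>M. M *v v"] arg_cong[OF sts, of "\<lambda>M. M *v v"]
    by (simp_all flip: matrix_vector_mul_assoc)
  have sym: "qform (t *v v) w = qform v (t *v w)" for v w
    using zautD(1)[OF t, of "t *v v" w] by (simp add: tv)
  obtain d p p2 p3 q q2 q3 where u0: "t *v zorn 1 0 0 0 0 0 0 = zorn d p p2 p3 q q2 q3" by (rule zorn_cases)
  have "p2 = p" "p3 = p" "q2 = q" "q3 = q"
    using sv[of "zorn 1 0 0 0 0 0 0"] unfolding std_zorn u0 zorn_eq_iff by metis+
  with u0 have u: "t *v zorn 1 0 0 0 0 0 0 = zorn d p p p q q q" by simp
  obtain k a1 a2 a3 b1 b2 b3 where x1: "t *v zorn 0 1 0 0 0 0 0 = zorn k a1 a2 a3 b1 b2 b3" by (rule zorn_cases)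
  have x3: "t *v zorn 0 0 0 1 0 0 0 = zorn k a3 a1 a2 b3 b1 b2"
    using sv[of "zorn 0 0 0 1 0 0 0"] by (simp add: std_zorn x1)
  have x2: "t *v zorn 0 0 1 0 0 0 0 = zorn k a2 a3 a1 b2 b3 b1"
    using sv[of "zorn 0 0 1 0 0 0 0"] by (simp add: std_zorn x3)
  obtain l c1 c2 c3 e1 e2 e3 where y1: "t *v zorn 0 0 0 0 1 0 0 = zorn l c1 c2 c3 e1 e2 e3" by (rule zorn_cases)
  have y3: "t *v zorn 0 0 0 0 0 0 1 = zorn l c3 c1 c2 e3 e1 e2"
    using sv[of "zorn 0 0 0 0 0 0 1"] by (simp add: std_zorn y1)
  have y2: "t *v zorn 0 0 0 0 0 1 0 = zorn l c2 c3 c1 e2 e3 e1"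
    using sv[of "zorn 0 0 0 0 0 1 0"] by (simp add: std_zorn y3)
  have eqs: "k = - q / 2" "l = - p / 2" "e1 = a1" "e2 = a2" "e3 = a3"
    using sym[of "zorn 0 1 0 0 0 0 0" "zorn 1 0 0 0 0 0 0"] sym[of "zorn 0 0 0 0 1 0 0" "zorn 1 0 0 0 0 0 0"]
      sym[of "zorn 0 1 0 0 0 0 0" "zorn 0 0 0 0 1 0 0"] sym[of "zorn 0 0 1 0 0 0 0" "zorn 0 0 0 0 1 0 0"]
      sym[of "zorn 0 0 0 1 0 0 0" "zorn 0 0 0 0 1 0 0"]
    by (simp_all add: u x1 x2 x3 y1 qform_zorn)
  have "t = circ d p q a1 a2 a3 b1 b2 b3 c1 c2 c3"
    by (intro matrix_eq_zornI, subst matrix_vector_mul_zorn, unfold u x1 x2 x3 y1 y2 y3 eqs)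
      (simp add: circ_def zmat_zorn)
  then show thesis by (rule that)
qed

text \<open>For \<open>w^3 = 1\<close> this is the centre of the special linear group on the
  \<open>x\<close>-space; it acts on the \<open>y\<close>-space by the inverse scalar. These
  elements absorb the cube roots of unity that turn up in the equations.\<close>

definition center_z :: "complex \<Rightarrow> complex^7^7" where "center_z w = sl3 w 0 0 0 w 0 0 0 w"

lemma center_z_zorn: "center_z w *v zorn a x1 x2 x3 y1 y2 y3 =
    zorn a (w * x1) (w * x2) (w * x3) (w^2 * y1) (w^2 * y2) (w^2 * y3)"
  by (simp add: center_z_def sl3_zorn power2_eq_square)

lemma center_z:
  assumes "w ^ 3 = 1"
  shows "center_z w \<in> zaut" "center_z w ** std_a = std_a ** center_z w"
    "center_z w ** std_b = std_b ** center_z w" "center_z w ** std_s = std_s ** center_z w"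
proof -
  show "center_z w \<in> zaut"
    unfolding center_z_def by (rule sl3_in_zaut) (use assms in \<open>simp add: det3_def power3_eq_cube mult.assoc\<close>)
  show "center_z w ** std_a = std_a ** center_z w" "center_z w ** std_b = std_b ** center_z w"
    "center_z w ** std_s = std_s ** center_z w"
    by (rule matrix_eq_zornI, simp add: center_z_zorn std_zorn flip: matrix_vector_mul_assoc)+
qed

text \<open>The constants here and in the next definitions are the solutions found in
  \<open>oct_classification\<close> and \<open>ico_classification\<close>; \<open>r\<close> is
  either square root of 5. \<open>oct_A\<close> and \<open>ico_A r\<close> fix \<open>zunit\<close>,
  \<open>oct_B\<close> negates it and exchanges the \<open>x\<close>- and \<open>y\<close>-space,
  \<open>ico_B r\<close> moves its line.\<close>

definition oct_A :: "complex^7^7" where "oct_A = circ 1 0 0 (-1) 0 0 0 0 0 0 0 0"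
definition oct_B :: "complex^7^7" where "oct_B = circ (-1) 0 0 0 0 0 (-1) 0 0 (-1) 0 0"
definition ico_A :: "complex \<Rightarrow> complex^7^7" where
  "ico_A r = circ 1 0 0 (- 1 / 2) ((r - 1) / 4) ((- 1 - r) / 4) 0 0 0 0 0 0"
definition ico_B :: "complex \<Rightarrow> complex^7^7" where
  "ico_B r = circ (- 1 / 4) (r / 4) (- r / 4) (1 / 8) ((r - 2) / 8) ((- r - 2) / 8)
     (- 5 / 8) (r / 8) (- r / 8) (- 5 / 8) (r / 8) (- r / 8)"

text \<open>With a basis vector as first argument, the identities to be checked for
  \<open>circ\<close> are linear in the coordinates of the second, which keeps them
  manageable.\<close>

lemma zautI_basis:
  fixes M :: "complex^7^7"
  defines "B \<equiv> {zorn 1 0 0 0 0 0 0, zorn 0 1 0 0 0 0 0, zorn 0 0 1 0 0 0 0, zorn 0 0 0 1 0 0 0,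
     zorn 0 0 0 0 1 0 0, zorn 0 0 0 0 0 1 0, zorn 0 0 0 0 0 0 1}"
  assumes Q: "\<And>v e x1 x2 x3 y1 y2 y3. v \<in> B \<Longrightarrow>
     qform (M *v v) (M *v zorn e x1 x2 x3 y1 y2 y3) = qform v (zorn e x1 x2 x3 y1 y2 y3)"
    and C: "\<And>v e x1 x2 x3 y1 y2 y3. v \<in> B \<Longrightarrow>
     cprod (M *v v) (M *v zorn e x1 x2 x3 y1 y2 y3) = M *v cprod v (zorn e x1 x2 x3 y1 y2 y3)"
  shows "M \<in> zaut"
proof -
  have P: "qform (M *v v) (M *v w) = qform v w \<and> cprod (M *v v) (M *v w) = M *v cprod v w"
    if "v \<in> B" for v w
    using Q[OF that] C[OF that] by (cases w rule: zorn_cases) simp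
  have lin: "qform (M *v (c *s v + v')) (M *v w) = qform (c *s v + v') w \<and>
      cprod (M *v (c *s v + v')) (M *v w) = M *v cprod (c *s v + v') w"
    if "qform (M *v v) (M *v w) = qform v w \<and> cprod (M *v v) (M *v w) = M *v cprod v w"
      "qform (M *v v') (M *v w) = qform v' w \<and> cprod (M *v v') (M *v w) = M *v cprod v' w" for c v v' w
    using that by (simp add: matrix_vector_simps qform_linear cprod_linear)
  have "qform (M *v v) (M *v w) = qform v w \<and> cprod (M *v v) (M *v w) = M *v cprod v w" for v w
  proof (cases v rule: zorn_cases)
    case (1 a x1 x2 x3 y1 y2 y3)
    \<comment> \<open>The summand with coefficient 0 ends the chain, so that \<open>lin\<close>
      applies to all seven terms alike.\<close>
    then have v: "v = a *s zorn 1 0 0 0 0 0 0 + (x1 *s zorn 0 1 0 0 0 0 0 + (x2 *s zorn 0 0 1 0 0 0 0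
      + (x3 *s zorn 0 0 0 1 0 0 0 + (y1 *s zorn 0 0 0 0 1 0 0 + (y2 *s zorn 0 0 0 0 0 1 0
      + (y3 *s zorn 0 0 0 0 0 0 1 + 0 *s zorn 1 0 0 0 0 0 0))))))"
      by (simp add: zorn_arith)
    have lin': "qform (M *v (c *s z)) (M *v w) = qform (c *s z) w \<and>
        cprod (M *v (c *s z)) (M *v w) = M *v cprod (c *s z) w" if "z \<in> B" for c z
      using P[OF that, of w] by (simp add: matrix_vector_simps qform_linear cprod_linear)
    show ?thesis unfolding v
      by (intro lin lin' P) (simp_all add: B_def)
  qed
  then show ?thesis by (simp add: zaut_def)
qed

lemma oct_in_zaut: "oct_A \<in> zaut" "oct_B \<in> zaut"
  unfolding oct_A_def oct_B_def
  by (rule zautI_basis; elim insertE emptyE;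
      simp add: circ_zorn qform_zorn cprod_zorn zorn_eq_iff field_simps)+

lemma ico_A_in_zaut:
  assumes "r^2 = 5" shows "ico_A r \<in> zaut"
proof -
  have r: "r * r = 5" "\<And>z. r * (r * z) = 5 * z" using assms by (simp_all add: power2_eq_square flip: mult.assoc)
  show ?thesis unfolding ico_A_def
    by (rule zautI_basis; elim insertE emptyE;
        simp add: circ_zorn qform_zorn cprod_zorn zorn_eq_iff field_simps r)
qed

lemma ico_B_in_zaut:
  assumes "r^2 = 5" shows "ico_B r \<in> zaut"
proof -
  have r: "r * r = 5" "\<And>z. r * (r * z) = 5 * z" using assms by (simp_all add: power2_eq_square flip: mult.assoc)
  show ?thesis unfolding ico_B_def
    by (rule zautI_basis; elim insertE emptyE;
        simp add: circ_zorn qform_zorn cprod_zorn zorn_eq_iff field_simps r)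
qed

lemma trace_zorn:
  assumes "\<And>e x1 x2 x3 y1 y2 y3. M *v zorn e x1 x2 x3 y1 y2 y3 = zorn (f0 e x1 x2 x3 y1 y2 y3)
    (f1 e x1 x2 x3 y1 y2 y3) (f2 e x1 x2 x3 y1 y2 y3) (f3 e x1 x2 x3 y1 y2 y3)
    (f4 e x1 x2 x3 y1 y2 y3) (f5 e x1 x2 x3 y1 y2 y3) (f6 e x1 x2 x3 y1 y2 y3)"
  shows "trace M = f0 1 0 0 0 0 0 0 + f1 0 1 0 0 0 0 0 + f2 0 0 1 0 0 0 0 + f3 0 0 0 1 0 0 0
    + f4 0 0 0 0 1 0 0 + f5 0 0 0 0 0 1 0 + f6 0 0 0 0 0 0 1"
proof -
  have entry: "M $ i $ i = (M *v axis i 1) $ i" for i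
    by (simp add: matrix_vector_mult_def axis_def if_distrib cong: if_cong)
  \<comment> \<open>\<open>axis 6 1\<close> is the negative of a Zorn basis vector and coordinate 6
    is \<open>- y2\<close>; the two signs cancel in the trace.\<close>
  have neg: "zorn 0 0 0 0 0 (-1) 0 = - zorn 0 0 0 0 0 1 0" by (simp add: zorn_arith)
  show ?thesis
    by (simp add: trace_def sum_7 entry axis_zorn assms zorn_nth neg matrix_vector_simps)
qed

lemma trace_circ: "trace (circ d p q a1 a2 a3 b1 b2 b3 c1 c2 c3) = d + 2 * (a1 + a2 + a3)"
  by (subst trace_zorn, rule circ_zorn) simp

lemma trace_circ_std_a: "trace (circ d p q a1 a2 a3 b1 b2 b3 c1 c2 c3 ** std_a) = d + 2 * (a1 - a2 - a3)"
  by (subst trace_zorn, subst matrix_vector_mul_assoc[symmetric], subst std_zorn, rule circ_zorn) simp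

text \<open>Conjugacy by the centraliser of the standard tetrahedral group, which is the freedom
  left once that group is in place.\<close>

definition std_equiv :: "complex^7^7 \<Rightarrow> complex^7^7 \<Rightarrow> bool" where
  "std_equiv t t' \<longleftrightarrow> (\<exists>m\<in>zaut. m ** std_a = std_a ** m \<and> m ** std_b = std_b ** m \<and>
     m ** std_s = std_s ** m \<and> m ** t = t' ** m)"

lemma std_equiv_refl: "std_equiv t t"
  unfolding std_equiv_def by (intro bexI[of _ "mat 1"]) (simp_all add: zaut_one)

lemma std_equiv_center:
  assumes "w ^ 3 = 1" "center_z w ** t = t' ** center_z w" shows "std_equiv t t'"
  unfolding std_equiv_def using assms center_z[of w] by blast

section \<open>Solution of the octahedral and icosahedral equations\<close>

lemma oct_classification:
  assumes t: "t \<in> zaut" and tt: "t ** t = mat 1" and sts: "std_s ** t ** std_s = t"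
    and ta: "t ** std_a = std_a ** t"
  shows "std_equiv t oct_A \<or> std_equiv t oct_B"
proof -
  obtain d p q a1 a2 a3 b1 b2 b3 c1 c2 c3 where tc: "t = circ d p q a1 a2 a3 b1 b2 b3 c1 c2 c3"
    by (rule circ_of_dihedral[OF t tt sts])
  have tv: "t *v (t *v v) = v" and av: "t *v (std_a *v v) = std_a *v (t *v v)" for v
    using arg_cong[OF tt, of "\<lambda>M. M *v v"] arg_cong[OF ta, of "\<lambda>M. M *v v"]
    by (simp_all flip: matrix_vector_mul_assoc)
  have pq: "p = 0" "q = 0"
    using av[of "zorn 1 0 0 0 0 0 0"] by (simp_all add: tc circ_zorn std_zorn zorn_eq_iff complex_eq_neg_self)
  have abc: "a2 = 0" "a3 = 0" "b2 = 0" "b3 = 0" "c2 = 0" "c3 = 0"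
    using av[of "zorn 0 1 0 0 0 0 0"] av[of "zorn 0 0 0 0 1 0 0"]
    by (simp_all add: tc circ_zorn std_zorn zorn_eq_iff complex_eq_neg_self)
  note tc = tc[unfolded pq abc]
  have dd: "d * d = 1" using tv[of "zorn 1 0 0 0 0 0 0"] by (simp add: tc circ_zorn zorn_eq_iff)
  have aa: "a1 * a1 + b1 * c1 = 1"
    using tv[of "zorn 0 1 0 0 0 0 0"] by (simp add: tc circ_zorn zorn_eq_iff algebra_simps)
  \<comment> \<open>\<open>t\<close> sends \<open>zunit\<close> to \<open>d\<close> times itself,
    and multiplication by \<open>zunit\<close> is 1 on the \<open>x\<close>-space, -1 on the
    \<open>y\<close>-space. So \<open>d = 1\<close> preserves the two spaces and
    \<open>d = -1\<close> exchanges them.\<close>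
  have "d * a1 = a1" "- d * b1 = b1" "- d * c1 = c1"
    using zautD(2)[OF t, of "zorn 1 0 0 0 0 0 0" "zorn 0 1 0 0 0 0 0"]
      zautD(2)[OF t, of "zorn 1 0 0 0 0 0 0" "zorn 0 0 0 0 1 0 0"]
    by (simp_all add: tc circ_zorn cprod_zorn zorn_eq_iff)
  moreover have y: "a1 = - a1 * a1" "c1 = - b1 * b1"
    using zautD(2)[OF t, of "zorn 0 0 1 0 0 0 0" "zorn 0 0 0 1 0 0 0"]
    by (simp_all add: tc circ_zorn cprod_zorn zorn_eq_iff)
  moreover have "d = 1 \<or> d = -1" using dd by (simp add: square_eq_1_iff)
  ultimately consider "d = 1" "b1 = 0" "c1 = 0" | "d = -1" "a1 = 0"
    by (auto simp: complex_eq_neg_self)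
  then show ?thesis
  proof cases
    case 1
    then have "a1 = -1" using aa y(1) by simp
    with 1 have "t = oct_A" by (simp add: tc oct_A_def)
    then show ?thesis by (simp add: std_equiv_refl)
  next
    case 2
    \<comment> \<open>Conjugation by \<open>center_z w\<close> multiplies \<open>b1\<close> by
      \<open>w\<close>. To reach the value -1 of \<open>oct_B\<close> one needs
      \<open>w = - 1 / b1\<close>, which is \<open>b1^2\<close> because
      \<open>b1^3 = -1\<close>.\<close>
    define w where "w = b1 * b1"
    have b3: "b1 * (b1 * b1) = -1" using aa y(2) 2 by (simp add: minus_equation_iff)
    then have w: "w ^ 3 = 1" by (simp add: w_def power3_eq_cube) (simp add: mult.assoc)
    have wb: "w^2 * b1 = - w" "w * c1 = - (w^2)"
      unfolding y(2) w_def power2_eq_square using b3 by (simp_all add: mult.assoc)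
    have "center_z w ** t = oct_B ** center_z w"
      using wb by (intro matrix_eq_zornI)
        (simp add: tc 2 oct_B_def circ_zorn center_z_zorn zorn_eq_iff mult.assoc[symmetric] flip: matrix_vector_mul_assoc)
    then show ?thesis using std_equiv_center[OF w] by blast
  qed
qed

text \<open>The hypothesis \<open>tat\<close> says that \<open>t std_a\<close> has order dividing 3.
  The two traces are linear in the unknowns and eliminate \<open>a1\<close> and
  \<open>a2 + a3\<close>; what remains is a quadratic equation for \<open>d\<close> and, in each of
  its two cases, one free parameter \<open>r\<close> with \<open>r^2 = 5\<close>.\<close>

lemma ico_classification:
  assumes t: "t \<in> zaut" and tt: "t ** t = mat 1" and sts: "std_s ** t ** std_s = t"
    and tat: "t ** std_a ** t = std_a ** t ** std_a"
    and tr: "trace t = -1" "trace (t ** std_a) = 1"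
  shows "\<exists>r. r^2 = 5 \<and> (std_equiv t (ico_A r) \<or> std_equiv t (ico_B r))"
proof -
  obtain d p q a1 a2 a3 b1 b2 b3 c1 c2 c3 where tc: "t = circ d p q a1 a2 a3 b1 b2 b3 c1 c2 c3"
    by (rule circ_of_dihedral[OF t tt sts])
  have tv: "t *v (t *v v) = v" and av: "t *v (std_a *v (t *v v)) = std_a *v (t *v (std_a *v v))" for v
    using arg_cong[OF tt, of "\<lambda>M. M *v v"] arg_cong[OF tat, of "\<lambda>M. M *v v"]
    by (simp_all flip: matrix_vector_mul_assoc)
  have tr: "d + 2 * (a1 + a2 + a3) = -1" "d + 2 * (a1 - a2 - a3) = 1"
    using tr unfolding tc trace_circ trace_circ_std_a by auto
  have "4 * a1 = - 2 * d" "4 * (a2 + a3) = - 2" using tr by algebra+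
  then have a1: "2 * a1 = - d" and a23: "2 * (a2 + a3) = - 1"
    by (auto simp: complex_eq_iff)
  note tu = tv[of "zorn 1 0 0 0 0 0 0", unfolded tc circ_zorn zorn_eq_iff, simplified]
  note ta = av[of "zorn 1 0 0 0 0 0 0", unfolded tc circ_zorn std_zorn zorn_eq_iff, simplified]
  \<comment> \<open>The coordinates of weight 0 of
    \<open>t std_a t zunit = std_a t std_a zunit\<close> and of \<open>t t zunit = zunit\<close>.
    Eliminating \<open>p q\<close> leaves a quadratic in \<open>d\<close> with roots 1 and
    \<open>- 1 / 4\<close>.\<close>
  have pq: "p * q = d - d * d" "d * d - 3 * (p * q) = 1"
    using ta tu by (simp_all add: field_simps)
  then have "(4 * d + 1) * (d - 1) = 0" by algebra
  then have "4 * d + 1 = 0 \<or> d = 1" by simp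
  then have "d = 1 \<or> d = - 1 / 4" by (auto simp: complex_eq_iff)
  have X: "p * d + p * (a1 - a2 - a3) + q * (c1 - c2 - c3) = p"
    "p * d + p * (a2 - a3 - a1) + q * (c2 - c3 - c1) = - p"
    "p * d + p * (a3 - a1 - a2) + q * (c3 - c1 - c2) = - p"
    "q * d + p * (b1 - b2 - b3) + q * (a1 - a2 - a3) = q"
    "q * d + p * (b2 - b3 - b1) + q * (a2 - a3 - a1) = - q"
    "q * d + p * (b3 - b1 - b2) + q * (a3 - a1 - a2) = - q"
    "p * d + p * (a1 + a2 + a3) + q * (c1 + c2 + c3) = 0"
    "q * d + p * (b1 + b2 + b3) + q * (a1 + a2 + a3) = 0"
    using ta tu by (simp_all add: algebra_simps)
  have Y: "2 * (p * d) + 2 * (p * a1) + 2 * (q * c1) = p" "2 * (p * d) + 2 * (p * a2) + 2 * (q * c2) = - p"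
    "2 * (p * d) + 2 * (p * a3) + 2 * (q * c3) = - p" "2 * (q * d) + 2 * (p * b1) + 2 * (q * a1) = q"
    "2 * (q * d) + 2 * (p * b2) + 2 * (q * a2) = - q" "2 * (q * d) + 2 * (p * b3) + 2 * (q * a3) = - q"
    using arg_cong2[OF X(1,7), of "(+)"] arg_cong2[OF X(2,7), of "(+)"] arg_cong2[OF X(3,7), of "(+)"]
      arg_cong2[OF X(4,8), of "(+)"] arg_cong2[OF X(5,8), of "(+)"] arg_cong2[OF X(6,8), of "(+)"]
    by (simp_all add: algebra_simps)
  \<comment> \<open>The three lines of \<open>Y\<close> add up to an equation in the sums of the
    \<open>a\<close>'s and of the \<open>c\<close>'s, and \<open>X(7)\<close> eliminates those sums.
    For \<open>d = 1\<close> this forces \<open>p = 0\<close>.\<close>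
  have Zp: "p * (4 * d + 1) = 0" using X(7) Y(1,2,3) by algebra
  have Zq: "q * (4 * d + 1) = 0" using X(8) Y(4,5,6) by algebra
  note tx = tv[of "zorn 0 1 0 0 0 0 0", unfolded tc circ_zorn zorn_eq_iff, simplified]
  have S: "a1 * a1 + a2 * a2 + a3 * a3 + b1 * c1 + b2 * c2 + b3 * c3 - p * q / 2 = 1"
    using tx by (simp add: algebra_simps)
  from \<open>d = 1 \<or> d = - 1 / 4\<close> show ?thesis
  proof
    assume d: "d = 1"
    have "p = 0" "q = 0" using Zp Zq by (simp_all add: d)
    have "b1 = 0" "b2 = 0" "b3 = 0" "c1 = 0" "c2 = 0" "c3 = 0"
      using zautD(2)[OF t, of "zorn 1 0 0 0 0 0 0" "zorn 0 1 0 0 0 0 0"]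
        zautD(2)[OF t, of "zorn 1 0 0 0 0 0 0" "zorn 0 0 0 0 1 0 0"]
      by (simp_all add: tc d \<open>p = 0\<close> \<open>q = 0\<close> circ_zorn cprod_zorn zorn_eq_iff complex_eq_neg_self)
    note bc = this
    \<comment> \<open>The sum of \<open>a2\<close> and \<open>a3\<close> is known; \<open>r\<close>
      is twice their difference. Then \<open>S\<close> becomes \<open>r^2 = 5\<close>.\<close>
    define r where "r = 4 * a2 + 1"
    have "4 * a3 = - 1 - r" unfolding r_def using a23 by algebra
    then have a: "a1 = - 1 / 2" "a2 = (r - 1) / 4" "a3 = (- 1 - r) / 4"
      using a1 d by (auto simp: r_def complex_eq_iff)
    have "r^2 = 5" using S unfolding a bc \<open>p = 0\<close> by (simp add: field_simps power2_eq_square)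
    moreover have "t = ico_A r" by (simp add: tc ico_A_def d \<open>p = 0\<close> \<open>q = 0\<close> bc a)
    ultimately show ?thesis using std_equiv_refl by blast
  next
    assume d: "d = - 1 / 4"
    have pq: "p * q = - 5 / 16" using pq(1) by (simp add: d)
    then have nz: "p \<noteq> 0" "q \<noteq> 0" by auto
    \<comment> \<open>Now \<open>r\<close> is four times the difference of \<open>a2\<close> and
      \<open>a3\<close>.\<close>
    define r where "r = 8 * a2 + 2"
    have "8 * a3 = - r - 2" unfolding r_def using a23 by algebra
    then have a: "a1 = 1 / 8" "a2 = (r - 2) / 8" "a3 = (- r - 2) / 8"
      using a1 d by (auto simp: r_def complex_eq_iff)
    have solve: "x = z / 2 - u - y" if "2 * u + 2 * y + 2 * x = z" for u x y z :: complex
      using that by (auto simp: field_simps)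
    have "q * c1 = 5 / 8 * p" "q * c2 = - r / 8 * p" "q * c3 = r / 8 * p"
      "p * b1 = 5 / 8 * q" "p * b2 = - r / 8 * q" "p * b3 = r / 8 * q"
      using solve[OF Y(1)] solve[OF Y(2)] solve[OF Y(3)]
        solve[of "q * d" "q * a1" "p * b1" q] solve[of "q * d" "q * a2" "p * b2" "- q"]
        solve[of "q * d" "q * a3" "p * b3" "- q"] Y(4,5,6)
      unfolding a d by (simp_all add: field_simps)
    note qc = this
    \<comment> \<open>As \<open>p q = - 5 / 16\<close>, dividing by \<open>q\<close> is multiplying
      by \<open>- 16 / 5 * p\<close>. This expresses the \<open>c\<close>'s through
      \<open>p^2\<close> and, by symmetry, the \<open>b\<close>'s through
      \<open>q^2\<close>.\<close>
    have pqz: "z = (- 16 / 5) * (p * (q * z))" for z using pq by (simp flip: mult.assoc)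
    have qpz: "z = (- 16 / 5) * (q * (p * z))" for z using pqz by (simp add: mult.left_commute)
    have bc: "c1 = - 2 * p^2" "c2 = 2 * r / 5 * p^2" "c3 = - 2 * r / 5 * p^2"
      "b1 = - 2 * q^2" "b2 = 2 * r / 5 * q^2" "b3 = - 2 * r / 5 * q^2"
      by (subst pqz qpz, simp only: qc, simp add: power2_eq_square)+
    have r: "r^2 = 5"
    proof -
      have "b1 * c1 = 4 * (p * q)^2" "b2 * c2 = 4 * r^2 / 25 * (p * q)^2" "b3 * c3 = 4 * r^2 / 25 * (p * q)^2"
        by (simp_all add: bc power2_eq_square)
      with S show ?thesis unfolding pq a by (simp add: field_simps power2_eq_square)
    qed
    \<comment> \<open>The coordinate of weight 0 of
      \<open>t (x1 \<times> x2) = t x1 \<times> t x2\<close>. It ties \<open>p\<close> to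
      \<open>q^2\<close> and so determines \<open>p\<close> up to a cube root of unity.\<close>
    have "p = a1 * (b2 - b3) + a2 * (b3 - b1) + a3 * (b1 - b2)"
      using zautD(2)[OF t, of "zorn 0 1 0 0 0 0 0" "zorn 0 0 1 0 0 0 0"]
      by (simp add: tc circ_zorn cprod_zorn zorn_eq_iff algebra_simps)
    then have p: "p = 4 * r / 5 * q^2"
      unfolding a bc by (simp add: field_simps power2_eq_square)
    have p3: "p ^ 3 = 5 * r / 64"
    proof -
      have "p ^ 3 = p * p^2" by (simp add: power3_eq_cube power2_eq_square)
      also have "\<dots> = 4 * r / 5 * (p * q)^2" by (subst p) (simp add: power2_eq_square)
      finally show ?thesis by (simp add: pq power2_eq_square)
    qed
    \<comment> \<open>By \<open>p3\<close> and \<open>r^2 = 5\<close> the cubes of \<open>p\<close>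
      and \<open>r / 4\<close> agree, so \<open>w\<close> is a cube root of unity;
      \<open>center_z w\<close> conjugates \<open>p\<close> to \<open>r / 4\<close>.\<close>
    define w where "w = r / (4 * p)"
    have rr: "r * r = 5" "\<And>z. r * (r * z) = 5 * z" using r by (simp_all add: power2_eq_square flip: mult.assoc)
    have "w ^ 3 = r ^ 3 / (64 * p ^ 3)" by (simp add: w_def power_divide power_mult_distrib)
    also have "r ^ 3 = 5 * r" by (simp add: power3_eq_cube mult.assoc rr)
    finally have w: "w ^ 3 = 1" using rr(1) unfolding p3 by auto
    then have w3: "w * (w * w) = 1" "\<And>z. w * (w * (w * z)) = z" by (simp_all add: power3_eq_cube flip: mult.assoc)
    have "4 * (w * p) = r" using nz by (simp add: w_def)
    have p: "p = r / 4 * w^2"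
    proof -
      have "p = (w * (w * w)) * p" by (simp add: w3)
      also have "\<dots> = (4 * (w * p)) / 4 * w^2" by (simp add: power2_eq_square)
      finally show ?thesis using \<open>4 * (w * p) = r\<close> by simp
    qed
    have q: "q = - r / 4 * w"
    proof -
      have "q = (r * r) * (w * (w * w)) * q / 5" by (simp add: rr w3)
      also have "\<dots> = (p * q) * (4 * r / 5 * w)" unfolding p by (simp add: power2_eq_square)
      finally show ?thesis by (simp add: pq)
    qed
    have bcw: "b1 = - 5 / 8 * w^2" "b2 = r / 8 * w^2" "b3 = - r / 8 * w^2"
      "c1 = - 5 / 8 * w" "c2 = r / 8 * w" "c3 = - r / 8 * w"
      unfolding bc p q using w3 by (simp_all add: power2_eq_square field_simps rr)
    have "center_z w ** t = ico_B r ** center_z w"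
      unfolding tc a d p q bcw
      by (intro matrix_eq_zornI)
        (simp add: ico_B_def circ_zorn center_z_zorn zorn_eq_iff power2_eq_square w3 field_simps flip: matrix_vector_mul_assoc)
    with r show ?thesis using std_equiv_center[OF w] by blast
  qed
qed

section \<open>Presentations of the polyhedral groups adapted to the tetrahedral subgroup\<close>

text \<open>The identity outside of the carrier, so that rewriting with products of translations needs no membership conditions.\<close>

definition lact :: "('a, 'b) monoid_scheme \<Rightarrow> 'a \<Rightarrow> 'a \<Rightarrow> 'a" where
  "lact G g z = (if z \<in> carrier G then g \<otimes>\<^bsub>G\<^esub> z else z)"

definition poly_rel :: "('a, 'b) monoid_scheme \<Rightarrow> nat \<Rightarrow> 'a \<Rightarrow> 'a \<Rightarrow> 'a \<Rightarrow> bool" where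
  "poly_rel G n a b c \<longleftrightarrow> a \<in> carrier G \<and> b \<in> carrier G \<and> c \<in> carrier G \<and> a [^]\<^bsub>G\<^esub> n = \<one>\<^bsub>G\<^esub> \<and>
     b [^]\<^bsub>G\<^esub> (3::nat) = \<one>\<^bsub>G\<^esub> \<and> c [^]\<^bsub>G\<^esub> (2::nat) = \<one>\<^bsub>G\<^esub> \<and> a \<otimes>\<^bsub>G\<^esub> b \<otimes>\<^bsub>G\<^esub> c = \<one>\<^bsub>G\<^esub>"

text \<open>\<open>b\<close> abbreviates the conjugate of \<open>a\<close> by \<open>s\<close>. That
  \<open>a\<close> and \<open>b\<close> generate a Klein four-group is a consequence, drawn in
  \<open>tet_rel_lact\<close>.\<close>

definition tet_rel :: "('a, 'b) monoid_scheme \<Rightarrow> 'a \<Rightarrow> 'a \<Rightarrow> 'a \<Rightarrow> bool" where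
  "tet_rel G a b s \<longleftrightarrow> a \<in> carrier G \<and> s \<in> carrier G \<and> a \<otimes>\<^bsub>G\<^esub> a = \<one>\<^bsub>G\<^esub> \<and> s \<otimes>\<^bsub>G\<^esub> s \<otimes>\<^bsub>G\<^esub> s = \<one>\<^bsub>G\<^esub> \<and>
     b = s \<otimes>\<^bsub>G\<^esub> a \<otimes>\<^bsub>G\<^esub> s \<otimes>\<^bsub>G\<^esub> s \<and> a \<otimes>\<^bsub>G\<^esub> b = s \<otimes>\<^bsub>G\<^esub> s \<otimes>\<^bsub>G\<^esub> a \<otimes>\<^bsub>G\<^esub> s"

definition oct_rel :: "('a, 'b) monoid_scheme \<Rightarrow> 'a \<Rightarrow> 'a \<Rightarrow> 'a \<Rightarrow> 'a \<Rightarrow> bool" where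
  "oct_rel G a b s t \<longleftrightarrow> tet_rel G a b s \<and> t \<in> carrier G \<and> t \<otimes>\<^bsub>G\<^esub> t = \<one>\<^bsub>G\<^esub> \<and>
     t \<otimes>\<^bsub>G\<^esub> s \<otimes>\<^bsub>G\<^esub> t = s \<otimes>\<^bsub>G\<^esub> s \<and> t \<otimes>\<^bsub>G\<^esub> a = a \<otimes>\<^bsub>G\<^esub> t"

definition ico_rel :: "('a, 'b) monoid_scheme \<Rightarrow> 'a \<Rightarrow> 'a \<Rightarrow> 'a \<Rightarrow> 'a \<Rightarrow> bool" where
  "ico_rel G a b s t \<longleftrightarrow> tet_rel G a b s \<and> t \<in> carrier G \<and> t \<otimes>\<^bsub>G\<^esub> t = \<one>\<^bsub>G\<^esub> \<and>
     t \<otimes>\<^bsub>G\<^esub> s \<otimes>\<^bsub>G\<^esub> t = s \<otimes>\<^bsub>G\<^esub> s \<and> t \<otimes>\<^bsub>G\<^esub> a \<otimes>\<^bsub>G\<^esub> t = a \<otimes>\<^bsub>G\<^esub> t \<otimes>\<^bsub>G\<^esub> a"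

context group
begin

lemma lact_mult:
  "g \<in> carrier G \<Longrightarrow> h \<in> carrier G \<Longrightarrow> lact G (g \<otimes> h) z = lact G g (lact G h z)"
  by (simp add: lact_def m_assoc)

lemma lact_one: "lact G \<one> z = z"
  by (simp add: lact_def)

lemma lact_cong: "g = h \<Longrightarrow> lact G g z = lact G h z"
  by simp

lemma lact_eqI:
  assumes "g \<in> carrier G" "h \<in> carrier G" "\<And>z. lact G g z = lact G h z"
  shows "g = h"
  using assms(1,2) assms(3)[of \<one>] by (simp add: lact_def)

text \<open>From \<open>a b c = 1\<close> comes \<open>a = c b b\<close>. Everything is thus a word
  in \<open>b\<close> and \<open>c\<close>, and the relator \<open>a^n\<close> becomes an
  \<open>n\<close>-fold iterate.\<close>

lemma poly_rel_lact:
  assumes "poly_rel G n a b c"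
  shows "a = c \<otimes> (b \<otimes> b)" and "lact G b (lact G b (lact G b z)) = z" and "lact G c (lact G c z) = z"
    and "(\<lambda>z. lact G c (lact G b (lact G b z))) ^^ n = id"
proof -
  have cl: "a \<in> carrier G" "b \<in> carrier G" "c \<in> carrier G"
    and an: "a [^] n = \<one>" and b3: "b \<otimes> b \<otimes> b = \<one>" and c2: "c \<otimes> c = \<one>" and abc: "a \<otimes> b \<otimes> c = \<one>"
    using assms by (auto simp: poly_rel_def numeral_3_eq_3 numeral_2_eq_2)
  show B: "lact G b (lact G b (lact G b z)) = z" for z
    using lact_cong[OF b3, of z] cl by (simp add: lact_mult lact_one)
  show C: "lact G c (lact G c z) = z" for z
    using lact_cong[OF c2, of z] cl by (simp add: lact_mult lact_one)
  have A: "lact G a (lact G b (lact G c z)) = z" for z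
    using lact_cong[OF abc, of z] cl by (simp add: lact_mult lact_one)
  show a: "a = c \<otimes> (b \<otimes> b)"
  proof (rule lact_eqI)
    fix z show "lact G a z = lact G (c \<otimes> (b \<otimes> b)) z"
      using A[of "lact G c (lact G b (lact G b z))"] cl by (simp add: lact_mult B C)
  qed (use cl in auto)
  have "((\<lambda>z. lact G c (lact G b (lact G b z))) ^^ k) z = lact G (a [^] k) z" for k z
  proof (induction k)
    case (Suc k)
    then show ?case using cl by (subst nat_pow_Suc2) (simp_all add: lact_mult a)
  qed (simp add: lact_one)
  then show "(\<lambda>z. lact G c (lact G b (lact G b z))) ^^ n = id"
    by (auto simp: an lact_one)
qed

lemma tet_rel_of_poly_rel:
  assumes "poly_rel G 3 a b c"
  shows "tet_rel G c (b \<otimes> c \<otimes> b \<otimes> b) b"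
proof -
  let ?c = "lact G c" and ?b = "lact G b"
  have cl: "a \<in> carrier G" "b \<in> carrier G" "c \<in> carrier G"
    using assms by (auto simp: poly_rel_def)
  note R = poly_rel_lact(2,3)[OF assms]
  \<comment> \<open>The relator \<open>(c b b)^3\<close>. The following rules arise from it by
    cancelling letters on the left and at the argument, until \<open>r12\<close> states the missing
    relation of \<open>tet_rel\<close>.\<close>
  have r5: "?c (?b (?b (?c (?b (?b (?c (?b (?b z)))))))) = z" for z
    using fun_cong[OF poly_rel_lact(4)[OF assms], of z] by (simp add: eval_nat_numeral)
  have r6: "?b (?b (?c (?b (?b (?c (?b (?b z))))))) = ?c z" for z using r5[of z] by (metis R)
  have r8: "?c (?b (?b (?c (?b (?b z))))) = ?b (?c z)" for z using r6[of z] by (metis R)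
  have r9: "?b (?b (?c (?b (?b z)))) = ?c (?b (?c z))" for z using r8[of z] by (metis R)
  have r12: "?c (?b (?c (?b (?b z)))) = ?b (?b (?c (?b z)))" for z
    using r9[of "?b (?b z)"] by (simp add: R)
  have "c \<otimes> (b \<otimes> c \<otimes> b \<otimes> b) = b \<otimes> b \<otimes> c \<otimes> b"
    by (rule lact_eqI) (use cl in \<open>simp_all add: lact_mult r12\<close>)
  then show ?thesis using assms cl by (auto simp: tet_rel_def poly_rel_def numeral_3_eq_3 numeral_2_eq_2)
qed

text \<open>The inverse of \<open>a\<close> is \<open>b c\<close>, so \<open>v\<close> is the
  conjugate by \<open>b\<close> of the involution \<open>a^2\<close>: an element of the normal Klein
  four-group. \<open>t\<close> is the product of the commuting involutions \<open>c\<close> and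
  \<open>v\<close>.\<close>

lemma oct_rel_of_poly_rel:
  assumes "poly_rel G 4 a b c"
  defines "v \<equiv> b \<otimes> b \<otimes> c \<otimes> b \<otimes> c \<otimes> b \<otimes> b"
  shows "oct_rel G v (b \<otimes> v \<otimes> b \<otimes> b) b (c \<otimes> v)" and "c = (c \<otimes> v) \<otimes> v"
proof -
  let ?c = "lact G c" and ?b = "lact G b"
  have cl: "a \<in> carrier G" "b \<in> carrier G" "c \<in> carrier G" "v \<in> carrier G"
    using assms by (auto simp: poly_rel_def)
  note R = poly_rel_lact(2,3)[OF assms(1)]
  have r5: "?c (?b (?b (?c (?b (?b (?c (?b (?b (?c (?b (?b z))))))))))) = z" for z
    using fun_cong[OF poly_rel_lact(4)[OF assms(1)], of z] by (simp add: eval_nat_numeral)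
  have r6: "?b (?b (?c (?b (?b (?c (?b (?b (?c (?b (?b z)))))))))) = ?c z" for z using r5[of z] by (metis R)
  have r8: "?c (?b (?b (?c (?b (?b (?c (?b (?b z)))))))) = ?b (?c z)" for z using r6[of z] by (metis R)
  have r9: "?b (?b (?c (?b (?b (?c (?b (?b z))))))) = ?c (?b (?c z))" for z using r8[of z] by (metis R)
  have r10: "?b (?c (?b (?b (?c (?b (?b z)))))) = ?b (?b (?c (?b (?c z))))" for z using r9[of z] by (metis R)
  have r11: "?b (?c (?b (?c z))) = ?c (?b (?b (?c (?b (?b z)))))" for z using r9[of z] by (metis R)
  have r13: "?b (?b (?c (?b (?b (?c z))))) = ?c (?b (?c (?b z)))" for z using r9[of "?b z"] by (simp add: R)
  have r14: "?b (?b (?c (?b (?c (?b z))))) = ?b (?c (?b (?b (?c z))))" for z using r13[of z] by (metis R)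
  \<comment> \<open>A single letter for the inverse of \<open>b\<close>, so that the derived
    relations work as rewrite rules on words in \<open>b\<close>, \<open>B\<close> and
    \<open>c\<close>.\<close>
  define B where "B z = ?b (?b z)" for z
  have RB: "?b (?b z) = B z" "?b (B z) = z" "B (?b z) = z" "B (B z) = ?b z" "?c (?c z) = z" for z
    by (simp_all add: B_def R)
  note K = r10[folded B_def] r11[folded B_def] r13[folded B_def] r14[folded B_def]
  have e: "v \<otimes> v = \<one>" "v \<otimes> (b \<otimes> v \<otimes> b \<otimes> b) = b \<otimes> b \<otimes> v \<otimes> b" "(c \<otimes> v) \<otimes> (c \<otimes> v) = \<one>"
    "(c \<otimes> v) \<otimes> b \<otimes> (c \<otimes> v) = b \<otimes> b" "(c \<otimes> v) \<otimes> v = v \<otimes> (c \<otimes> v)" "(c \<otimes> v) \<otimes> v = c"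
    unfolding v_def by (rule lact_eqI; use cl in \<open>simp add: lact_mult lact_one RB K\<close>)+
  show "oct_rel G v (b \<otimes> v \<otimes> b \<otimes> b) b (c \<otimes> v)" "c = (c \<otimes> v) \<otimes> v"
    using e assms(1) cl by (auto simp: oct_rel_def tet_rel_def poly_rel_def numeral_3_eq_3)
qed

text \<open>Both \<open>v\<close> and \<open>t\<close> are conjugates of the involution
  \<open>c\<close>, by \<open>c b b\<close> and by \<open>c b c b b\<close>. The last five equations
  place \<open>v\<close>, \<open>t\<close>, \<open>t v\<close>, \<open>t w\<close> and
  \<open>t v w\<close> in their conjugacy classes, where \<open>w\<close> is the conjugate of
  \<open>v\<close> by \<open>b\<close>.\<close>

lemma ico_rel_of_poly_rel:
  assumes "poly_rel G 5 a b c"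
  defines "v \<equiv> c \<otimes> b \<otimes> b \<otimes> c \<otimes> b \<otimes> c" and "t \<equiv> c \<otimes> b \<otimes> c \<otimes> b \<otimes> b \<otimes> c \<otimes> b \<otimes> c \<otimes> b \<otimes> b \<otimes> c"
  shows "ico_rel G v (b \<otimes> v \<otimes> b \<otimes> b) b t" and "c = v \<otimes> b \<otimes> t \<otimes> v"
    and "v \<otimes> (c \<otimes> b \<otimes> b) = (c \<otimes> b \<otimes> b) \<otimes> c" and "t \<otimes> (c \<otimes> b \<otimes> c \<otimes> b \<otimes> b) = (c \<otimes> b \<otimes> c \<otimes> b \<otimes> b) \<otimes> c"
    and "c \<otimes> b \<otimes> (t \<otimes> v) = b \<otimes> b \<otimes> (c \<otimes> b)"
    and "b \<otimes> b \<otimes> c \<otimes> b \<otimes> (t \<otimes> (b \<otimes> v \<otimes> b \<otimes> b)) = a \<otimes> (b \<otimes> b \<otimes> c \<otimes> b)"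
    and "t \<otimes> (v \<otimes> (b \<otimes> v \<otimes> b \<otimes> b)) = a \<otimes> a"
proof -
  let ?c = "lact G c" and ?b = "lact G b"
  have cl: "a \<in> carrier G" "b \<in> carrier G" "c \<in> carrier G" "v \<in> carrier G" "t \<in> carrier G"
    using assms by (auto simp: poly_rel_def)
  note R = poly_rel_lact(2,3)[OF assms(1)] and a = poly_rel_lact(1)[OF assms(1)]
  have r5: "?c (?b (?b (?c (?b (?b (?c (?b (?b (?c (?b (?b (?c (?b (?b z)))))))))))))) = z" for z
    using fun_cong[OF poly_rel_lact(4)[OF assms(1)], of z] by (simp add: eval_nat_numeral)
  have r6: "?b (?b (?c (?b (?b (?c (?b (?b (?c (?b (?b (?c (?b (?b z))))))))))))) = ?c z" for z
    using r5[of z] by (metis R)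
  have r8: "?c (?b (?b (?c (?b (?b (?c (?b (?b (?c (?b (?b z))))))))))) = ?b (?c z)" for z
    using r6[of z] by (metis R)
  have r9: "?b (?b (?c (?b (?b (?c (?b (?b (?c (?b (?b z)))))))))) = ?c (?b (?c z))" for z
    using r8[of z] by (metis R)
  have r11: "?c (?b (?b (?c (?b (?b (?c (?b (?b z)))))))) = ?b (?c (?b (?c z)))" for z
    using r9[of z] by (metis R)
  have r12: "?b (?b (?c (?b (?b (?c (?b (?b z))))))) = ?c (?b (?c (?b (?c z))))" for z
    using r11[of z] by (metis R)
  have r13: "?b (?b (?c (?b (?c (?b (?c z)))))) = ?b (?c (?b (?b (?c (?b (?b z))))))" for z
    using r12[of z] by (metis R)
  have r15: "?c (?b (?c (?b (?c (?b (?b z)))))) = ?b (?b (?c (?b (?b (?c (?b z))))))" for z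
    using r12[of "?b (?b z)"] by (simp add: R)
  have r16: "?c (?b (?c (?b (?c (?b z))))) = ?b (?b (?c (?b (?b (?c z)))))" for z
    using r12[of "?b z"] by (simp add: R)
  have r21: "?b (?c (?b (?c (?b z)))) = ?c (?b (?b (?c (?b (?b (?c z))))))" for z
    using r16[of z] by (metis R)
  define B where "B z = ?b (?b z)" for z
  have RB: "?b (?b z) = B z" "?b (B z) = z" "B (?b z) = z" "B (B z) = ?b z" "?c (?c z) = z" for z
    by (simp_all add: B_def R)
  note K0 = r12[folded B_def] r13[folded B_def] r15[folded B_def] r21[folded B_def]
  \<comment> \<open>Further rules obtained from overlaps of the four rules above with one another
    and with the cancellations.\<close>
  have k1: "?c (B (?c (B (?c (?b z))))) = ?b (?c (?b (?c (B z))))" for z by (metis RB(5) K0(3))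
  have k2: "?b (?c (B (?c (B (?c z))))) = B (?c (?b (?c (?b z))))" for z by (metis RB(5) K0(2))
  have k3: "B (?c (B (?c (?b (?c (B (?c (B z)))))))) = ?c (?b (?c (B (?c (?b (?c z))))))" for z
    using K0(1)[of "?c (?b (?c (?b (?c z))))"] by (simp only: K0(2) RB)
  have k4: "?b (?c (B (?c (?b (?c (B (?c (B z)))))))) = B (?c (?b (?c (B (?c (?b (?c z)))))))" for z
    using arg_cong[OF k3[of z], of B] by (simp only: RB)
  have k5: "?b (?c (?b (?c (B (?c (?b (?c z))))))) = ?c (B (?c (?b (?c (B (?c (B z)))))))" for z
    using arg_cong[OF k3[of z], of ?b] by (simp only: RB)
  have k6: "B (?c (B (?c (?b (?c (B (?c z))))))) = ?c (?b (?c (B (?c (?b (?c (?b z)))))))" for z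
    using K0(3)[of "?c (B (?c z))"] by (simp only: k2)
  note K = K0 k1 k2 k4 k5 k6
  have e: "v \<otimes> v = \<one>" "v \<otimes> (b \<otimes> v \<otimes> b \<otimes> b) = b \<otimes> b \<otimes> v \<otimes> b" "t \<otimes> t = \<one>" "t \<otimes> b \<otimes> t = b \<otimes> b"
    "t \<otimes> v \<otimes> t = v \<otimes> t \<otimes> v"
    unfolding v_def t_def by (rule lact_eqI; use cl in \<open>simp add: lact_mult lact_one RB K\<close>)+
  show "ico_rel G v (b \<otimes> v \<otimes> b \<otimes> b) b t"
    using e assms(1) cl by (auto simp: ico_rel_def tet_rel_def poly_rel_def numeral_3_eq_3)
  show "c = v \<otimes> b \<otimes> t \<otimes> v" "v \<otimes> (c \<otimes> b \<otimes> b) = (c \<otimes> b \<otimes> b) \<otimes> c"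
    "t \<otimes> (c \<otimes> b \<otimes> c \<otimes> b \<otimes> b) = (c \<otimes> b \<otimes> c \<otimes> b \<otimes> b) \<otimes> c"
    "c \<otimes> b \<otimes> (t \<otimes> v) = b \<otimes> b \<otimes> (c \<otimes> b)"
    "b \<otimes> b \<otimes> c \<otimes> b \<otimes> (t \<otimes> (b \<otimes> v \<otimes> b \<otimes> b)) = a \<otimes> (b \<otimes> b \<otimes> c \<otimes> b)"
    "t \<otimes> (v \<otimes> (b \<otimes> v \<otimes> b \<otimes> b)) = a \<otimes> a"
    unfolding v_def t_def a by (rule lact_eqI; use cl in \<open>simp add: lact_mult lact_one RB K\<close>)+
qed

end

section \<open>Normal forms of elements and their conjugacy classes\<close>

definition conj_in :: "('a, 'b) monoid_scheme \<Rightarrow> 'a \<Rightarrow> 'a \<Rightarrow> bool" where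
  "conj_in G x y \<longleftrightarrow> (\<exists>g\<in>carrier G. x = g \<otimes>\<^bsub>G\<^esub> y \<otimes>\<^bsub>G\<^esub> inv\<^bsub>G\<^esub> g)"

definition tet_elements :: "('a, 'b) monoid_scheme \<Rightarrow> 'a \<Rightarrow> 'a \<Rightarrow> 'a \<Rightarrow> 'a set" where
  "tet_elements G a b s = {\<one>\<^bsub>G\<^esub>, a, b, a \<otimes>\<^bsub>G\<^esub> b, s, a \<otimes>\<^bsub>G\<^esub> s, b \<otimes>\<^bsub>G\<^esub> s, a \<otimes>\<^bsub>G\<^esub> (b \<otimes>\<^bsub>G\<^esub> s),
     s \<otimes>\<^bsub>G\<^esub> s, a \<otimes>\<^bsub>G\<^esub> (s \<otimes>\<^bsub>G\<^esub> s), b \<otimes>\<^bsub>G\<^esub> (s \<otimes>\<^bsub>G\<^esub> s), a \<otimes>\<^bsub>G\<^esub> (b \<otimes>\<^bsub>G\<^esub> (s \<otimes>\<^bsub>G\<^esub> s))}"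

context group
begin

lemma conj_inI:
  assumes "g \<in> carrier G" "x \<in> carrier G" "y \<in> carrier G" "x \<otimes> g = g \<otimes> y"
  shows "conj_in G x y"
  unfolding conj_in_def using assms by (metis inv_solve_right m_closed)

lemma conj_in_refl: "x \<in> carrier G \<Longrightarrow> conj_in G x x"
  by (rule conj_inI[of \<one>]) auto

lemma conj_in_trans:
  assumes "conj_in G x y" "conj_in G y z" "z \<in> carrier G"
  shows "conj_in G x z"
proof -
  obtain g h where "g \<in> carrier G" "h \<in> carrier G" "x = g \<otimes> y \<otimes> inv g" "y = h \<otimes> z \<otimes> inv h"
    using assms by (auto simp: conj_in_def)
  with assms(3) show ?thesis
    unfolding conj_in_def by (intro bexI[of _ "g \<otimes> h"]) (simp_all add: inv_mult_group m_assoc)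
qed

lemma conj_in_sym:
  assumes "conj_in G x y" "y \<in> carrier G"
  shows "conj_in G y x"
proof -
  obtain g where "g \<in> carrier G" "x = g \<otimes> y \<otimes> inv g" using assms by (auto simp: conj_in_def)
  with assms show ?thesis by (intro conj_inI[of "inv g"]) (simp_all add: m_assoc inv_solve_left' flip: m_assoc)
qed

text \<open>Both \<open>b\<close> and \<open>a b\<close> are conjugates of \<open>a\<close> under
  powers of \<open>s\<close>, hence of square one, and elements of square one whose product has
  square one commute.\<close>

lemma tet_rel_lact:
  assumes "tet_rel G a b s"
  shows "lact G a (lact G a z) = z" "lact G b (lact G b z) = z" "lact G s (lact G s (lact G s z)) = z"
    "lact G b (lact G a z) = lact G a (lact G b z)" "lact G s (lact G a z) = lact G b (lact G s z)"
    "lact G s (lact G b z) = lact G a (lact G b (lact G s z))"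
    "lact G s (lact G s (lact G a (lact G s z))) = lact G a (lact G b z)"
    "lact G b z = lact G s (lact G a (lact G s (lact G s z)))"
proof -
  have cl: "a \<in> carrier G" "s \<in> carrier G" "b \<in> carrier G" and e: "a \<otimes> a = \<one>" "s \<otimes> s \<otimes> s = \<one>"
    "a \<otimes> b = s \<otimes> s \<otimes> a \<otimes> s" and b: "b = s \<otimes> a \<otimes> s \<otimes> s"
    using assms by (auto simp: tet_rel_def)
  have B: "lact G b z = lact G s (lact G a (lact G s (lact G s z)))" for z
    using cl unfolding b by (simp add: lact_mult)
  have A2: "lact G a (lact G a z) = z" and S3: "lact G s (lact G s (lact G s z)) = z"
    and AB: "lact G a (lact G b z) = lact G s (lact G s (lact G a (lact G s z)))" for z
    using e[THEN lact_cong, of z] cl by (simp_all add: lact_mult lact_one)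
  show "lact G a (lact G a z) = z" "lact G s (lact G s (lact G s z)) = z"
    "lact G b z = lact G s (lact G a (lact G s (lact G s z)))"
    "lact G s (lact G s (lact G a (lact G s z))) = lact G a (lact G b z)"
    using A2 S3 B AB by auto
  show B2: "lact G b (lact G b z) = z" for z by (simp add: B S3 A2)
  have "lact G a (lact G b (lact G a (lact G b z))) = z" for z by (simp add: AB S3 A2)
  then show "lact G b (lact G a z) = lact G a (lact G b z)" by (metis A2 B2)
  show "lact G s (lact G a z) = lact G b (lact G s z)" by (simp add: B S3)
  show "lact G s (lact G b z) = lact G a (lact G b (lact G s z))"
    unfolding AB by (simp add: B)
qed

lemma tet_rel_simps:
  assumes "tet_rel G a b s" and z: "z \<in> carrier G"
  shows "a \<otimes> (a \<otimes> z) = z" "b \<otimes> (b \<otimes> z) = z" "s \<otimes> (s \<otimes> (s \<otimes> z)) = z"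
    "b \<otimes> (a \<otimes> z) = a \<otimes> (b \<otimes> z)" "s \<otimes> (a \<otimes> z) = b \<otimes> (s \<otimes> z)" "s \<otimes> (b \<otimes> z) = a \<otimes> (b \<otimes> (s \<otimes> z))"
  using tet_rel_lact[OF assms(1), of z] assms by (auto simp: lact_def tet_rel_def)

lemma tet_rel_closed: "tet_rel G a b s \<Longrightarrow> a \<in> carrier G \<and> b \<in> carrier G \<and> s \<in> carrier G"
  by (auto simp: tet_rel_def)

lemma tet_rel_simps':
  assumes "tet_rel G a b s"
  shows "a \<otimes> a = \<one>" "b \<otimes> b = \<one>" "s \<otimes> (s \<otimes> s) = \<one>"
    "b \<otimes> a = a \<otimes> b" "s \<otimes> a = b \<otimes> s" "s \<otimes> b = a \<otimes> (b \<otimes> s)"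
  using tet_rel_simps[OF assms, of \<one>] tet_rel_closed[OF assms] by auto

lemma poly_rel_of_tet_rel:
  assumes "tet_rel G a b s"
  shows "poly_rel G 3 (a \<otimes> s \<otimes> s) s a"
  using tet_rel_closed[OF assms]
  by (simp add: poly_rel_def eval_nat_numeral m_assoc tet_rel_simps[OF assms] tet_rel_simps'[OF assms])

lemma oct_rel_lact:
  assumes "oct_rel G a b s t"
  shows "lact G t (lact G t z) = z" "lact G t (lact G s z) = lact G s (lact G s (lact G t z))"
    "lact G t (lact G a z) = lact G a (lact G t z)" "lact G t (lact G b z) = lact G a (lact G b (lact G t z))"
proof -
  have T: "tet_rel G a b s" and cl: "a \<in> carrier G" "s \<in> carrier G" "t \<in> carrier G"
    and e: "t \<otimes> t = \<one>" "t \<otimes> s \<otimes> t = s \<otimes> s" "t \<otimes> a = a \<otimes> t"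
    using assms by (auto simp: oct_rel_def tet_rel_def)
  show t2: "lact G t (lact G t z) = z" and ta: "lact G t (lact G a z) = lact G a (lact G t z)" for z
    using e[THEN lact_cong, of z] cl by (simp_all add: lact_mult lact_one)
  show ts: "lact G t (lact G s z) = lact G s (lact G s (lact G t z))" for z
    using e(2)[THEN lact_cong, of "lact G t z"] cl by (simp add: lact_mult t2)
  show "lact G t (lact G b z) = lact G a (lact G b (lact G t z))"
    unfolding tet_rel_lact(7)[OF T, symmetric]
    by (subst tet_rel_lact(8)[OF T]) (simp add: ts ta tet_rel_lact(3)[OF T])
qed

lemma oct_rel_simps:
  assumes "oct_rel G a b s t" and "z \<in> carrier G"
  shows "t \<otimes> (t \<otimes> z) = z" "t \<otimes> (s \<otimes> z) = s \<otimes> (s \<otimes> (t \<otimes> z))"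
    "t \<otimes> (a \<otimes> z) = a \<otimes> (t \<otimes> z)" "t \<otimes> (b \<otimes> z) = a \<otimes> (b \<otimes> (t \<otimes> z))"
  using oct_rel_lact[OF assms(1), of z] assms by (auto simp: lact_def oct_rel_def tet_rel_def)

lemma oct_rel_simps':
  assumes "oct_rel G a b s t"
  shows "t \<otimes> t = \<one>" "t \<otimes> s = s \<otimes> (s \<otimes> t)" "t \<otimes> a = a \<otimes> t" "t \<otimes> b = a \<otimes> (b \<otimes> t)"
  using oct_rel_simps[OF assms, of \<one>] assms by (auto simp: oct_rel_def tet_rel_def)

lemma poly_rel_of_oct_rel:
  assumes "oct_rel G a b s t"
  shows "poly_rel G 4 (t \<otimes> a \<otimes> s \<otimes> s) s (t \<otimes> a)"
proof -
  have T: "tet_rel G a b s" and t: "t \<in> carrier G" using assms by (auto simp: oct_rel_def)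
  show ?thesis using tet_rel_closed[OF T] t
    by (simp add: poly_rel_def eval_nat_numeral m_assoc tet_rel_simps[OF T] tet_rel_simps'[OF T]
        oct_rel_simps[OF assms] oct_rel_simps'[OF assms])
qed

text \<open>\<open>t\<close> inverts \<open>s\<close>, so the rules for \<open>t b t\<close> and
  \<open>t a b t\<close> are the rule for \<open>t a t\<close> conjugated by powers of
  \<open>s\<close>.\<close>

lemma ico_rel_lact:
  assumes "ico_rel G a b s t"
  shows "lact G t (lact G t z) = z" "lact G s (lact G t z) = lact G t (lact G s (lact G s z))"
    "lact G t (lact G a (lact G t z)) = lact G a (lact G t (lact G a z))"
    "lact G t (lact G b (lact G t z)) = lact G a (lact G b (lact G t (lact G b (lact G s (lact G s z)))))"
    "lact G t (lact G a (lact G b (lact G t z))) = lact G b (lact G t (lact G a (lact G b (lact G s z))))"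
proof -
  have T: "tet_rel G a b s" and cl: "a \<in> carrier G" "s \<in> carrier G" "t \<in> carrier G"
    and e: "t \<otimes> t = \<one>" "t \<otimes> s \<otimes> t = s \<otimes> s" "t \<otimes> a \<otimes> t = a \<otimes> t \<otimes> a"
    using assms by (auto simp: ico_rel_def tet_rel_def)
  show t2: "lact G t (lact G t z) = z"
    and ta: "lact G t (lact G a (lact G t z)) = lact G a (lact G t (lact G a z))" for z
    using e[THEN lact_cong, of z] cl by (simp_all add: lact_mult lact_one)
  have ts: "lact G t (lact G s z) = lact G s (lact G s (lact G t z))" for z
    using e(2)[THEN lact_cong, of "lact G t z"] cl by (simp add: lact_mult t2)
  show st: "lact G s (lact G t z) = lact G t (lact G s (lact G s z))" for z
    by (simp add: ts tet_rel_lact(3)[OF T])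
  have "lact G t (lact G b (lact G t z)) = lact G s (lact G s (lact G t (lact G a (lact G t (lact G s z)))))"
    by (subst tet_rel_lact(8)[OF T]) (simp add: ts tet_rel_lact(3)[OF T])
  also have "\<dots> = lact G a (lact G b (lact G t (lact G b (lact G s (lact G s z)))))"
    unfolding ta by (simp add: st tet_rel_lact(1-6)[OF T])
  finally show "lact G t (lact G b (lact G t z)) = lact G a (lact G b (lact G t (lact G b (lact G s (lact G s z)))))" .
  have "lact G t (lact G a (lact G b (lact G t z))) = lact G s (lact G t (lact G a (lact G t (lact G s (lact G s z)))))"
    unfolding tet_rel_lact(7)[OF T, symmetric] by (simp add: ts tet_rel_lact(3)[OF T])
  also have "\<dots> = lact G b (lact G t (lact G a (lact G b (lact G s z))))"
    unfolding ta by (simp add: st tet_rel_lact(1-6)[OF T])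
  finally show "lact G t (lact G a (lact G b (lact G t z))) = lact G b (lact G t (lact G a (lact G b (lact G s z))))" .
qed

lemma ico_rel_simps:
  assumes "ico_rel G a b s t" and "z \<in> carrier G"
  shows "t \<otimes> (t \<otimes> z) = z" "s \<otimes> (t \<otimes> z) = t \<otimes> (s \<otimes> (s \<otimes> z))"
    "t \<otimes> (a \<otimes> (t \<otimes> z)) = a \<otimes> (t \<otimes> (a \<otimes> z))"
    "t \<otimes> (b \<otimes> (t \<otimes> z)) = a \<otimes> (b \<otimes> (t \<otimes> (b \<otimes> (s \<otimes> (s \<otimes> z)))))"
    "t \<otimes> (a \<otimes> (b \<otimes> (t \<otimes> z))) = b \<otimes> (t \<otimes> (a \<otimes> (b \<otimes> (s \<otimes> z))))"
  using ico_rel_lact[OF assms(1), of z] assms by (auto simp: lact_def ico_rel_def tet_rel_def)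

lemma ico_rel_simps':
  assumes "ico_rel G a b s t"
  shows "t \<otimes> t = \<one>" "s \<otimes> t = t \<otimes> (s \<otimes> s)" "t \<otimes> (a \<otimes> t) = a \<otimes> (t \<otimes> a)"
    "t \<otimes> (b \<otimes> t) = a \<otimes> (b \<otimes> (t \<otimes> (b \<otimes> (s \<otimes> s))))" "t \<otimes> (a \<otimes> (b \<otimes> t)) = b \<otimes> (t \<otimes> (a \<otimes> (b \<otimes> s)))"
  using ico_rel_simps[OF assms, of \<one>] assms by (auto simp: ico_rel_def tet_rel_def)

lemma poly_rel_of_ico_rel:
  assumes "ico_rel G a b s t"
  shows "poly_rel G 5 (a \<otimes> s \<otimes> t \<otimes> a \<otimes> s \<otimes> s) s (a \<otimes> s \<otimes> t \<otimes> a)"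
proof -
  have T: "tet_rel G a b s" and t: "t \<in> carrier G" using assms by (auto simp: ico_rel_def)
  show ?thesis using tet_rel_closed[OF T] t
    by (simp add: poly_rel_def eval_nat_numeral m_assoc tet_rel_simps[OF T] tet_rel_simps'[OF T]
        ico_rel_simps[OF assms] ico_rel_simps'[OF assms])
qed

lemma tet_elements_closed:
  assumes T: "tet_rel G a b s"
  shows "tet_elements G a b s \<subseteq> carrier G" "\<one> \<in> tet_elements G a b s"
    and "x \<in> tet_elements G a b s \<Longrightarrow> a \<otimes> x \<in> tet_elements G a b s"
    and "x \<in> tet_elements G a b s \<Longrightarrow> s \<otimes> x \<in> tet_elements G a b s"
    and "x \<in> tet_elements G a b s \<Longrightarrow> y \<in> tet_elements G a b s \<Longrightarrow> x \<otimes> y \<in> tet_elements G a b s"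
proof -
  let ?N = "tet_elements G a b s"
  have cl: "a \<in> carrier G" "b \<in> carrier G" "s \<in> carrier G" using tet_rel_closed[OF T] by auto
  note rules = m_assoc tet_rel_simps[OF T] tet_rel_simps'[OF T]
  show sub: "?N \<subseteq> carrier G" and "\<one> \<in> ?N" using cl by (auto simp: tet_elements_def)
  show a: "a \<otimes> x \<in> ?N" if "x \<in> ?N" for x
    using that cl unfolding tet_elements_def by (elim insertE emptyE) (simp_all add: rules)
  show s: "s \<otimes> x \<in> ?N" if "x \<in> ?N" for x
    using that cl unfolding tet_elements_def by (elim insertE emptyE) (simp_all add: rules)
  have b: "b \<otimes> x \<in> ?N" if "x \<in> ?N" for x
    using that cl unfolding tet_elements_def by (elim insertE emptyE) (simp_all add: rules)
  have "x \<otimes> y \<in> ?N" if "x = \<one> \<or> x = a \<or> x = b \<or> x = a \<otimes> b \<or> x = s \<or> x = a \<otimes> s \<or> x = b \<otimes> s \<or> x = a \<otimes> (b \<otimes> s) \<or>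
     x = s \<otimes> s \<or> x = a \<otimes> (s \<otimes> s) \<or> x = b \<otimes> (s \<otimes> s) \<or> x = a \<otimes> (b \<otimes> (s \<otimes> s))" "y \<in> ?N" for x y
  proof -
    have "y \<in> carrier G" using that sub by auto
    with that cl show ?thesis by (elim disjE) (simp_all add: m_assoc a b s)
  qed
  then show "x \<in> ?N \<Longrightarrow> y \<in> ?N \<Longrightarrow> x \<otimes> y \<in> ?N"
    by (simp add: tet_elements_def)
qed

lemma tet_elements_conj:
  assumes T: "tet_rel G a b s" and x: "x \<in> tet_elements G a b s"
  shows "\<exists>y\<in>{\<one>, a, s, s \<otimes> s}. conj_in G x y"
proof -
  have cl: "a \<in> carrier G" "b \<in> carrier G" "s \<in> carrier G" using tet_rel_closed[OF T] by auto
  note rules = m_assoc tet_rel_simps[OF T] tet_rel_simps'[OF T]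
  have "conj_in G b a" by (rule conj_inI[of "s"]) (use cl in \<open>simp_all add: rules\<close>)
  moreover have "conj_in G (a \<otimes> b) a" by (rule conj_inI[of "s \<otimes> s"]) (use cl in \<open>simp_all add: rules\<close>)
  moreover have "conj_in G (a \<otimes> s) s" by (rule conj_inI[of "b"]) (use cl in \<open>simp_all add: rules\<close>)
  moreover have "conj_in G (b \<otimes> s) s" by (rule conj_inI[of "a \<otimes> b"]) (use cl in \<open>simp_all add: rules\<close>)
  moreover have "conj_in G (a \<otimes> (b \<otimes> s)) s" by (rule conj_inI[of "a"]) (use cl in \<open>simp_all add: rules\<close>)
  moreover have "conj_in G (a \<otimes> (s \<otimes> s)) (s \<otimes> s)" by (rule conj_inI[of "a \<otimes> b"]) (use cl in \<open>simp_all add: rules\<close>)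
  moreover have "conj_in G (b \<otimes> (s \<otimes> s)) (s \<otimes> s)" by (rule conj_inI[of "a"]) (use cl in \<open>simp_all add: rules\<close>)
  moreover have "conj_in G (a \<otimes> (b \<otimes> (s \<otimes> s))) (s \<otimes> s)" by (rule conj_inI[of "b"]) (use cl in \<open>simp_all add: rules\<close>)
  moreover have "conj_in G \<one> \<one>" "conj_in G a a" "conj_in G s s" "conj_in G (s \<otimes> s) (s \<otimes> s)"
    using cl by (auto intro: conj_in_refl)
  ultimately show ?thesis using x unfolding tet_elements_def by auto
qed

text \<open>Two double cosets of the tetrahedral subgroup. In the octahedral case \<open>t\<close>
  normalises this subgroup and the second one is a single coset.\<close>

definition double_elements :: "'a \<Rightarrow> 'a \<Rightarrow> 'a \<Rightarrow> 'a \<Rightarrow> 'a set" where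
  "double_elements a b s t = tet_elements G a b s \<union>
     {x \<otimes> (t \<otimes> y) | x y. x \<in> tet_elements G a b s \<and> y \<in> tet_elements G a b s}"

text \<open>Left multiplication by generators suffices, since induction over words then yields the
  whole group. The only substantial case is \<open>t x t\<close> with \<open>x\<close> in the
  tetrahedral subgroup.\<close>

lemma double_elements_closed:
  assumes R: "oct_rel G a b s t \<or> ico_rel G a b s t"
  shows "\<one> \<in> double_elements a b s t"
    and "x \<in> double_elements a b s t \<Longrightarrow> a \<otimes> x \<in> double_elements a b s t"
    and "x \<in> double_elements a b s t \<Longrightarrow> s \<otimes> x \<in> double_elements a b s t"
    and "x \<in> double_elements a b s t \<Longrightarrow> t \<otimes> x \<in> double_elements a b s t"
proof -
  let ?N = "tet_elements G a b s"
  have T: "tet_rel G a b s" and t: "t \<in> carrier G"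
    using R by (auto simp: oct_rel_def ico_rel_def)
  have cl: "a \<in> carrier G" "b \<in> carrier G" "s \<in> carrier G" "t \<in> carrier G"
    using tet_rel_closed[OF T] t by auto
  note N = tet_elements_closed[OF T]
  have Nc: "x \<in> carrier G" if "x \<in> ?N" for x using N(1) that by auto
  show "\<one> \<in> double_elements a b s t" using N(2) by (simp add: double_elements_def)
  have left: "g \<otimes> x \<in> double_elements a b s t"
    if g: "g \<in> carrier G" "\<And>x. x \<in> ?N \<Longrightarrow> g \<otimes> x \<in> ?N" and x: "x \<in> double_elements a b s t" for g x
  proof -
    from x consider "x \<in> ?N" | u y where "x = u \<otimes> (t \<otimes> y)" "u \<in> ?N" "y \<in> ?N"
      by (auto simp: double_elements_def)
    then show ?thesis
    proof cases
      case 1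
      then show ?thesis using g(2) by (simp add: double_elements_def)
    next
      case 2
      then have "g \<otimes> x = (g \<otimes> u) \<otimes> (t \<otimes> y)" using g(1) Nc t by (simp add: m_assoc)
      with 2 g(2)[OF 2(2)] show ?thesis unfolding double_elements_def by blast
    qed
  qed
  show "a \<otimes> x \<in> double_elements a b s t" if "x \<in> double_elements a b s t"
    by (rule left[OF cl(1) N(3) that])
  show "s \<otimes> x \<in> double_elements a b s t" if "x \<in> double_elements a b s t"
    by (rule left[OF cl(3) N(4) that])
  have tnt: "t \<otimes> (x \<otimes> t) \<in> double_elements a b s t" if "x \<in> ?N" for x
  proof -
    have mem: "y \<in> double_elements a b s t" if "y \<in> ?N" for y using that by (simp add: double_elements_def)
    have mem': "z \<in> double_elements a b s t" if "z = u \<otimes> (t \<otimes> y)" "u \<in> ?N" "y \<in> ?N" for u y z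
      using that by (auto simp: double_elements_def)
    from R show ?thesis
    proof
      assume O: "oct_rel G a b s t"
      have "t \<otimes> (x \<otimes> t) \<in> ?N"
        using \<open>x \<in> ?N\<close> cl unfolding tet_elements_def
        by (elim insertE emptyE) (simp_all add: m_assoc tet_rel_simps[OF T] tet_rel_simps'[OF T]
          oct_rel_simps[OF O] oct_rel_simps'[OF O])
      then show ?thesis by (rule mem)
    next
      assume I: "ico_rel G a b s t"
      note rules = m_assoc tet_rel_simps[OF T] tet_rel_simps'[OF T] ico_rel_simps[OF I] ico_rel_simps'[OF I]
      have gen: "\<one> \<in> ?N" "a \<in> ?N" "b \<in> ?N" "s \<in> ?N" by (auto simp: tet_elements_def)
      have N1: "w \<in> ?N" if "w \<in> {\<one>, s, s \<otimes> s}" for w using that by (auto simp: tet_elements_def)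
      have "\<exists>v\<in>{\<one>, a, b, a \<otimes> b}. \<exists>w\<in>{\<one>, s, s \<otimes> s}. x = v \<otimes> w"
        using \<open>x \<in> ?N\<close> cl unfolding tet_elements_def by (elim insertE emptyE) (simp_all add: m_assoc)
      then obtain v w where x: "x = v \<otimes> w" and v: "v \<in> {\<one>, a, b, a \<otimes> b}" and w: "w \<in> {\<one>, s, s \<otimes> s}"
        by blast
      have vc: "v \<in> carrier G" and wc: "w \<in> carrier G" using v w cl by auto
      \<comment> \<open>Powers of \<open>s\<close> pass \<open>t\<close> at the price of inversion.
        This leaves \<open>t v t\<close> for \<open>v\<close> in the Klein four-group, which the
        relations give explicitly.\<close>
      have wt: "w \<otimes> t = t \<otimes> (w \<otimes> w)" using w cl by (auto simp: rules)
      have "t \<otimes> (x \<otimes> t) = (t \<otimes> v \<otimes> t) \<otimes> (w \<otimes> w)"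
        using vc wc cl by (simp add: x m_assoc wt)
      moreover have "w \<otimes> w \<in> ?N" using N(5) N1[OF w] by blast
      moreover have "t \<otimes> v \<otimes> t = \<one> \<or> (\<exists>u\<in>?N. \<exists>y\<in>?N. t \<otimes> v \<otimes> t = u \<otimes> (t \<otimes> y))"
      proof -
        have "t \<otimes> \<one> \<otimes> t = \<one>" "t \<otimes> a \<otimes> t = a \<otimes> (t \<otimes> a)"
          "t \<otimes> b \<otimes> t = (a \<otimes> b) \<otimes> (t \<otimes> (b \<otimes> (s \<otimes> s)))" "t \<otimes> (a \<otimes> b) \<otimes> t = b \<otimes> (t \<otimes> (a \<otimes> (b \<otimes> s)))"
          using cl by (simp_all add: rules)
        moreover have "a \<otimes> b \<in> ?N" "b \<otimes> (s \<otimes> s) \<in> ?N" "a \<otimes> (b \<otimes> s) \<in> ?N"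
          by (auto simp: tet_elements_def)
        ultimately show ?thesis using v gen by blast
      qed
      ultimately show ?thesis
        using N(5) Nc cl by (auto intro: mem mem' simp: m_assoc)
    qed
  qed
  show "t \<otimes> x \<in> double_elements a b s t" if "x \<in> double_elements a b s t"
  proof -
    from that consider "x \<in> ?N" | u y where "x = u \<otimes> (t \<otimes> y)" "u \<in> ?N" "y \<in> ?N"
      by (auto simp: double_elements_def)
    then show ?thesis
    proof cases
      case 1
      then have "t \<otimes> x = \<one> \<otimes> (t \<otimes> x)" using Nc cl by simp
      with 1 N(2) show ?thesis unfolding double_elements_def by blast
    next
      case 2
      note uy = 2
      then have "t \<otimes> x = (t \<otimes> (u \<otimes> t)) \<otimes> y" using Nc cl by (simp add: m_assoc)
      moreover from tnt[OF uy(2)] consider "t \<otimes> (u \<otimes> t) \<in> ?N" |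
        u' y' where "t \<otimes> (u \<otimes> t) = u' \<otimes> (t \<otimes> y')" "u' \<in> ?N" "y' \<in> ?N"
        by (auto simp: double_elements_def)
      then have "(t \<otimes> (u \<otimes> t)) \<otimes> y \<in> double_elements a b s t"
      proof cases
        case 1
        then show ?thesis using N(5) uy by (simp add: double_elements_def)
      next
        case 2
        then have "(t \<otimes> (u \<otimes> t)) \<otimes> y = u' \<otimes> (t \<otimes> (y' \<otimes> y))" using Nc cl uy by (simp add: m_assoc)
        with 2 N(5)[OF 2(3) uy(3)] show ?thesis unfolding double_elements_def by blast
      qed
      ultimately show ?thesis by simp
    qed
  qed
qed

text \<open>\<open>u t y\<close> is conjugate to \<open>t (y u)\<close>. Writing \<open>y u\<close>
  as \<open>v\<close> times a power of \<open>s\<close>, conjugation by a power of \<open>s\<close>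
  removes that power, because \<open>t\<close> inverts \<open>s\<close>.\<close>

lemma double_elements_conj:
  assumes R: "oct_rel G a b s t \<or> ico_rel G a b s t" and x: "x \<in> double_elements a b s t"
  shows "\<exists>y\<in>{\<one>, a, s, t, t \<otimes> a, t \<otimes> b, t \<otimes> (a \<otimes> b)}. conj_in G x y"
proof -
  let ?N = "tet_elements G a b s"
  have T: "tet_rel G a b s" and t: "t \<in> carrier G" "t \<otimes> t = \<one>" "t \<otimes> s \<otimes> t = s \<otimes> s"
    using R by (auto simp: oct_rel_def ico_rel_def)
  have cl: "a \<in> carrier G" "b \<in> carrier G" "s \<in> carrier G" "t \<in> carrier G"
    using tet_rel_closed[OF T] t by auto
  note N = tet_elements_closed[OF T] and rules = m_assoc tet_rel_simps[OF T] tet_rel_simps'[OF T]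
  have ss: "conj_in G (s \<otimes> s) s"
  proof (rule conj_inI[of t])
    have "s \<otimes> s \<otimes> t = t \<otimes> s \<otimes> (t \<otimes> t)" unfolding t(3)[symmetric] using cl by (simp add: m_assoc)
    then show "s \<otimes> s \<otimes> t = t \<otimes> s" using cl t by simp
  qed (use cl in auto)
  from x consider "x \<in> ?N" | u y where "x = u \<otimes> (t \<otimes> y)" "u \<in> ?N" "y \<in> ?N"
    by (auto simp: double_elements_def)
  then show ?thesis
  proof cases
    case 1
    then show ?thesis using tet_elements_conj[OF T 1] conj_in_trans[OF _ ss] cl by blast
  next
    case 2
    define z where "z = y \<otimes> u"
    have z: "z \<in> ?N" unfolding z_def using N(5) 2 by blast
    have "conj_in G x (t \<otimes> z)"
    proof -
      have "u \<in> carrier G" "y \<in> carrier G" using 2 N(1) by auto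
      then show ?thesis using cl 2(1) by (intro conj_inI[of u]) (simp_all add: z_def m_assoc)
    qed
    moreover have "\<exists>y\<in>{t, t \<otimes> a, t \<otimes> b, t \<otimes> (a \<otimes> b)}. conj_in G (t \<otimes> z) y"
    proof -
      have st: "s \<otimes> t = t \<otimes> (s \<otimes> s)"
      proof -
        have "t \<otimes> (s \<otimes> s) = t \<otimes> (t \<otimes> s \<otimes> t)" by (simp add: t(3))
        also have "\<dots> = (t \<otimes> t) \<otimes> (s \<otimes> t)" using cl by (simp add: m_assoc)
        finally show ?thesis using t cl by simp
      qed
      have st': "s \<otimes> (t \<otimes> z) = t \<otimes> (s \<otimes> (s \<otimes> z))" if "z \<in> carrier G" for z
        using arg_cong[OF st, of "\<lambda>x. x \<otimes> z"] that cl by (simp add: m_assoc)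
      have c1: "conj_in G (t \<otimes> (v \<otimes> s)) (t \<otimes> (s \<otimes> v \<otimes> (s \<otimes> s)))" if "v \<in> carrier G" for v
        by (rule conj_inI[of s]) (use that cl in \<open>simp_all add: rules st st'\<close>)
      have c2: "conj_in G (t \<otimes> (v \<otimes> (s \<otimes> s))) (t \<otimes> (s \<otimes> s \<otimes> v \<otimes> s))" if "v \<in> carrier G" for v
        by (rule conj_inI[of "s \<otimes> s"]) (use that cl in \<open>simp_all add: rules st st'\<close>)
      have "conj_in G (t \<otimes> s) t" "conj_in G (t \<otimes> (s \<otimes> s)) t"
        using c1[of \<one>] c2[of \<one>] cl by (simp_all add: rules)
      moreover have "conj_in G (t \<otimes> (a \<otimes> s)) (t \<otimes> b)" "conj_in G (t \<otimes> (b \<otimes> s)) (t \<otimes> (a \<otimes> b))"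
        "conj_in G (t \<otimes> (a \<otimes> (b \<otimes> s))) (t \<otimes> a)"
        using c1[of a] c1[of b] c1[of "a \<otimes> b"] cl by (simp_all add: rules)
      moreover have "conj_in G (t \<otimes> (a \<otimes> (s \<otimes> s))) (t \<otimes> (a \<otimes> b))" "conj_in G (t \<otimes> (b \<otimes> (s \<otimes> s))) (t \<otimes> a)"
        "conj_in G (t \<otimes> (a \<otimes> (b \<otimes> (s \<otimes> s)))) (t \<otimes> b)"
        using c2[of a] c2[of b] c2[of "a \<otimes> b"] cl by (simp_all add: rules)
      moreover have "conj_in G t t" "conj_in G (t \<otimes> a) (t \<otimes> a)" "conj_in G (t \<otimes> b) (t \<otimes> b)"
        "conj_in G (t \<otimes> (a \<otimes> b)) (t \<otimes> (a \<otimes> b))"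
        using cl by (auto intro: conj_in_refl)
      ultimately show ?thesis using z cl unfolding tet_elements_def by auto
    qed
    ultimately show ?thesis using conj_in_trans cl by blast
  qed
qed

end

section \<open>Homomorphisms out of the presented groups\<close>

definition word_eval :: "('g, 'b) monoid_scheme \<Rightarrow> ('x \<Rightarrow> 'g) \<Rightarrow> ('x \<times> bool) list \<Rightarrow> 'g" where
  "word_eval H f w = foldr (\<lambda>(x, s) z. (if s then f x else inv\<^bsub>H\<^esub> f x) \<otimes>\<^bsub>H\<^esub> z) w \<one>\<^bsub>H\<^esub>"

lemma carrier_presented_group: "carrier (presented_group R) = range (word_class R)"
  and one_presented_group: "\<one>\<^bsub>presented_group R\<^esub> = word_class R []"
  by (simp_all add: presented_group_def)

lemma ex_presented_hom:
  assumes H: "group H" and f: "\<And>x. f x \<in> carrier H" and R: "\<And>r. r \<in> R \<Longrightarrow> word_eval H f r = \<one>\<^bsub>H\<^esub>"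
  shows "\<exists>\<rho>\<in>hom (presented_group R) H. \<forall>x. \<rho> (word_class R [(x, True)]) = f x"
proof -
  interpret H: group H by (rule H)
  have cl: "word_eval H f w \<in> carrier H" for w
    by (induction w) (auto simp: word_eval_def f)
  have cons: "word_eval H f ((x, s) # w) = (if s then f x else inv\<^bsub>H\<^esub> f x) \<otimes>\<^bsub>H\<^esub> word_eval H f w" for x s w
    by (simp add: word_eval_def)
  have nil: "word_eval H f [] = \<one>\<^bsub>H\<^esub>" by (simp add: word_eval_def)
  have app: "word_eval H f (u @ v) = word_eval H f u \<otimes>\<^bsub>H\<^esub> word_eval H f v" for u v
    by (induction u) (auto simp: cons nil cl f H.m_assoc)
  have cong: "word_eval H f u = word_eval H f v" if "word_cong R u v" for u v
    using that
  proof induction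
    case (cancel u x s v)
    have "word_eval H f [(x, s), (x, \<not> s)] = \<one>\<^bsub>H\<^esub>"
      by (simp add: cons nil f)
    then show ?case using cl by (simp add: app del: append_Cons)
  next
    case (relator r u v)
    then show ?case using cl by (simp add: app R)
  qed auto
  define \<rho> where "\<rho> X = word_eval H f (SOME u. X = word_class R u)" for X
  have \<rho>: "\<rho> (word_class R u) = word_eval H f u" for u
  proof -
    have "word_class R u = word_class R (SOME v. word_class R u = word_class R v)"
      by (rule someI) (rule HOL.refl)
    then show ?thesis unfolding \<rho>_def word_class_eq_iff by (rule cong[symmetric])
  qed
  show ?thesis
    by (rule bexI[of _ \<rho>]) (auto simp: hom_def carrier_presented_group word_class_mult \<rho> cl app cons nil f)
qed

lemma presented_group_induct:
  assumes x: "x \<in> carrier (presented_group R)" and one: "P \<one>\<^bsub>presented_group R\<^esub>"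
    and step: "\<And>l s y. y \<in> carrier (presented_group R) \<Longrightarrow> P y \<Longrightarrow> P (word_class R [(l, s)] \<otimes>\<^bsub>presented_group R\<^esub> y)"
  shows "P x"
proof -
  have "P (word_class R u)" for u
  proof (induction u)
    case Nil
    then show ?case using one by (simp add: one_presented_group)
  next
    case (Cons ls u)
    then show ?case using step[of "word_class R u" "fst ls" "snd ls"]
      by (simp add: carrier_presented_group word_class_mult)
  qed
  with x show ?thesis by (auto simp: carrier_presented_group)
qed

lemma word_class_inverse_letter:
  "word_class R [(x, False)] = inv\<^bsub>presented_group R\<^esub> word_class R [(x, True)]"
proof (rule group.inv_equality[OF group_presented_group, symmetric])
  have "word_cong R ([] @ [(x, False), (x, \<not> False)] @ []) ([] @ [])"
    by (rule word_cong.cancel)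
  then show "word_class R [(x, False)] \<otimes>\<^bsub>presented_group R\<^esub> word_class R [(x, True)] = \<one>\<^bsub>presented_group R\<^esub>"
    by (simp add: word_class_mult one_presented_group word_class_eq_iff)
qed (auto simp: carrier_presented_group)

lemma gen_in_carrier: "gen n x \<in> carrier (polyhedral_group n)"
  by (simp add: gen_def polyhedral_group_def carrier_presented_group)

lemma group_polyhedral: "group (polyhedral_group n)"
  by (simp add: polyhedral_group_def group_presented_group)

lemma poly_rel_gen: "poly_rel (polyhedral_group n) n (gen n Ga) (gen n Gb) (gen n Gc)"
proof -
  let ?R = "polyhedral_relators n"
  interpret group "polyhedral_group n" by (rule group_polyhedral)
  have pow: "gen n x [^]\<^bsub>polyhedral_group n\<^esub> k = word_class ?R (replicate k (x, True))" for x and k :: nat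
    by (induction k) (simp_all add: gen_def polyhedral_group_def one_presented_group word_class_mult replicate_append_same)
  have one: "word_class ?R r = \<one>\<^bsub>polyhedral_group n\<^esub>" if "r \<in> ?R" for r
    using word_cong.relator[OF that, of "[]" "[]"]
    by (simp add: polyhedral_group_def one_presented_group word_class_eq_iff)
  have abc: "gen n Ga \<otimes>\<^bsub>polyhedral_group n\<^esub> gen n Gb \<otimes>\<^bsub>polyhedral_group n\<^esub> gen n Gc
      = word_class ?R [(Ga, True), (Gb, True), (Gc, True)]"
    by (simp add: gen_def polyhedral_group_def word_class_mult)
  have "replicate n (Ga, True) \<in> ?R" "replicate 3 (Gb, True) \<in> ?R" "replicate 2 (Gc, True) \<in> ?R"
    "[(Ga, True), (Gb, True), (Gc, True)] \<in> ?R"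
    by (simp_all add: polyhedral_relators_def)
  then show ?thesis
    unfolding poly_rel_def pow abc by (simp only: one gen_in_carrier simp_thms)
qed

lemma ex_polyhedral_hom:
  assumes H: "group H" and P: "poly_rel H n a b c"
  shows "\<exists>\<rho>\<in>hom (polyhedral_group n) H. \<rho> (gen n Ga) = a \<and> \<rho> (gen n Gb) = b \<and> \<rho> (gen n Gc) = c"
proof -
  interpret H: group H by (rule H)
  define f where "f x = (case x of Ga \<Rightarrow> a | Gb \<Rightarrow> b | Gc \<Rightarrow> c)" for x
  have cl: "a \<in> carrier H" "b \<in> carrier H" "c \<in> carrier H" using P by (auto simp: poly_rel_def)
  have f: "f x \<in> carrier H" for x using cl by (cases x) (auto simp: f_def)
  have pow: "word_eval H f (replicate k (x, True)) = f x [^]\<^bsub>H\<^esub> k" for x and k :: nat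
  proof (induction k)
    case (Suc k)
    then show ?case using f by (subst H.nat_pow_Suc2) (simp_all add: word_eval_def)
  qed (simp add: word_eval_def)
  have "word_eval H f r = \<one>\<^bsub>H\<^esub>" if "r \<in> polyhedral_relators n" for r
    using that P cl unfolding polyhedral_relators_def
    by (elim insertE emptyE; simp add: pow)
      (auto simp: f_def poly_rel_def word_eval_def H.m_assoc)
  from ex_presented_hom[OF H f this] obtain \<rho> where
    "\<rho> \<in> hom (polyhedral_group n) H" "\<And>x. \<rho> (gen n x) = f x"
    by (auto simp: polyhedral_group_def gen_def)
  then show ?thesis by (intro bexI[of _ \<rho>]) (simp_all add: f_def)
qed

text \<open>\<open>b\<close> and \<open>c\<close> suffice as letters: \<open>a\<close> is
  \<open>c b b\<close>, and the inverses of \<open>b\<close> and \<open>c\<close> are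
  \<open>b b\<close> and \<open>c\<close>.\<close>

lemma polyhedral_induct:
  assumes x: "x \<in> carrier (polyhedral_group n)" and one: "P \<one>\<^bsub>polyhedral_group n\<^esub>"
    and b: "\<And>y. y \<in> carrier (polyhedral_group n) \<Longrightarrow> P y \<Longrightarrow> P (gen n Gb \<otimes>\<^bsub>polyhedral_group n\<^esub> y)"
    and c: "\<And>y. y \<in> carrier (polyhedral_group n) \<Longrightarrow> P y \<Longrightarrow> P (gen n Gc \<otimes>\<^bsub>polyhedral_group n\<^esub> y)"
  shows "P x"
proof -
  let ?G = "polyhedral_group n"
  interpret group ?G by (rule group_polyhedral)
  have cl: "gen n x \<in> carrier ?G" for x by (rule gen_in_carrier)
  have rel: "gen n Ga = gen n Gc \<otimes>\<^bsub>?G\<^esub> (gen n Gb \<otimes>\<^bsub>?G\<^esub> gen n Gb)"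
    by (rule poly_rel_lact(1)[OF poly_rel_gen])
  have b3: "gen n Gb \<otimes>\<^bsub>?G\<^esub> gen n Gb \<otimes>\<^bsub>?G\<^esub> gen n Gb = \<one>\<^bsub>?G\<^esub>" and c2: "gen n Gc \<otimes>\<^bsub>?G\<^esub> gen n Gc = \<one>\<^bsub>?G\<^esub>"
    using poly_rel_gen[of n] by (auto simp: poly_rel_def eval_nat_numeral)
  have inv: "inv\<^bsub>?G\<^esub> gen n Gb = gen n Gb \<otimes>\<^bsub>?G\<^esub> gen n Gb" "inv\<^bsub>?G\<^esub> gen n Gc = gen n Gc"
    "inv\<^bsub>?G\<^esub> gen n Ga = gen n Gb \<otimes>\<^bsub>?G\<^esub> gen n Gc"
  proof -
    show "inv\<^bsub>?G\<^esub> gen n Gb = gen n Gb \<otimes>\<^bsub>?G\<^esub> gen n Gb" by (rule inv_equality) (use b3 cl in auto)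
    show "inv\<^bsub>?G\<^esub> gen n Gc = gen n Gc" by (rule inv_equality) (use c2 cl in auto)
    show "inv\<^bsub>?G\<^esub> gen n Ga = gen n Gb \<otimes>\<^bsub>?G\<^esub> gen n Gc"
    proof (rule inv_equality)
      have "gen n Ga \<otimes>\<^bsub>?G\<^esub> (gen n Gb \<otimes>\<^bsub>?G\<^esub> gen n Gc) = \<one>\<^bsub>?G\<^esub>"
        using poly_rel_gen[of n] cl by (simp add: poly_rel_def m_assoc)
      then show "gen n Gb \<otimes>\<^bsub>?G\<^esub> gen n Gc \<otimes>\<^bsub>?G\<^esub> gen n Ga = \<one>\<^bsub>?G\<^esub>"
        using cl by (intro inv_comm[of "gen n Ga"]) auto
    qed (use cl in auto)
  qed
  have step: "P (word_class (polyhedral_relators n) [(l, s)] \<otimes>\<^bsub>?G\<^esub> y)" if y: "y \<in> carrier ?G" "P y" for l s y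
  proof -
    have "word_class (polyhedral_relators n) [(l, s)] = (if s then gen n l else inv\<^bsub>?G\<^esub> gen n l)"
      by (simp add: gen_def word_class_inverse_letter polyhedral_group_def)
    then show ?thesis
      using y cl by (cases l; cases s) (simp_all add: inv(1,2) inv(3)[unfolded rel] rel b c m_assoc)
  qed
  show ?thesis
    by (rule presented_group_induct[of x "polyhedral_relators n" P])
      (use x one step in \<open>simp_all add: polyhedral_group_def\<close>)
qed

section \<open>Characters and conjugacy of monomorphisms\<close>

text \<open>\<open>sep\<close> demands equal values at conjugate representatives rather than
  inequivalent representatives. This weaker form serves the tetrahedral group, where traces do not
  separate all representatives.\<close>

lemma class_function_eq:
  assumes "group G" and x: "x \<in> carrier G" and i: "i < length reps" and conj: "conj_in G x (reps ! i)"
    and reps: "set reps \<subseteq> carrier G"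
    and sep: "\<And>j. j < length reps \<Longrightarrow> conj_in G (reps ! i) (reps ! j) \<Longrightarrow> vals ! j = vals ! i"
  shows "class_function G reps vals x = vals ! i"
proof -
  interpret group G by fact
  have "(THE v. \<exists>i < length reps. v = vals ! i \<and> conj_in G x (reps ! i)) = vals ! i"
  proof (rule the_equality)
    show "\<exists>k<length reps. vals ! i = vals ! k \<and> conj_in G x (reps ! k)" using i conj by blast
    fix v assume "\<exists>j<length reps. v = vals ! j \<and> conj_in G x (reps ! j)"
    then obtain j where j: "j < length reps" "v = vals ! j" "conj_in G x (reps ! j)" by blast
    have "conj_in G (reps ! i) (reps ! j)"
      using conj_in_trans[OF conj_in_sym[OF conj] j(3)] reps i j(1) by (auto simp: subset_iff)
    with sep j show "v = vals ! i" by simp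
  qed
  with x show ?thesis by (simp add: class_function_def conj_in_def)
qed

lemma hom_conj_in:
  assumes "group G" "group H" "\<rho> \<in> hom G H" "conj_in G x y" "y \<in> carrier G"
  shows "conj_in H (\<rho> x) (\<rho> y)"
proof -
  interpret group_hom G H \<rho> using assms by (simp add: group_hom_def group_hom_axioms_def)
  obtain g where g: "g \<in> carrier G" "x = g \<otimes>\<^bsub>G\<^esub> y \<otimes>\<^bsub>G\<^esub> inv\<^bsub>G\<^esub> g" using assms by (auto simp: conj_in_def)
  then show ?thesis using assms(5) unfolding conj_in_def by (intro bexI[of _ "\<rho> g"]) auto
qed

lemma trace_conj_in_G2:
  assumes "conj_in G2 x y" shows "trace x = trace y"
proof -
  obtain g where g: "g \<in> carrier G2" "x = g ** y ** inv\<^bsub>G2\<^esub> g" using assms by (auto simp: conj_in_def G2_mult)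
  have "trace x = trace (inv\<^bsub>G2\<^esub> g ** (g ** y))" unfolding g(2) by (rule trace_mul_sym)
  then show ?thesis by (simp add: matrix_mul_assoc G2_inverse[OF g(1)])
qed

lemma mon_hom: "\<rho> \<in> mon G H \<Longrightarrow> \<rho> \<in> hom G H"
  by (simp add: mon_def)

lemma mon_conjI:
  assumes \<rho>: "\<rho> \<in> mon \<Gamma> G2" and \<rho>': "\<rho>' \<in> mon \<Gamma> G2" and h: "h \<in> carrier G2"
    and eq: "\<And>x. x \<in> carrier \<Gamma> \<Longrightarrow> h ** \<rho> x = \<rho>' x ** h"
  shows "(\<rho>, \<rho>') \<in> mon_conj \<Gamma> G2"
proof -
  have "\<rho>' x = h ** \<rho> x ** inv\<^bsub>G2\<^esub> h" if "x \<in> carrier \<Gamma>" for x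
    unfolding eq[OF that] using G2_inverse[OF h] by (simp flip: matrix_mul_assoc)
  with assms show ?thesis by (auto simp: mon_conj_def G2_mult)
qed

lemma mon_conjD:
  assumes "(\<rho>, \<rho>') \<in> mon_conj \<Gamma> G2"
  shows "\<rho> \<in> mon \<Gamma> G2" "\<rho>' \<in> mon \<Gamma> G2" "\<exists>h\<in>carrier G2. \<forall>x\<in>carrier \<Gamma>. h ** \<rho> x = \<rho>' x ** h"
proof -
  show "\<rho> \<in> mon \<Gamma> G2" "\<rho>' \<in> mon \<Gamma> G2" using assms by (auto simp: mon_conj_def)
  obtain h where h: "h \<in> carrier G2" "\<And>x. x \<in> carrier \<Gamma> \<Longrightarrow> \<rho>' x = h ** \<rho> x ** inv\<^bsub>G2\<^esub> h"
    using assms by (auto simp: mon_conj_def G2_mult)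
  have "\<rho>' x ** h = h ** \<rho> x" if "x \<in> carrier \<Gamma>" for x
    unfolding h(2)[OF that] using G2_inverse[OF h(1)] by (simp flip: matrix_mul_assoc)
  with h(1) show "\<exists>h\<in>carrier G2. \<forall>x\<in>carrier \<Gamma>. h ** \<rho> x = \<rho>' x ** h" by force
qed

lemma equiv_mon_conj: "equiv (mon \<Gamma> G2) (mon_conj \<Gamma> G2)"
proof (rule equivI)
  show "mon_conj \<Gamma> G2 \<subseteq> mon \<Gamma> G2 \<times> mon \<Gamma> G2" by (auto simp: mon_conj_def)
  show "refl_on (mon \<Gamma> G2) (mon_conj \<Gamma> G2)"
  proof (rule refl_onI)
    fix \<rho> assume \<rho>: "\<rho> \<in> mon \<Gamma> G2"
    show "(\<rho>, \<rho>) \<in> mon_conj \<Gamma> G2"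
      by (rule mon_conjI[OF \<rho> \<rho>, of "mat 1"]) (simp_all add: carrier_G2 zaut_one)
  qed
  show "Relation.sym (mon_conj \<Gamma> G2)"
  proof (rule symI)
    fix \<rho> \<rho>' assume *: "(\<rho>, \<rho>') \<in> mon_conj \<Gamma> G2"
    then obtain h where h: "h \<in> carrier G2" "\<And>x. x \<in> carrier \<Gamma> \<Longrightarrow> h ** \<rho> x = \<rho>' x ** h"
      using mon_conjD(3) by blast
    have "inv\<^bsub>G2\<^esub> h ** \<rho>' x = \<rho> x ** inv\<^bsub>G2\<^esub> h" if "x \<in> carrier \<Gamma>" for x
    proof -
      have "inv\<^bsub>G2\<^esub> h ** \<rho>' x = inv\<^bsub>G2\<^esub> h ** (\<rho>' x ** h) ** inv\<^bsub>G2\<^esub> h"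
        using G2_inverse[OF h(1)] by (simp flip: matrix_mul_assoc)
      also have "\<dots> = (inv\<^bsub>G2\<^esub> h ** h) ** \<rho> x ** inv\<^bsub>G2\<^esub> h"
        by (simp only: h(2)[OF that, symmetric] matrix_mul_assoc)
      finally show ?thesis using G2_inverse[OF h(1)] by simp
    qed
    with mon_conjI mon_conjD(1,2)[OF *] G2_inverse(1)[OF h(1)] show "(\<rho>', \<rho>) \<in> mon_conj \<Gamma> G2" by blast
  qed
  show "Relation.trans (mon_conj \<Gamma> G2)"
  proof (rule transI)
    fix \<rho> \<rho>' \<rho>'' assume 1: "(\<rho>, \<rho>') \<in> mon_conj \<Gamma> G2" and 2: "(\<rho>', \<rho>'') \<in> mon_conj \<Gamma> G2"
    obtain h where h: "h \<in> carrier G2" "\<And>x. x \<in> carrier \<Gamma> \<Longrightarrow> h ** \<rho> x = \<rho>' x ** h"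
      using mon_conjD(3)[OF 1] by blast
    obtain k where k: "k \<in> carrier G2" "\<And>x. x \<in> carrier \<Gamma> \<Longrightarrow> k ** \<rho>' x = \<rho>'' x ** k"
      using mon_conjD(3)[OF 2] by blast
    have "(k ** h) ** \<rho> x = \<rho>'' x ** (k ** h)" if "x \<in> carrier \<Gamma>" for x
      using h(2)[OF that] k(2)[OF that] by (metis matrix_mul_assoc)
    with mon_conjI[OF mon_conjD(1)[OF 1] mon_conjD(2)[OF 2] G2_closed[OF k(1) h(1)]]
    show "(\<rho>, \<rho>'') \<in> mon_conj \<Gamma> G2" by blast
  qed
qed

lemma rep_character_mon_conj:
  assumes "(\<rho>, \<rho>') \<in> mon_conj \<Gamma> G2"
  shows "rep_character \<Gamma> \<rho> = rep_character \<Gamma> \<rho>'"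
proof -
  have "trace (\<rho>' x) = trace (\<rho> x)" if "x \<in> carrier \<Gamma>" for x
  proof (rule trace_conj_in_G2)
    show "conj_in G2 (\<rho>' x) (\<rho> x)" using assms that by (auto simp: mon_conj_def conj_in_def)
  qed
  then show ?thesis by (auto simp: rep_character_def)
qed

text \<open>Conjugate monomorphisms have equal characters, so a set that meets every class and is
  separated by characters contains exactly one member of each.\<close>

lemma classification_by_characters:
  assumes sub: "C \<subseteq> mon \<Gamma> G2" and inj: "inj_on (rep_character \<Gamma>) C" and X: "rep_character \<Gamma> ` C = X"
    and all: "\<And>\<rho>. \<rho> \<in> mon \<Gamma> G2 \<Longrightarrow> \<exists>\<rho>'\<in>C. (\<rho>, \<rho>') \<in> mon_conj \<Gamma> G2"
  shows "equiv (mon \<Gamma> G2) (mon_conj \<Gamma> G2) \<and> rep_character \<Gamma> respects mon_conj \<Gamma> G2 \<and>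
    bij_betw (\<lambda>C. the_elem (rep_character \<Gamma> ` C)) (mon \<Gamma> G2 // mon_conj \<Gamma> G2) X"
proof (intro conjI)
  let ?r = "mon_conj \<Gamma> G2" and ?f = "\<lambda>C. the_elem (rep_character \<Gamma> ` C)"
  show eq: "equiv (mon \<Gamma> G2) ?r" by (rule equiv_mon_conj)
  show resp: "rep_character \<Gamma> respects ?r"
    by (rule congruentI) (rule rep_character_mon_conj)
  have f: "?f (?r `` {\<rho>}) = rep_character \<Gamma> \<rho>" if "\<rho> \<in> mon \<Gamma> G2" for \<rho>
  proof -
    have "rep_character \<Gamma> \<rho>' = rep_character \<Gamma> \<rho>" if "\<rho>' \<in> ?r `` {\<rho>}" for \<rho>'
      using that rep_character_mon_conj by fastforce
    then have "rep_character \<Gamma> ` (?r `` {\<rho>}) = {rep_character \<Gamma> \<rho>}"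
      using equiv_class_self[OF eq that] by blast
    then show ?thesis by simp
  qed
  show "bij_betw ?f (mon \<Gamma> G2 // ?r) X"
    unfolding bij_betw_def
  proof
    show "inj_on ?f (mon \<Gamma> G2 // ?r)"
    proof (rule inj_onI)
      fix A B assume A: "A \<in> mon \<Gamma> G2 // ?r" and B: "B \<in> mon \<Gamma> G2 // ?r" and AB: "?f A = ?f B"
      obtain \<rho> where \<rho>: "\<rho> \<in> mon \<Gamma> G2" "A = ?r `` {\<rho>}" using A by (rule quotientE)
      obtain \<sigma> where \<sigma>: "\<sigma> \<in> mon \<Gamma> G2" "B = ?r `` {\<sigma>}" using B by (rule quotientE)
      obtain \<rho>' where \<rho>': "\<rho>' \<in> C" "(\<rho>, \<rho>') \<in> ?r" using all[OF \<rho>(1)] by blast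
      obtain \<sigma>' where \<sigma>': "\<sigma>' \<in> C" "(\<sigma>, \<sigma>') \<in> ?r" using all[OF \<sigma>(1)] by blast
      have "rep_character \<Gamma> \<rho>' = rep_character \<Gamma> \<sigma>'"
        using AB f \<rho> \<sigma> rep_character_mon_conj[OF \<rho>'(2)] rep_character_mon_conj[OF \<sigma>'(2)] by simp
      then have "\<rho>' = \<sigma>'" using inj \<rho>'(1) \<sigma>'(1) by (auto dest: inj_onD)
      then show "A = B"
        using equiv_class_eq[OF eq \<rho>'(2)] equiv_class_eq[OF eq \<sigma>'(2)] \<rho> \<sigma> by simp
    qed
    show "?f ` (mon \<Gamma> G2 // ?r) = X"
    proof
      show "?f ` (mon \<Gamma> G2 // ?r) \<subseteq> X"
      proof (rule image_subsetI)
        fix A assume "A \<in> mon \<Gamma> G2 // ?r"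
        then obtain \<rho> where \<rho>: "\<rho> \<in> mon \<Gamma> G2" "A = ?r `` {\<rho>}" by (rule quotientE)
        obtain \<rho>' where "\<rho>' \<in> C" "(\<rho>, \<rho>') \<in> ?r" using all[OF \<rho>(1)] by blast
        then show "?f A \<in> X" using f[OF \<rho>(1)] \<rho>(2) X rep_character_mon_conj by fastforce
      qed
      show "X \<subseteq> ?f ` (mon \<Gamma> G2 // ?r)"
      proof
        fix c assume "c \<in> X"
        then obtain \<rho> where \<rho>: "\<rho> \<in> C" "c = rep_character \<Gamma> \<rho>" using X by blast
        then have "\<rho> \<in> mon \<Gamma> G2" using sub by blast
        from f[OF this] quotientI[OF this, of ?r] \<rho>(2) show "c \<in> ?f ` (mon \<Gamma> G2 // ?r)" by force
      qed
    qed
  qed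
qed

section \<open>Transfer of the relations to the standard position\<close>

lemma tet_rel_hom:
  assumes "group G" "group H" "\<rho> \<in> hom G H" "tet_rel G a b s"
  shows "tet_rel H (\<rho> a) (\<rho> b) (\<rho> s)"
proof -
  interpret group_hom G H \<rho> using assms by (simp add: group_hom_def group_hom_axioms_def)
  have cl: "a \<in> carrier G" "b \<in> carrier G" "s \<in> carrier G" using G.tet_rel_closed[OF assms(4)] by auto
  have e: "a \<otimes>\<^bsub>G\<^esub> a = \<one>\<^bsub>G\<^esub>" "s \<otimes>\<^bsub>G\<^esub> s \<otimes>\<^bsub>G\<^esub> s = \<one>\<^bsub>G\<^esub>" "b = s \<otimes>\<^bsub>G\<^esub> a \<otimes>\<^bsub>G\<^esub> s \<otimes>\<^bsub>G\<^esub> s"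
    "a \<otimes>\<^bsub>G\<^esub> b = s \<otimes>\<^bsub>G\<^esub> s \<otimes>\<^bsub>G\<^esub> a \<otimes>\<^bsub>G\<^esub> s"
    using assms(4) unfolding tet_rel_def by blast+
  show ?thesis
    using e[THEN arg_cong[where f = \<rho>]] cl by (simp add: tet_rel_def)
qed

lemma oct_rel_hom:
  assumes "group G" "group H" "\<rho> \<in> hom G H" "oct_rel G a b s t"
  shows "oct_rel H (\<rho> a) (\<rho> b) (\<rho> s) (\<rho> t)"
proof -
  interpret group_hom G H \<rho> using assms by (simp add: group_hom_def group_hom_axioms_def)
  have T: "tet_rel G a b s" and cl: "a \<in> carrier G" "s \<in> carrier G" "t \<in> carrier G"
    and e: "t \<otimes>\<^bsub>G\<^esub> t = \<one>\<^bsub>G\<^esub>" "t \<otimes>\<^bsub>G\<^esub> s \<otimes>\<^bsub>G\<^esub> t = s \<otimes>\<^bsub>G\<^esub> s" "t \<otimes>\<^bsub>G\<^esub> a = a \<otimes>\<^bsub>G\<^esub> t"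
    using assms(4) by (auto simp: oct_rel_def tet_rel_def)
  show ?thesis
    using tet_rel_hom[OF assms(1-3) T] e[THEN arg_cong[where f = \<rho>]] cl by (simp add: oct_rel_def)
qed

lemma ico_rel_hom:
  assumes "group G" "group H" "\<rho> \<in> hom G H" "ico_rel G a b s t"
  shows "ico_rel H (\<rho> a) (\<rho> b) (\<rho> s) (\<rho> t)"
proof -
  interpret group_hom G H \<rho> using assms by (simp add: group_hom_def group_hom_axioms_def)
  have T: "tet_rel G a b s" and cl: "a \<in> carrier G" "s \<in> carrier G" "t \<in> carrier G"
    and e: "t \<otimes>\<^bsub>G\<^esub> t = \<one>\<^bsub>G\<^esub>" "t \<otimes>\<^bsub>G\<^esub> s \<otimes>\<^bsub>G\<^esub> t = s \<otimes>\<^bsub>G\<^esub> s" "t \<otimes>\<^bsub>G\<^esub> a \<otimes>\<^bsub>G\<^esub> t = a \<otimes>\<^bsub>G\<^esub> t \<otimes>\<^bsub>G\<^esub> a"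
    using assms(4) by (auto simp: ico_rel_def tet_rel_def)
  show ?thesis
    using tet_rel_hom[OF assms(1-3) T] e[THEN arg_cong[where f = \<rho>]] cl by (simp add: ico_rel_def)
qed

lemma std_tet_rel: "tet_rel G2 std_a std_b std_s"
proof -
  have "std_a ** std_a = mat 1" "std_s ** std_s ** std_s = mat 1" "std_b = std_s ** std_a ** std_s ** std_s"
    "std_a ** std_b = std_s ** std_s ** std_a ** std_s"
    by (rule matrix_eq_zornI, simp add: std_zorn flip: matrix_vector_mul_assoc)+
  then show ?thesis using std_in_zaut by (simp add: tet_rel_def G2_mult G2_one carrier_G2)
qed

lemma std_oct_rel: "t \<in> {oct_A, oct_B} \<Longrightarrow> oct_rel G2 std_a std_b std_s t"
proof -
  assume t: "t \<in> {oct_A, oct_B}"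
  have "t ** t = mat 1" "t ** std_s ** t = std_s ** std_s" "t ** std_a = std_a ** t"
    using t by (auto intro!: matrix_eq_zornI simp: oct_A_def oct_B_def circ_zorn std_zorn zorn_eq_iff simp flip: matrix_vector_mul_assoc)
  then show ?thesis using t oct_in_zaut std_tet_rel by (auto simp: oct_rel_def G2_mult G2_one carrier_G2)
qed

lemma std_ico_rel:
  assumes r: "r^2 = 5" and t: "t \<in> {ico_A r, ico_B r}"
  shows "ico_rel G2 std_a std_b std_s t"
proof -
  have rr: "r * r = 5" "\<And>z. r * (r * z) = 5 * z" using r by (simp_all add: power2_eq_square flip: mult.assoc)
  have "ico_A r ** ico_A r = mat 1" "ico_A r ** std_s ** ico_A r = std_s ** std_s"
    "ico_A r ** std_a ** ico_A r = std_a ** ico_A r ** std_a"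
    unfolding ico_A_def
    by (rule matrix_eq_zornI, simp add: circ_zorn std_zorn flip: matrix_vector_mul_assoc,
        simp add: zorn_eq_iff field_simps rr)+
  moreover have "ico_B r ** ico_B r = mat 1" "ico_B r ** std_s ** ico_B r = std_s ** std_s"
    "ico_B r ** std_a ** ico_B r = std_a ** ico_B r ** std_a"
    unfolding ico_B_def
    by (rule matrix_eq_zornI, simp add: circ_zorn std_zorn flip: matrix_vector_mul_assoc,
        simp add: zorn_eq_iff field_simps rr)+
  ultimately show ?thesis using t ico_A_in_zaut[OF r] ico_B_in_zaut[OF r] std_tet_rel
    by (auto simp: ico_rel_def G2_mult G2_one carrier_G2)
qed

lemma tetra_of_tet_rel:
  assumes "tet_rel G2 a b s" "a \<noteq> mat 1"
  shows "tetra a b s"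
  using assms group.tet_rel_simps'[OF group_G2 assms(1)] group.tet_rel_closed[OF group_G2 assms(1)]
  by (simp add: tetra_def G2_mult G2_one carrier_G2 matrix_mul_assoc)

text \<open>\<open>S\<close> is the set of normal forms for the additional involution. The premise
  \<open>P\<close> hands the classification lemmas all that survives conjugation; the relations
  between \<open>t\<close> and \<open>a\<close> are implications, so that one lemma serves the
  octahedral and the icosahedral case.\<close>

lemma extension_standard:
  assumes T: "tet_rel G2 a b s" "a \<noteq> mat 1" and t: "t \<in> carrier G2" "t ** t = mat 1" "t ** s ** t = s ** s"
    and P: "\<And>t'. t' \<in> zaut \<Longrightarrow> t' ** t' = mat 1 \<Longrightarrow> std_s ** t' ** std_s = t' \<Longrightarrow>
       (t ** a = a ** t \<Longrightarrow> t' ** std_a = std_a ** t') \<Longrightarrow>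
       (t ** a ** t = a ** t ** a \<Longrightarrow> t' ** std_a ** t' = std_a ** t' ** std_a) \<Longrightarrow>
       trace t' = trace t \<Longrightarrow> trace (t' ** std_a) = trace (t ** a) \<Longrightarrow> trace std_a = trace a \<Longrightarrow>
       trace std_s = trace s \<Longrightarrow> \<exists>t0\<in>S. std_equiv t' t0"
  shows "\<exists>h\<in>zaut. \<exists>t0\<in>S. h ** a = std_a ** h \<and> h ** s = std_s ** h \<and> h ** t = t0 ** h"
proof -
  obtain h where h: "h \<in> zaut" "h ** a = std_a ** h" "h ** b = std_b ** h" "h ** s = std_s ** h"
    using tetra_standard[OF tetra_of_tet_rel[OF T]] .
  obtain h' where h': "h' \<in> zaut" "h ** h' = mat 1" "h' ** h = mat 1"
    using zaut_two_sided_inverse[OF h(1)] .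
  define c where "c x = h ** x ** h'" for x
  have c_mult: "c x ** c y = c (x ** y)" for x y
    unfolding c_def by (metis h'(3) matrix_mul_assoc matrix_mul_lid)
  have c_one: "c (mat 1) = mat 1" by (simp add: c_def h')
  have ca: "c a = std_a" "c s = std_s"
    unfolding c_def h using h'(2) by (simp_all flip: matrix_mul_assoc)
  have ct: "c x ** h = h ** x" for x
    unfolding c_def using h'(3) by (simp flip: matrix_mul_assoc)
  have tr: "trace (c x) = trace x" for x
  proof -
    have "trace (c x) = trace (h' ** (h ** x))" unfolding c_def by (rule trace_mul_sym)
    then show ?thesis by (simp add: matrix_mul_assoc h'(3))
  qed
  have sts: "s ** t ** s = t"
  proof -
    have sss: "s ** (s ** s) = mat 1"
      using group.tet_rel_simps'(3)[OF group_G2 T(1)] by (simp add: G2_mult G2_one)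
    have "s ** t = t ** t ** s ** t" by (simp add: t(2))
    also have "\<dots> = t ** (s ** s)" by (simp only: t(3) flip: matrix_mul_assoc) (simp only: t(3) matrix_mul_assoc)
    finally have "s ** t ** s = t ** (s ** (s ** s))" by (simp add: matrix_mul_assoc)
    then show ?thesis by (simp add: sss)
  qed
  have "\<exists>t0\<in>S. std_equiv (c t) t0"
  proof (rule P)
    show "c t \<in> zaut" unfolding c_def using h h' t(1) by (simp add: zaut_mult carrier_G2)
    show "c t ** c t = mat 1" by (simp add: c_mult t(2) c_one)
    show "std_s ** c t ** std_s = c t" by (simp add: c_mult sts flip: ca)
    show "c t ** std_a = std_a ** c t" if "t ** a = a ** t" by (simp add: c_mult that flip: ca)
    show "c t ** std_a ** c t = std_a ** c t ** std_a" if "t ** a ** t = a ** t ** a"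
      by (simp add: c_mult that flip: ca)
    show "trace (c t) = trace t" "trace (c t ** std_a) = trace (t ** a)" "trace std_a = trace a"
      "trace std_s = trace s"
      using tr by (simp_all add: c_mult flip: ca)
  qed
  then obtain t0 m where m: "t0 \<in> S" "m \<in> zaut" "m ** std_a = std_a ** m" "m ** std_s = std_s ** m" "m ** c t = t0 ** m"
    by (auto simp: std_equiv_def)
  have "(m ** h) ** a = std_a ** (m ** h)" "(m ** h) ** s = std_s ** (m ** h)" "(m ** h) ** t = t0 ** (m ** h)"
    using m h ct[of t] by (metis matrix_mul_assoc)+
  with m h show ?thesis using zaut_mult by blast
qed

lemma mon_conj_gensI:
  assumes \<rho>: "\<rho> \<in> mon (polyhedral_group n) G2" and \<rho>': "\<rho>' \<in> mon (polyhedral_group n) G2" and h: "h \<in> zaut"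
    and b: "h ** \<rho> (gen n Gb) = \<rho>' (gen n Gb) ** h" and c: "h ** \<rho> (gen n Gc) = \<rho>' (gen n Gc) ** h"
  shows "(\<rho>, \<rho>') \<in> mon_conj (polyhedral_group n) G2"
proof (rule mon_conjI[OF \<rho> \<rho>'])
  let ?G = "polyhedral_group n"
  interpret I: group_hom ?G G2 \<rho>
    using mon_hom[OF \<rho>] group_polyhedral group_G2 by (simp add: group_hom_def group_hom_axioms_def)
  interpret J: group_hom ?G G2 \<rho>'
    using mon_hom[OF \<rho>'] group_polyhedral group_G2 by (simp add: group_hom_def group_hom_axioms_def)
  fix x assume "x \<in> carrier ?G"
  then show "h ** \<rho> x = \<rho>' x ** h"
  proof (rule polyhedral_induct[where P = "\<lambda>x. h ** \<rho> x = \<rho>' x ** h"])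
    show "h ** \<rho> \<one>\<^bsub>?G\<^esub> = \<rho>' \<one>\<^bsub>?G\<^esub> ** h" using I.hom_one J.hom_one by (simp add: G2_one)
  next
    fix y assume y: "y \<in> carrier ?G" "h ** \<rho> y = \<rho>' y ** h"
    show "h ** \<rho> (gen n Gb \<otimes>\<^bsub>?G\<^esub> y) = \<rho>' (gen n Gb \<otimes>\<^bsub>?G\<^esub> y) ** h"
      using y b by (simp add: gen_in_carrier G2_mult) (metis matrix_mul_assoc)
  next
    fix y assume y: "y \<in> carrier ?G" "h ** \<rho> y = \<rho>' y ** h"
    show "h ** \<rho> (gen n Gc \<otimes>\<^bsub>?G\<^esub> y) = \<rho>' (gen n Gc \<otimes>\<^bsub>?G\<^esub> y) ** h"
      using y c by (simp add: gen_in_carrier G2_mult) (metis matrix_mul_assoc)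
  qed
qed (use h in \<open>simp add: carrier_G2\<close>)

lemma trace_one_7: "trace (mat 1 :: complex^7^7) = 7"
  by (simp add: trace_def mat_def)

text \<open>A kernel element has trace 7 and is conjugate to a representative, which must then be
  the identity.\<close>

lemma mon_of_traces:
  assumes G: "group G" and \<rho>: "\<rho> \<in> hom G G2"
    and reps: "\<And>x. x \<in> carrier G \<Longrightarrow> \<exists>i<length reps. conj_in G x (reps ! i)" "set reps \<subseteq> carrier G" "reps ! 0 = \<one>\<^bsub>G\<^esub>"
    and tr: "\<And>i. 0 < i \<Longrightarrow> i < length reps \<Longrightarrow> trace (\<rho> (reps ! i)) \<noteq> 7"
  shows "\<rho> \<in> mon G G2"
proof -
  interpret group_hom G G2 \<rho> using assms group_G2 by (simp add: group_hom_def group_hom_axioms_def)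
  have "x = \<one>\<^bsub>G\<^esub>" if x: "x \<in> carrier G" "\<rho> x = \<one>\<^bsub>G2\<^esub>" for x
  proof -
    obtain i where i: "i < length reps" "conj_in G x (reps ! i)" using reps(1) x by blast
    have "trace (\<rho> (reps ! i)) = trace (\<rho> x)"
      using trace_conj_in_G2[OF hom_conj_in[OF G group_G2 \<rho> i(2)]] i(1) reps(2) by (simp add: subset_iff)
    also have "\<dots> = 7" by (simp add: x G2_one trace_one_7)
    finally have "i = 0" using tr i(1) by blast
    then show ?thesis using i(2) reps(3) by (auto simp: conj_in_def)
  qed
  then have "inj_on \<rho> (carrier G)" using inj_on_one_iff by blast
  with \<rho> show ?thesis by (simp add: mon_def)
qed

lemma trace_std: "trace std_a = - 1" "trace std_s = 1"
  by (subst trace_zorn, rule std_zorn, simp)+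

lemma trace_circ_std_b: "trace (circ d p q a1 a2 a3 b1 b2 b3 c1 c2 c3 ** std_b) = d + 2 * (a3 - a1 - a2)"
  by (subst trace_zorn, subst matrix_vector_mul_assoc[symmetric], subst std_zorn, rule circ_zorn) simp

lemma trace_circ_std_ab:
  "trace (circ d p q a1 a2 a3 b1 b2 b3 c1 c2 c3 ** (std_a ** std_b)) = d + 2 * (a2 - a1 - a3)"
  by (subst trace_zorn, subst matrix_vector_mul_assoc[symmetric], subst matrix_vector_mul_assoc[symmetric],
      subst std_zorn, subst std_zorn, rule circ_zorn) simp

lemma std_a_not_one: "std_a \<noteq> mat 1"
  using trace_std(1) trace_one_7 by auto

lemma rep_character_eqI:
  assumes G: "group G" and \<rho>: "\<rho> \<in> hom G G2"
    and reps: "\<And>x. x \<in> carrier G \<Longrightarrow> \<exists>i<length reps. conj_in G x (reps ! i)" "set reps \<subseteq> carrier G"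
    and F: "\<And>x i. x \<in> carrier G \<Longrightarrow> i < length reps \<Longrightarrow> conj_in G x (reps ! i) \<Longrightarrow> F x = trace (\<rho> (reps ! i))"
  shows "rep_character G \<rho> = (\<lambda>x\<in>carrier G. F x)"
proof -
  have "trace (\<rho> x) = F x" if x: "x \<in> carrier G" for x
  proof -
    obtain i where i: "i < length reps" "conj_in G x (reps ! i)" using reps(1) x by blast
    have "trace (\<rho> x) = trace (\<rho> (reps ! i))"
      using trace_conj_in_G2[OF hom_conj_in[OF G group_G2 \<rho> i(2)]] i(1) reps(2) by (simp add: subset_iff)
    with F[OF x i] show ?thesis by simp
  qed
  then show ?thesis by (auto simp: rep_character_def)
qed

lemma (in group) pow_two: "x \<in> carrier G \<Longrightarrow> x [^] (2::nat) = x \<otimes> x"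
  by (simp add: numeral_2_eq_2)

lemma mon_not_one:
  assumes "group G" "\<rho> \<in> mon G G2" "x \<in> carrier G" "x \<noteq> \<one>\<^bsub>G\<^esub>"
  shows "\<rho> x \<noteq> mat 1"
proof -
  interpret group_hom G G2 \<rho>
    using mon_hom[OF assms(2)] assms(1) group_G2 by (simp add: group_hom_def group_hom_axioms_def)
  have "inj_on \<rho> (carrier G)" using assms(2) by (simp add: mon_def)
  from inj_on_eq_iff[OF this assms(3) monoid.one_closed[OF group.is_monoid[OF assms(1)]]] assms(4)
  show ?thesis using hom_one by (simp add: G2_one)
qed

subsection \<open>The tetrahedral group\<close>

abbreviation "reps_T \<equiv> [\<one>\<^bsub>tetrahedral\<^esub>, gen 3 Ga, gen 3 Gc, gen 3 Gb]"

lemma reps_T_subset: "set reps_T \<subseteq> carrier tetrahedral"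
  using monoid.one_closed[OF group.is_monoid[OF group_polyhedral]] by (auto simp: gen_in_carrier)

lemma tetrahedral_classes:
  assumes x: "x \<in> carrier tetrahedral"
  shows "\<exists>i<length reps_T. conj_in tetrahedral x (reps_T ! i)"
proof -
  interpret group tetrahedral by (rule group_polyhedral)
  define a s where "a = gen 3 Gc" and "s = gen 3 Gb"
  define b where "b = s \<otimes>\<^bsub>tetrahedral\<^esub> a \<otimes>\<^bsub>tetrahedral\<^esub> s \<otimes>\<^bsub>tetrahedral\<^esub> s"
  have T: "tet_rel tetrahedral a b s"
    unfolding a_def b_def s_def by (rule tet_rel_of_poly_rel[OF poly_rel_gen])
  have cl: "a \<in> carrier tetrahedral" "b \<in> carrier tetrahedral" "s \<in> carrier tetrahedral"
    using tet_rel_closed[OF T] by auto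
  have "x \<in> tet_elements tetrahedral a b s"
    by (rule polyhedral_induct[OF x]) (auto simp: tet_elements_closed[OF T] simp flip: a_def s_def)
  then obtain y where y: "y \<in> {\<one>\<^bsub>tetrahedral\<^esub>, a, s, s \<otimes>\<^bsub>tetrahedral\<^esub> s}" "conj_in tetrahedral x y"
    using tet_elements_conj[OF T] by blast
  have ga: "gen 3 Ga = a \<otimes>\<^bsub>tetrahedral\<^esub> (s \<otimes>\<^bsub>tetrahedral\<^esub> s)"
    unfolding a_def s_def by (rule poly_rel_lact(1)[OF poly_rel_gen])
  have "conj_in tetrahedral (gen 3 Ga) (s \<otimes>\<^bsub>tetrahedral\<^esub> s)"
    unfolding ga by (rule conj_inI[of "a \<otimes>\<^bsub>tetrahedral\<^esub> b"])
      (use cl in \<open>simp_all add: m_assoc tet_rel_simps[OF T] tet_rel_simps'[OF T]\<close>)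
  then have "conj_in tetrahedral (s \<otimes>\<^bsub>tetrahedral\<^esub> s) (gen 3 Ga)"
    by (rule conj_in_sym) (use cl in simp)
  then have "y = s \<otimes>\<^bsub>tetrahedral\<^esub> s \<Longrightarrow> conj_in tetrahedral x (gen 3 Ga)"
    using conj_in_trans y(2) gen_in_carrier by metis
  then have "\<exists>z\<in>set reps_T. conj_in tetrahedral x z" using y by (auto simp: a_def s_def)
  then show ?thesis by (metis in_set_conv_nth)
qed

lemma tetrahedral_classification:
  "equiv (mon tetrahedral G2) (mon_conj tetrahedral G2) \<and>
    rep_character tetrahedral respects mon_conj tetrahedral G2 \<and>
    bij_betw (\<lambda>C. the_elem (rep_character tetrahedral ` C)) (mon tetrahedral G2 // mon_conj tetrahedral G2)
      {\<lambda>\<gamma>\<in>carrier tetrahedral. chi_T 1 \<gamma> + 2 * chi_T 4 \<gamma>}"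
proof -
  let ?G = tetrahedral
  interpret G: group ?G by (rule group_polyhedral)
  obtain \<rho> where \<rho>: "\<rho> \<in> hom ?G G2" "\<rho> (gen 3 Ga) = std_a ** std_s ** std_s" "\<rho> (gen 3 Gb) = std_s" "\<rho> (gen 3 Gc) = std_a"
    using ex_polyhedral_hom[OF group_G2 group.poly_rel_of_tet_rel[OF group_G2 std_tet_rel]] by (auto simp: G2_mult)
  interpret \<rho>: group_hom ?G G2 \<rho>
    using \<rho>(1) group_polyhedral group_G2 by (simp add: group_hom_def group_hom_axioms_def)
  have "(std_a ** std_s ** std_s) *v zorn e x1 x2 x3 y1 y2 y3 = zorn e x2 (- x3) (- x1) y2 (- y3) (- y1)"
    for e x1 x2 x3 y1 y2 y3 by (simp add: std_zorn flip: matrix_vector_mul_assoc)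
  from trace_zorn[OF this] have tr1: "trace (std_a ** std_s ** std_s) = 1" by simp
  have tr: "trace (\<rho> (reps_T ! i)) = [7, 1, -1, 1] ! i" if "i < length reps_T" for i
  proof -
    have "i = 0 \<or> i = 1 \<or> i = 2 \<or> i = 3" using that by auto
    then show ?thesis using \<rho>.hom_one by (auto simp: \<rho> trace_std tr1 trace_one_7 G2_one)
  qed
  have mon: "\<rho> \<in> mon ?G G2"
  proof (rule mon_of_traces[OF group_polyhedral \<rho>(1) tetrahedral_classes reps_T_subset])
    fix i assume "0 < i" "i < length reps_T"
    then have "i = 1 \<or> i = 2 \<or> i = 3" by auto
    then show "trace (\<rho> (reps_T ! i)) \<noteq> 7" unfolding tr[OF \<open>i < length reps_T\<close>] by auto
  qed auto
  \<comment> \<open>The traces at \<open>gen 3 Ga\<close> and \<open>gen 3 Gb\<close> are both 1, so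
    they do not exclude that the two are conjugate. For \<open>k = 1\<close> and
    \<open>k = 4\<close> the listed values agree there, and \<open>sep\<close> holds all the
    same.\<close>
  have chi: "chi_T k x = [[1, 1, 1, 1], [1, zeta\<^sup>2, 1, zeta], [1, zeta, 1, zeta\<^sup>2], [3, 0, -1, 0]] ! (k - 1) ! i"
    if x: "x \<in> carrier ?G" "i < length reps_T" "conj_in ?G x (reps_T ! i)" and k: "k \<in> {1, 4}" for k x i
    unfolding chi_T_def
  proof (rule class_function_eq[OF group_polyhedral x reps_T_subset])
    fix j assume j: "j < length reps_T" "conj_in ?G (reps_T ! i) (reps_T ! j)"
    have "reps_T ! j \<in> carrier ?G" using j(1) reps_T_subset nth_mem by blast
    then have "trace (\<rho> (reps_T ! i)) = trace (\<rho> (reps_T ! j))"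
      by (intro trace_conj_in_G2 hom_conj_in[OF group_polyhedral group_G2 \<rho>(1) j(2)])
    then have "[7, 1, -1, 1] ! i = ([7, 1, -1, 1] ! j :: complex)" using tr x(2) j(1) by simp
    moreover have "i = 0 \<or> i = 1 \<or> i = 2 \<or> i = 3" "j = 0 \<or> j = 1 \<or> j = 2 \<or> j = 3" using x(2) j(1) by auto
    ultimately show "[[1, 1, 1, 1], [1, zeta\<^sup>2, 1, zeta], [1, zeta, 1, zeta\<^sup>2], [3, 0, -1, 0]] ! (k - 1) ! j
        = [[1, 1, 1, 1], [1, zeta\<^sup>2, 1, zeta], [1, zeta, 1, zeta\<^sup>2], [3, 0, -1, 0]] ! (k - 1) ! i"
      using k by auto
  qed
  have ch: "rep_character ?G \<rho> = (\<lambda>\<gamma>\<in>carrier ?G. chi_T 1 \<gamma> + 2 * chi_T 4 \<gamma>)"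
  proof (rule rep_character_eqI[OF group_polyhedral \<rho>(1) tetrahedral_classes reps_T_subset])
    fix x i assume x: "x \<in> carrier ?G" "i < length reps_T" "conj_in ?G x (reps_T ! i)"
    then have "i = 0 \<or> i = 1 \<or> i = 2 \<or> i = 3" by auto
    then show "chi_T 1 x + 2 * chi_T 4 x = trace (\<rho> (reps_T ! i))"
      unfolding tr[OF x(2)] using chi[OF x, of 1] chi[OF x, of 4] by auto
  qed auto
  show ?thesis
  proof (rule classification_by_characters[of "{\<rho>}"])
    fix \<sigma> assume \<sigma>: "\<sigma> \<in> mon ?G G2"
    interpret \<sigma>: group_hom ?G G2 \<sigma>
      using mon_hom[OF \<sigma>] group_polyhedral group_G2 by (simp add: group_hom_def group_hom_axioms_def)
    note T = tet_rel_hom[OF group_polyhedral group_G2 mon_hom[OF \<sigma>] G.tet_rel_of_poly_rel[OF poly_rel_gen]]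
    have "gen 3 Gc \<noteq> \<one>\<^bsub>?G\<^esub>" using \<rho>.hom_one \<rho>(4) std_a_not_one by (auto simp: G2_one)
    then have "\<sigma> (gen 3 Gc) \<noteq> mat 1" by (rule mon_not_one[OF group_polyhedral \<sigma> gen_in_carrier])
    from tetra_standard[OF tetra_of_tet_rel[OF T this]] obtain h where
      "h \<in> zaut" "h ** \<sigma> (gen 3 Gc) = std_a ** h" "h ** \<sigma> (gen 3 Gb) = std_s ** h" by metis
    then show "\<exists>\<rho>'\<in>{\<rho>}. (\<sigma>, \<rho>') \<in> mon_conj ?G G2"
      using mon_conj_gensI[OF \<sigma> mon] by (simp add: \<rho>)
  qed (use mon ch in auto)
qed

subsection \<open>The octahedral group\<close>

abbreviation "reps_O \<equiv> [\<one>\<^bsub>octahedral\<^esub>, gen 4 Gc, gen 4 Gb, gen 4 Ga [^]\<^bsub>octahedral\<^esub> (2::nat), gen 4 Ga]"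

lemma reps_O_subset: "set reps_O \<subseteq> carrier octahedral"
proof -
  interpret group octahedral by (rule group_polyhedral)
  show ?thesis by (auto simp: gen_in_carrier)
qed

definition oct_v :: polyhedral where
  "oct_v = gen 4 Gb \<otimes>\<^bsub>octahedral\<^esub> gen 4 Gb \<otimes>\<^bsub>octahedral\<^esub> gen 4 Gc \<otimes>\<^bsub>octahedral\<^esub> gen 4 Gb
     \<otimes>\<^bsub>octahedral\<^esub> gen 4 Gc \<otimes>\<^bsub>octahedral\<^esub> gen 4 Gb \<otimes>\<^bsub>octahedral\<^esub> gen 4 Gb"

definition oct_t :: polyhedral where
  "oct_t = gen 4 Gc \<otimes>\<^bsub>octahedral\<^esub> oct_v"

definition oct_w :: polyhedral where
  "oct_w = gen 4 Gb \<otimes>\<^bsub>octahedral\<^esub> oct_v \<otimes>\<^bsub>octahedral\<^esub> gen 4 Gb \<otimes>\<^bsub>octahedral\<^esub> gen 4 Gb"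

lemma oct_rel_octahedral: "oct_rel octahedral oct_v oct_w (gen 4 Gb) oct_t"
  and octahedral_c: "gen 4 Gc = oct_t \<otimes>\<^bsub>octahedral\<^esub> oct_v"
  unfolding oct_t_def oct_v_def oct_w_def
  by (rule group.oct_rel_of_poly_rel[OF group_polyhedral poly_rel_gen])+

lemma octahedral_classes:
  assumes x: "x \<in> carrier octahedral"
  shows "\<exists>i<length reps_O. conj_in octahedral x (reps_O ! i)"
    and "conj_in octahedral oct_v (gen 4 Ga [^]\<^bsub>octahedral\<^esub> (2::nat))"
proof -
  interpret group octahedral by (rule group_polyhedral)
  define a b s t where "a = oct_v" and "b = oct_w" and "s = gen 4 Gb" and "t = oct_t"
  have O: "oct_rel octahedral a b s t"
    unfolding a_def b_def s_def t_def by (rule oct_rel_octahedral)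
  then have T: "tet_rel octahedral a b s" by (simp add: oct_rel_def)
  have cl: "a \<in> carrier octahedral" "b \<in> carrier octahedral" "s \<in> carrier octahedral" "t \<in> carrier octahedral"
    using tet_rel_closed[OF T] O by (auto simp: oct_rel_def)
  note rules = m_assoc tet_rel_simps[OF T] tet_rel_simps'[OF T] oct_rel_simps[OF O] oct_rel_simps'[OF O]
  note D = double_elements_closed[OF disjI1[OF O]]
  have c: "gen 4 Gc = t \<otimes>\<^bsub>octahedral\<^esub> a" unfolding t_def a_def by (rule octahedral_c)
  have ga: "gen 4 Ga = t \<otimes>\<^bsub>octahedral\<^esub> (a \<otimes>\<^bsub>octahedral\<^esub> (s \<otimes>\<^bsub>octahedral\<^esub> s))"
    using poly_rel_lact(1)[OF poly_rel_gen[of 4]] c cl by (simp add: s_def m_assoc)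
  have ga2: "gen 4 Ga [^]\<^bsub>octahedral\<^esub> (2::nat) = a \<otimes>\<^bsub>octahedral\<^esub> b"
    using cl by (simp add: pow_two gen_in_carrier) (simp add: ga rules)
  have "x \<in> double_elements a b s t"
  proof (rule polyhedral_induct[OF x])
    fix y assume y: "y \<in> carrier octahedral" "y \<in> double_elements a b s t"
    show "gen 4 Gb \<otimes>\<^bsub>octahedral\<^esub> y \<in> double_elements a b s t" using D(3)[OF y(2)] by (simp add: s_def)
    show "gen 4 Gc \<otimes>\<^bsub>octahedral\<^esub> y \<in> double_elements a b s t"
      using D(4)[OF D(2)[OF y(2)]] y(1) cl by (simp add: c m_assoc)
  qed (rule D(1))
  then obtain y where y: "y \<in> {\<one>\<^bsub>octahedral\<^esub>, a, s, t, t \<otimes>\<^bsub>octahedral\<^esub> a, t \<otimes>\<^bsub>octahedral\<^esub> b,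
      t \<otimes>\<^bsub>octahedral\<^esub> (a \<otimes>\<^bsub>octahedral\<^esub> b)}" "conj_in octahedral x y"
    using double_elements_conj[OF disjI1[OF O]] by blast
  have c1: "conj_in octahedral a (gen 4 Ga [^]\<^bsub>octahedral\<^esub> (2::nat))"
    unfolding ga2 by (rule conj_inI[of s]) (use cl in \<open>simp_all add: rules\<close>)
  then show "conj_in octahedral oct_v (gen 4 Ga [^]\<^bsub>octahedral\<^esub> (2::nat))" by (simp add: a_def)
  have c2: "conj_in octahedral t (gen 4 Gc)"
    unfolding c by (rule conj_inI[of b]) (use cl in \<open>simp_all add: rules\<close>)
  have c3: "conj_in octahedral (gen 4 Ga) (t \<otimes>\<^bsub>octahedral\<^esub> (a \<otimes>\<^bsub>octahedral\<^esub> b))"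
    unfolding ga by (rule conj_inI[of "s \<otimes>\<^bsub>octahedral\<^esub> s"]) (use cl in \<open>simp_all add: rules\<close>)
  have c4: "conj_in octahedral (t \<otimes>\<^bsub>octahedral\<^esub> (a \<otimes>\<^bsub>octahedral\<^esub> b)) (gen 4 Ga)"
    using conj_in_sym[OF c3] cl by simp
  have c5: "conj_in octahedral (t \<otimes>\<^bsub>octahedral\<^esub> b) (t \<otimes>\<^bsub>octahedral\<^esub> (a \<otimes>\<^bsub>octahedral\<^esub> b))"
    by (rule conj_inI[of t]) (use cl in \<open>simp_all add: rules\<close>)
  have c6: "conj_in octahedral (t \<otimes>\<^bsub>octahedral\<^esub> b) (gen 4 Ga)"
    by (rule conj_in_trans[OF c5 c4 gen_in_carrier])
  have "\<exists>z\<in>set reps_O. conj_in octahedral y z"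
    using y(1) c1 c2 c4 c6 conj_in_refl[of "gen 4 Gc"] conj_in_refl[of s] conj_in_refl[of "\<one>\<^bsub>octahedral\<^esub>"] gen_in_carrier[of 4 Gc] cl
    by (auto simp: s_def c)
  then have "\<exists>z\<in>set reps_O. conj_in octahedral x z"
    using conj_in_trans[OF y(2)] reps_O_subset by blast
  then show "\<exists>i<length reps_O. conj_in octahedral x (reps_O ! i)" by (metis in_set_conv_nth)
qed

text \<open>Target of the sign character. It is commutative, so conjugate elements have equal
  images; this separates \<open>gen 4 Gc\<close> from the square of \<open>gen 4 Ga\<close>.\<close>

definition nonzero_mult :: "complex monoid" where
  "nonzero_mult = \<lparr>carrier = UNIV - {0}, monoid.mult = (*), one = 1\<rparr>"

lemma group_nonzero_mult: "group nonzero_mult"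
proof (rule groupI)
  fix x assume "x \<in> carrier nonzero_mult"
  then show "\<exists>y\<in>carrier nonzero_mult. y \<otimes>\<^bsub>nonzero_mult\<^esub> x = \<one>\<^bsub>nonzero_mult\<^esub>"
    by (intro bexI[of _ "inverse x"]) (auto simp: nonzero_mult_def)
qed (auto simp: nonzero_mult_def)

lemma octahedral_sign:
  obtains \<epsilon> where "\<epsilon> \<in> hom octahedral nonzero_mult" "\<epsilon> (gen 4 Ga) = -1" "\<epsilon> (gen 4 Gb) = 1" "\<epsilon> (gen 4 Gc) = -1"
proof -
  interpret group nonzero_mult by (rule group_nonzero_mult)
  have "poly_rel nonzero_mult 4 (-1) 1 (-1)"
    by (simp add: poly_rel_def eval_nat_numeral) (simp add: nonzero_mult_def)
  from ex_polyhedral_hom[OF group_nonzero_mult this] that show thesis by blast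
qed

lemma conj_in_nonzero_mult: "conj_in nonzero_mult x y \<Longrightarrow> x = y"
proof -
  assume "conj_in nonzero_mult x y"
  then obtain g where g: "g \<in> carrier nonzero_mult" "x = g \<otimes>\<^bsub>nonzero_mult\<^esub> y \<otimes>\<^bsub>nonzero_mult\<^esub> inv\<^bsub>nonzero_mult\<^esub> g"
    by (auto simp: conj_in_def)
  from group.r_inv[OF group_nonzero_mult g(1)] have "g * inv\<^bsub>nonzero_mult\<^esub> g = 1"
    by (simp add: nonzero_mult_def)
  with g(2) show "x = y" by (simp add: nonzero_mult_def)
qed

lemma octahedral_hom_std:
  assumes t: "t \<in> {oct_A, oct_B}"
  obtains \<rho> where "\<rho> \<in> hom octahedral G2" "\<rho> (gen 4 Gb) = std_s" "\<rho> (gen 4 Gc) = t ** std_a"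
    "\<And>i. i < length reps_O \<Longrightarrow> trace (\<rho> (reps_O ! i)) = [7, -1, 1, -1, if t = oct_A then 3 else -1] ! i"
proof -
  obtain \<rho> where \<rho>: "\<rho> \<in> hom octahedral G2" "\<rho> (gen 4 Ga) = t ** std_a ** std_s ** std_s"
    "\<rho> (gen 4 Gb) = std_s" "\<rho> (gen 4 Gc) = t ** std_a"
    using ex_polyhedral_hom[OF group_G2 group.poly_rel_of_oct_rel[OF group_G2 std_oct_rel[OF t]]] by (auto simp: G2_mult)
  interpret \<rho>: group_hom octahedral G2 \<rho>
    using \<rho>(1) group_polyhedral group_G2 by (simp add: group_hom_def group_hom_axioms_def)
  have A: "(oct_A ** std_a ** std_s ** std_s) *v zorn e x1 x2 x3 y1 y2 y3 = zorn e (- x2) x1 x3 (- y2) y1 y3"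
    "(oct_B ** std_a ** std_s ** std_s) *v zorn e x1 x2 x3 y1 y2 y3 = zorn (- e) (- y2) y1 y3 (- x2) x1 x3"
    for e x1 x2 x3 y1 y2 y3
    by (simp_all add: std_zorn oct_A_def oct_B_def circ_zorn flip: matrix_vector_mul_assoc)
  have A2: "((oct_A ** std_a ** std_s ** std_s) ** (oct_A ** std_a ** std_s ** std_s)) *v zorn e x1 x2 x3 y1 y2 y3
      = zorn e (- x1) (- x2) x3 (- y1) (- y2) y3"
    "((oct_B ** std_a ** std_s ** std_s) ** (oct_B ** std_a ** std_s ** std_s)) *v zorn e x1 x2 x3 y1 y2 y3
      = zorn e (- x1) (- x2) x3 (- y1) (- y2) y3"
    for e x1 x2 x3 y1 y2 y3
    by (subst matrix_vector_mul_assoc[symmetric], simp add: A)+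
  \<comment> \<open>Both have trace -1, but after multiplication by \<open>std_b\<close> the traces
    are 3 and -1.\<close>
  have AB: "oct_A \<noteq> oct_B"
    using trace_circ[of 1 0 0 "-1" 0 0 0 0 0 0 0 0] trace_circ[of "-1" 0 0 0 0 0 "-1" 0 0 "-1" 0 0]
      trace_circ_std_b[of 1 0 0 "-1" 0 0 0 0 0 0 0 0] trace_circ_std_b[of "-1" 0 0 0 0 0 "-1" 0 0 "-1" 0 0]
    by (auto simp: oct_A_def oct_B_def)
  have ta: "trace (t ** std_a ** std_s ** std_s) = (if t = oct_A then 3 else -1)"
    using t trace_zorn[OF A(1)] trace_zorn[OF A(2)] AB by auto
  have ta2: "trace ((t ** std_a ** std_s ** std_s) ** (t ** std_a ** std_s ** std_s)) = -1"
    using t trace_zorn[OF A2(1)] trace_zorn[OF A2(2)] by auto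
  have tc: "trace (t ** std_a) = -1"
    using t by (auto simp: oct_A_def oct_B_def trace_circ_std_a)
  have sq: "gen 4 Ga [^]\<^bsub>octahedral\<^esub> (2::nat) = gen 4 Ga \<otimes>\<^bsub>octahedral\<^esub> gen 4 Ga"
    by (rule group.pow_two[OF group_polyhedral gen_in_carrier])
  have "trace (\<rho> (reps_O ! i)) = [7, -1, 1, -1, if t = oct_A then 3 else -1] ! i" if "i < length reps_O" for i
  proof -
    have "i = 0 \<or> i = 1 \<or> i = 2 \<or> i = 3 \<or> i = 4" using that by auto
    then show ?thesis using \<rho>.hom_one ta ta2 tc by (auto simp: \<rho> sq trace_std trace_one_7 G2_one G2_mult gen_in_carrier)
  qed
  with \<rho> that show thesis by blast
qed

lemma octahedral_reps_inequivalent: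
  assumes ij: "i < length reps_O" "j < length reps_O" and c: "conj_in octahedral (reps_O ! i) (reps_O ! j)"
  shows "i = j"
proof -
  obtain \<rho> where \<rho>: "\<rho> \<in> hom octahedral G2"
    "\<And>i. i < length reps_O \<Longrightarrow> trace (\<rho> (reps_O ! i)) = [7, -1, 1, -1, if oct_A = oct_A then 3 else -1] ! i"
    using octahedral_hom_std[of oct_A] by blast
  obtain \<epsilon> where \<epsilon>: "\<epsilon> \<in> hom octahedral nonzero_mult" "\<epsilon> (gen 4 Ga) = -1" "\<epsilon> (gen 4 Gb) = 1" "\<epsilon> (gen 4 Gc) = -1"
    using octahedral_sign .
  interpret \<epsilon>: group_hom octahedral nonzero_mult \<epsilon>
    using \<epsilon>(1) group_polyhedral group_nonzero_mult by (simp add: group_hom_def group_hom_axioms_def)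
  have sq: "\<epsilon> (gen 4 Ga [^]\<^bsub>octahedral\<^esub> (2::nat)) = 1"
    by (simp add: group.pow_two[OF group_polyhedral] gen_in_carrier \<epsilon>) (simp add: nonzero_mult_def)
  have rj: "reps_O ! j \<in> carrier octahedral" using ij(2) reps_O_subset nth_mem by blast
  have 1: "[7, -1, 1, -1, 3] ! i = ([7, -1, 1, -1, 3] ! j :: complex)"
    using trace_conj_in_G2[OF hom_conj_in[OF group_polyhedral group_G2 \<rho>(1) c rj]] \<rho>(2) ij by simp
  have 2: "\<epsilon> (reps_O ! i) = \<epsilon> (reps_O ! j)"
    by (rule conj_in_nonzero_mult[OF hom_conj_in[OF group_polyhedral group_nonzero_mult \<epsilon>(1) c rj]])
  have "i = 0 \<or> i = 1 \<or> i = 2 \<or> i = 3 \<or> i = 4" "j = 0 \<or> j = 1 \<or> j = 2 \<or> j = 3 \<or> j = 4" using ij by auto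
  then show ?thesis using 1 2 by (elim disjE) (simp_all add: sq \<epsilon>)
qed

lemma octahedral_classification:
  "equiv (mon octahedral G2) (mon_conj octahedral G2) \<and>
    rep_character octahedral respects mon_conj octahedral G2 \<and>
    bij_betw (\<lambda>C. the_elem (rep_character octahedral ` C)) (mon octahedral G2 // mon_conj octahedral G2)
      {\<lambda>\<gamma>\<in>carrier octahedral. chi_O 1 \<gamma> + 2 * chi_O 4 \<gamma>,
       \<lambda>\<gamma>\<in>carrier octahedral. chi_O 2 \<gamma> + chi_O 4 \<gamma> + chi_O 5 \<gamma>}"
proof -
  let ?G = octahedral
  interpret G: group ?G by (rule group_polyhedral)
  obtain \<rho> where \<rho>: "\<rho> \<in> hom ?G G2" "\<rho> (gen 4 Gb) = std_s" "\<rho> (gen 4 Gc) = oct_A ** std_a"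
    and tr\<rho>: "\<And>i. i < length reps_O \<Longrightarrow> trace (\<rho> (reps_O ! i)) = [7, -1, 1, -1, if oct_A = oct_A then 3 else -1] ! i"
    using octahedral_hom_std[of oct_A] by blast
  obtain \<rho>' where \<rho>': "\<rho>' \<in> hom ?G G2" "\<rho>' (gen 4 Gb) = std_s" "\<rho>' (gen 4 Gc) = oct_B ** std_a"
    and tr\<rho>': "\<And>i. i < length reps_O \<Longrightarrow> trace (\<rho>' (reps_O ! i)) = [7, -1, 1, -1, if oct_B = oct_A then 3 else -1] ! i"
    using octahedral_hom_std[of oct_B] by blast
  have AB: "oct_B \<noteq> oct_A"
    using trace_circ_std_b[of 1 0 0 "-1" 0 0 0 0 0 0 0 0] trace_circ_std_b[of "-1" 0 0 0 0 0 "-1" 0 0 "-1" 0 0]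
    by (auto simp: oct_A_def oct_B_def)
  have five: "i = 0 \<or> i = 1 \<or> i = 2 \<or> i = 3 \<or> i = 4" if "i < length reps_O" for i using that by auto
  have mon: "\<rho> \<in> mon ?G G2"
  proof (rule mon_of_traces[OF group_polyhedral \<rho>(1) octahedral_classes(1) reps_O_subset])
    fix i assume "0 < i" "i < length reps_O"
    then show "trace (\<rho> (reps_O ! i)) \<noteq> 7" unfolding tr\<rho>[OF \<open>i < length reps_O\<close>] using five[of i] by auto
  qed auto
  have mon': "\<rho>' \<in> mon ?G G2"
  proof (rule mon_of_traces[OF group_polyhedral \<rho>'(1) octahedral_classes(1) reps_O_subset])
    fix i assume "0 < i" "i < length reps_O"
    then show "trace (\<rho>' (reps_O ! i)) \<noteq> 7" unfolding tr\<rho>'[OF \<open>i < length reps_O\<close>] using five[of i] AB by auto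
  qed auto
  have chi: "chi_O k x = [[1, 1, 1, 1, 1], [1, -1, 1, 1, -1], [2, 0, -1, 2, 0], [3, -1, 0, -1, 1], [3, 1, 0, -1, -1]] ! (k - 1) ! i"
    if x: "x \<in> carrier ?G" "i < length reps_O" "conj_in ?G x (reps_O ! i)" for k x i
    unfolding chi_O_def
    by (rule class_function_eq[OF group_polyhedral x reps_O_subset])
      (use octahedral_reps_inequivalent[OF x(2)] in blast)
  have ch: "rep_character ?G \<rho> = (\<lambda>\<gamma>\<in>carrier ?G. chi_O 1 \<gamma> + 2 * chi_O 4 \<gamma>)"
  proof (rule rep_character_eqI[OF group_polyhedral \<rho>(1) octahedral_classes(1) reps_O_subset])
    fix x i assume x: "x \<in> carrier ?G" "i < length reps_O" "conj_in ?G x (reps_O ! i)"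
    show "chi_O 1 x + 2 * chi_O 4 x = trace (\<rho> (reps_O ! i))"
      unfolding tr\<rho>[OF x(2)] chi[OF x] using five[OF x(2)] by auto
  qed auto
  have ch': "rep_character ?G \<rho>' = (\<lambda>\<gamma>\<in>carrier ?G. chi_O 2 \<gamma> + chi_O 4 \<gamma> + chi_O 5 \<gamma>)"
  proof (rule rep_character_eqI[OF group_polyhedral \<rho>'(1) octahedral_classes(1) reps_O_subset])
    fix x i assume x: "x \<in> carrier ?G" "i < length reps_O" "conj_in ?G x (reps_O ! i)"
    show "chi_O 2 x + chi_O 4 x + chi_O 5 x = trace (\<rho>' (reps_O ! i))"
      unfolding tr\<rho>'[OF x(2)] chi[OF x] using five[OF x(2)] AB by auto
  qed auto
  have "trace (\<rho> (gen 4 Ga)) = 3" "trace (\<rho>' (gen 4 Ga)) = -1"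
    using tr\<rho>[of 4] tr\<rho>'[of 4] AB by auto
  then have ne: "rep_character ?G \<rho> \<noteq> rep_character ?G \<rho>'"
    using gen_in_carrier[of 4 Ga] by (auto simp: rep_character_def dest: fun_cong[of _ _ "gen 4 Ga"])
  show ?thesis
  proof (rule classification_by_characters[of "{\<rho>, \<rho>'}"])
    fix \<sigma> assume \<sigma>: "\<sigma> \<in> mon ?G G2"
    interpret \<sigma>: group_hom ?G G2 \<sigma>
      using mon_hom[OF \<sigma>] group_polyhedral group_G2 by (simp add: group_hom_def group_hom_axioms_def)
    have O: "oct_rel G2 (\<sigma> oct_v) (\<sigma> oct_w) (\<sigma> (gen 4 Gb)) (\<sigma> oct_t)"
      by (rule oct_rel_hom[OF group_polyhedral group_G2 mon_hom[OF \<sigma>] oct_rel_octahedral])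
    have vt: "oct_v \<in> carrier ?G" "oct_t \<in> carrier ?G"
      using oct_rel_octahedral G.tet_rel_closed by (auto simp: oct_rel_def)
    have "trace (\<rho> oct_v) = -1"
      using trace_conj_in_G2[OF hom_conj_in[OF group_polyhedral group_G2 \<rho>(1) octahedral_classes(2)[OF vt(1)]]]
        tr\<rho>[of 3] by (simp add: gen_in_carrier)
    then have "oct_v \<noteq> \<one>\<^bsub>?G\<^esub>" using tr\<rho>[of 0] by auto
    then have v1: "\<sigma> oct_v \<noteq> mat 1" by (rule mon_not_one[OF group_polyhedral \<sigma> vt(1)])
    have "\<exists>h\<in>zaut. \<exists>t0\<in>{oct_A, oct_B}. h ** \<sigma> oct_v = std_a ** h \<and> h ** \<sigma> (gen 4 Gb) = std_s ** h \<and> h ** \<sigma> oct_t = t0 ** h"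
      by (rule extension_standard[of _ "\<sigma> oct_w"]) (use O v1 oct_classification in \<open>auto simp: oct_rel_def G2_mult G2_one\<close>)
    then obtain h t0 where h: "h \<in> zaut" "t0 \<in> {oct_A, oct_B}" "h ** \<sigma> oct_v = std_a ** h"
      "h ** \<sigma> (gen 4 Gb) = std_s ** h" "h ** \<sigma> oct_t = t0 ** h" by blast
    have c: "h ** \<sigma> (gen 4 Gc) = (t0 ** std_a) ** h"
      using h(3,5) vt by (simp add: octahedral_c G2_mult) (metis matrix_mul_assoc)
    show "\<exists>\<rho>''\<in>{\<rho>, \<rho>'}. (\<sigma>, \<rho>'') \<in> mon_conj ?G G2"
      using h(2)
    proof (elim insertE emptyE)
      assume "t0 = oct_A"
      with mon_conj_gensI[OF \<sigma> mon h(1)] h(4) c show ?thesis by (simp add: \<rho>)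
    next
      assume "t0 = oct_B"
      with mon_conj_gensI[OF \<sigma> mon' h(1)] h(4) c show ?thesis by (simp add: \<rho>')
    qed
  qed (use mon mon' ch ch' ne in auto)
qed

subsection \<open>The icosahedral group\<close>

abbreviation "reps_I \<equiv> [\<one>\<^bsub>icosahedral\<^esub>, gen 5 Gb, gen 5 Gc, gen 5 Ga, gen 5 Ga [^]\<^bsub>icosahedral\<^esub> (2::nat)]"

lemma reps_I_subset: "set reps_I \<subseteq> carrier icosahedral"
proof -
  interpret group icosahedral by (rule group_polyhedral)
  show ?thesis by (auto simp: gen_in_carrier)
qed

definition ico_v :: polyhedral where
  "ico_v = gen 5 Gc \<otimes>\<^bsub>icosahedral\<^esub> gen 5 Gb \<otimes>\<^bsub>icosahedral\<^esub> gen 5 Gb \<otimes>\<^bsub>icosahedral\<^esub> gen 5 Gc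
     \<otimes>\<^bsub>icosahedral\<^esub> gen 5 Gb \<otimes>\<^bsub>icosahedral\<^esub> gen 5 Gc"

definition ico_t :: polyhedral where
  "ico_t = gen 5 Gc \<otimes>\<^bsub>icosahedral\<^esub> gen 5 Gb \<otimes>\<^bsub>icosahedral\<^esub> gen 5 Gc \<otimes>\<^bsub>icosahedral\<^esub> gen 5 Gb \<otimes>\<^bsub>icosahedral\<^esub> gen 5 Gb
     \<otimes>\<^bsub>icosahedral\<^esub> gen 5 Gc \<otimes>\<^bsub>icosahedral\<^esub> gen 5 Gb \<otimes>\<^bsub>icosahedral\<^esub> gen 5 Gc \<otimes>\<^bsub>icosahedral\<^esub> gen 5 Gb
     \<otimes>\<^bsub>icosahedral\<^esub> gen 5 Gb \<otimes>\<^bsub>icosahedral\<^esub> gen 5 Gc"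

definition ico_w :: polyhedral where
  "ico_w = gen 5 Gb \<otimes>\<^bsub>icosahedral\<^esub> ico_v \<otimes>\<^bsub>icosahedral\<^esub> gen 5 Gb \<otimes>\<^bsub>icosahedral\<^esub> gen 5 Gb"

lemmas ico_words = group.ico_rel_of_poly_rel[OF group_polyhedral poly_rel_gen[of 5],
    folded ico_v_def, folded ico_t_def, folded ico_w_def]

lemma ico_words_closed: "ico_v \<in> carrier icosahedral" "ico_w \<in> carrier icosahedral" "ico_t \<in> carrier icosahedral"
  using ico_words(1) group.tet_rel_closed[OF group_polyhedral] by (auto simp: ico_rel_def)

lemma icosahedral_conj:
  "conj_in icosahedral ico_v (gen 5 Gc)" "conj_in icosahedral ico_t (gen 5 Gc)"
  "conj_in icosahedral (ico_t \<otimes>\<^bsub>icosahedral\<^esub> ico_v) (gen 5 Gb)"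
  "conj_in icosahedral (ico_t \<otimes>\<^bsub>icosahedral\<^esub> ico_w) (gen 5 Ga)"
proof -
  interpret group icosahedral by (rule group_polyhedral)
  define a b c where "a = gen 5 Ga" and "b = gen 5 Gb" and "c = gen 5 Gc"
  note cl = ico_words_closed gen_in_carrier[of 5 Ga, folded a_def] gen_in_carrier[of 5 Gb, folded b_def]
    gen_in_carrier[of 5 Gc, folded c_def]
  note W = ico_words[folded a_def b_def c_def]
  show "conj_in icosahedral ico_v (gen 5 Gc)" "conj_in icosahedral ico_t (gen 5 Gc)"
    using conj_inI[OF _ _ _ W(3)] conj_inI[OF _ _ _ W(4)] cl by (simp_all add: c_def)
  have 1: "conj_in icosahedral (b \<otimes>\<^bsub>icosahedral\<^esub> b) (ico_t \<otimes>\<^bsub>icosahedral\<^esub> ico_v)"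
    using conj_inI[OF _ _ _ W(5)[symmetric]] cl by simp
  have 2: "conj_in icosahedral (b \<otimes>\<^bsub>icosahedral\<^esub> b) b"
  proof (rule conj_inI[of ico_t])
    have t: "ico_t \<otimes>\<^bsub>icosahedral\<^esub> ico_t = \<one>\<^bsub>icosahedral\<^esub>"
      "ico_t \<otimes>\<^bsub>icosahedral\<^esub> b \<otimes>\<^bsub>icosahedral\<^esub> ico_t = b \<otimes>\<^bsub>icosahedral\<^esub> b"
      using W(1) by (auto simp: ico_rel_def)
    have "b \<otimes>\<^bsub>icosahedral\<^esub> b \<otimes>\<^bsub>icosahedral\<^esub> ico_t = ico_t \<otimes>\<^bsub>icosahedral\<^esub> b \<otimes>\<^bsub>icosahedral\<^esub> (ico_t \<otimes>\<^bsub>icosahedral\<^esub> ico_t)"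
      unfolding t(2)[symmetric] using cl by (simp add: m_assoc)
    then show "b \<otimes>\<^bsub>icosahedral\<^esub> b \<otimes>\<^bsub>icosahedral\<^esub> ico_t = ico_t \<otimes>\<^bsub>icosahedral\<^esub> b" using cl t(1) by simp
  qed (use cl in auto)
  show "conj_in icosahedral (ico_t \<otimes>\<^bsub>icosahedral\<^esub> ico_v) (gen 5 Gb)"
    using conj_in_trans[OF conj_in_sym[OF 1] 2] cl by (simp add: b_def)
  show "conj_in icosahedral (ico_t \<otimes>\<^bsub>icosahedral\<^esub> ico_w) (gen 5 Ga)"
    using conj_in_sym[OF conj_inI[OF _ _ _ W(6)[symmetric]]] cl by (simp add: a_def)
qed

lemma icosahedral_classes:
  assumes x: "x \<in> carrier icosahedral"
  shows "\<exists>i<length reps_I. conj_in icosahedral x (reps_I ! i)"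
proof -
  interpret group icosahedral by (rule group_polyhedral)
  note cl = ico_words_closed gen_in_carrier[of 5]
  note I = disjI2[OF ico_words(1)]
  note D = double_elements_closed[OF I]
  have "x \<in> double_elements ico_v ico_w (gen 5 Gb) ico_t"
  proof (rule polyhedral_induct[OF x])
    fix y assume y: "y \<in> carrier icosahedral" "y \<in> double_elements ico_v ico_w (gen 5 Gb) ico_t"
    show "gen 5 Gb \<otimes>\<^bsub>icosahedral\<^esub> y \<in> double_elements ico_v ico_w (gen 5 Gb) ico_t" by (rule D(3)[OF y(2)])
    show "gen 5 Gc \<otimes>\<^bsub>icosahedral\<^esub> y \<in> double_elements ico_v ico_w (gen 5 Gb) ico_t"
      using D(2)[OF D(3)[OF D(4)[OF D(2)[OF y(2)]]]] y(1) cl by (subst ico_words(2)) (simp add: m_assoc)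
  qed (rule D(1))
  then obtain y where y: "y \<in> {\<one>\<^bsub>icosahedral\<^esub>, ico_v, gen 5 Gb, ico_t, ico_t \<otimes>\<^bsub>icosahedral\<^esub> ico_v,
      ico_t \<otimes>\<^bsub>icosahedral\<^esub> ico_w, ico_t \<otimes>\<^bsub>icosahedral\<^esub> (ico_v \<otimes>\<^bsub>icosahedral\<^esub> ico_w)}" "conj_in icosahedral x y"
    using double_elements_conj[OF I] by blast
  have "ico_t \<otimes>\<^bsub>icosahedral\<^esub> (ico_v \<otimes>\<^bsub>icosahedral\<^esub> ico_w) = gen 5 Ga [^]\<^bsub>icosahedral\<^esub> (2::nat)"
    by (simp add: pow_two cl ico_words(7))
  then have "\<exists>z\<in>set reps_I. conj_in icosahedral y z"
    using y(1) icosahedral_conj conj_in_refl[of "gen 5 Gb"] conj_in_refl[of "\<one>\<^bsub>icosahedral\<^esub>"]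
      conj_in_refl[of "gen 5 Ga [^]\<^bsub>icosahedral\<^esub> (2::nat)"] cl
    by (elim insertE emptyE) simp_all
  then have "\<exists>z\<in>set reps_I. conj_in icosahedral x z"
    using conj_in_trans[OF y(2)] reps_I_subset by blast
  then show ?thesis by (metis in_set_conv_nth)
qed

lemma icosahedral_hom_std:
  assumes r: "r^2 = 5" and t: "(t, d, e) \<in> {(ico_A r, 2 - r, 2 + r), (ico_B r, - (1 + r) / 2, (r - 1) / 2)}"
  obtains \<rho> where "\<rho> \<in> hom icosahedral G2" "\<rho> (gen 5 Gb) = std_s" "\<rho> (gen 5 Gc) = std_a ** std_s ** t ** std_a"
    "\<And>i. i < length reps_I \<Longrightarrow> trace (\<rho> (reps_I ! i)) = [7, 1, -1, d, e] ! i"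
proof -
  have I: "ico_rel G2 std_a std_b std_s t" by (rule std_ico_rel[OF r]) (use t in auto)
  obtain \<rho> where \<rho>: "\<rho> \<in> hom icosahedral G2" "\<rho> (gen 5 Ga) = std_a ** std_s ** t ** std_a ** std_s ** std_s"
    "\<rho> (gen 5 Gb) = std_s" "\<rho> (gen 5 Gc) = std_a ** std_s ** t ** std_a"
    using ex_polyhedral_hom[OF group_G2 group.poly_rel_of_ico_rel[OF group_G2 I]] by (auto simp: G2_mult)
  interpret G2: group G2 by (rule group_G2)
  interpret \<rho>: group_hom icosahedral G2 \<rho>
    using \<rho>(1) group_polyhedral group_G2 by (simp add: group_hom_def group_hom_axioms_def)
  have t': "t = circ (- 1 / 4) (r / 4) (- r / 4) (1 / 8) ((r - 2) / 8) ((- r - 2) / 8)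
     (- 5 / 8) (r / 8) (- r / 8) (- 5 / 8) (r / 8) (- r / 8) \<and> d = - (1 + r) / 2 \<and> e = (r - 1) / 2 \<or>
     t = circ 1 0 0 (- 1 / 2) ((r - 1) / 4) ((- 1 - r) / 4) 0 0 0 0 0 0 \<and> d = 2 - r \<and> e = 2 + r"
    using t by (auto simp: ico_A_def ico_B_def)
  \<comment> \<open>The images of \<open>gen 5 Ga\<close> and its square will turn out conjugate to
    \<open>t std_b\<close> and \<open>t std_a std_b\<close>, whose traces can be read off from the
    circulants.\<close>
  have tb: "trace (t ** std_b) = d" "trace (t ** (std_a ** std_b)) = e" "trace t = -1"
    using t' by (elim disjE conjE; simp only: trace_circ_std_b trace_circ_std_ab trace_circ; simp add: field_simps)+
  have T: "tet_rel G2 std_a std_b std_s" by (rule std_tet_rel)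
  have cl: "std_a \<in> carrier G2" "std_b \<in> carrier G2" "std_s \<in> carrier G2" "t \<in> carrier G2"
    using G2.tet_rel_closed[OF T] I by (auto simp: ico_rel_def)
  note rules = G2.m_assoc G2.tet_rel_simps[OF T] G2.tet_rel_simps'[OF T] G2.ico_rel_simps[OF I] G2.ico_rel_simps'[OF I]
  define x where "x = std_a \<otimes>\<^bsub>G2\<^esub> std_s \<otimes>\<^bsub>G2\<^esub> t \<otimes>\<^bsub>G2\<^esub> std_a \<otimes>\<^bsub>G2\<^esub> std_s \<otimes>\<^bsub>G2\<^esub> std_s"
  have x: "x \<in> carrier G2" unfolding x_def using cl by simp
  have "conj_in G2 (std_a \<otimes>\<^bsub>G2\<^esub> std_s \<otimes>\<^bsub>G2\<^esub> t \<otimes>\<^bsub>G2\<^esub> std_a) t"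
    by (rule G2.conj_inI[of "std_a \<otimes>\<^bsub>G2\<^esub> (std_s \<otimes>\<^bsub>G2\<^esub> std_s)"]) (use cl in \<open>simp_all add: rules\<close>)
  then have trc: "trace (std_a ** std_s ** t ** std_a) = -1"
    using tb(3) by (simp add: trace_conj_in_G2 G2_mult)
  have "conj_in G2 x (t \<otimes>\<^bsub>G2\<^esub> std_b)"
    by (rule G2.conj_inI[of "std_a \<otimes>\<^bsub>G2\<^esub> std_s"]) (use cl in \<open>simp_all add: x_def rules\<close>)
  then have tra: "trace (std_a ** std_s ** t ** std_a ** std_s ** std_s) = d"
    using tb(1) by (simp add: trace_conj_in_G2 G2_mult x_def)
  have "conj_in G2 (x \<otimes>\<^bsub>G2\<^esub> x) (t \<otimes>\<^bsub>G2\<^esub> (std_a \<otimes>\<^bsub>G2\<^esub> std_b))"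
    by (rule G2.conj_inI[of "\<one>\<^bsub>G2\<^esub>"]) (use cl in \<open>simp_all add: x_def rules\<close>)
  then have tra2: "trace ((std_a ** std_s ** t ** std_a ** std_s ** std_s) ** (std_a ** std_s ** t ** std_a ** std_s ** std_s)) = e"
    using tb(2) by (simp add: trace_conj_in_G2 G2_mult x_def)
  have "trace (\<rho> (reps_I ! i)) = [7, 1, -1, d, e] ! i" if "i < length reps_I" for i
  proof -
    have "i = 0 \<or> i = 1 \<or> i = 2 \<or> i = 3 \<or> i = 4" using that by auto
    then show ?thesis using \<rho>.hom_one trc tra tra2
      by (auto simp: \<rho> trace_std trace_one_7 G2_one G2_mult gen_in_carrier group.pow_two[OF group_polyhedral])
  qed
  with \<rho> that show thesis by blast
qed

lemma sqrt5_power2: "(complex_of_real (sqrt 5))^2 = 5" "(- complex_of_real (sqrt 5))^2 = 5"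
  by (simp_all flip: of_real_power)

lemma sqrt5_bounds: "2 < sqrt 5" "sqrt 5 < 3"
  by (simp_all add: real_less_lsqrt real_less_rsqrt)

text \<open>Since the square root of 5 lies between 2 and 3, the traces 7, 1, -1,
  \<open>2 - r\<close>, \<open>2 + r\<close> of a single homomorphism are distinct.\<close>

lemma icosahedral_reps_inequivalent:
  assumes ij: "i < length reps_I" "j < length reps_I" and c: "conj_in icosahedral (reps_I ! i) (reps_I ! j)"
  shows "i = j"
proof -
  define r where "r = complex_of_real (sqrt 5)"
  have r: "r^2 = 5" using sqrt5_power2 by (simp add: r_def)
  obtain \<rho> where \<rho>: "\<rho> \<in> hom icosahedral G2"
    "\<And>i. i < length reps_I \<Longrightarrow> trace (\<rho> (reps_I ! i)) = [7, 1, -1, 2 - r, 2 + r] ! i"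
    using icosahedral_hom_std[OF r, of "ico_A r" "2 - r" "2 + r"] by blast
  have rj: "reps_I ! j \<in> carrier icosahedral" using ij(2) reps_I_subset nth_mem by blast
  have "[7, 1, -1, 2 - r, 2 + r] ! i = [7, 1, -1, 2 - r, 2 + r] ! j"
    using trace_conj_in_G2[OF hom_conj_in[OF group_polyhedral group_G2 \<rho>(1) c rj]] \<rho>(2) ij by simp
  then have "Re ([7, 1, -1, 2 - r, 2 + r] ! i) = Re ([7, 1, -1, 2 - r, 2 + r] ! j)" by simp
  moreover have "i = 0 \<or> i = 1 \<or> i = 2 \<or> i = 3 \<or> i = 4" "j = 0 \<or> j = 1 \<or> j = 2 \<or> j = 3 \<or> j = 4" using ij by auto
  ultimately show ?thesis using sqrt5_bounds by (elim disjE) (simp_all add: r_def)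
qed

lemma icosahedral_classification:
  "equiv (mon icosahedral G2) (mon_conj icosahedral G2) \<and>
    rep_character icosahedral respects mon_conj icosahedral G2 \<and>
    bij_betw (\<lambda>C. the_elem (rep_character icosahedral ` C)) (mon icosahedral G2 // mon_conj icosahedral G2)
      {\<lambda>\<gamma>\<in>carrier icosahedral. chi_I 1 \<gamma> + 2 * chi_I 2 \<gamma>,
       \<lambda>\<gamma>\<in>carrier icosahedral. chi_I 1 \<gamma> + 2 * chi_I 3 \<gamma>,
       \<lambda>\<gamma>\<in>carrier icosahedral. chi_I 2 \<gamma> + chi_I 4 \<gamma>,
       \<lambda>\<gamma>\<in>carrier icosahedral. chi_I 3 \<gamma> + chi_I 4 \<gamma>}"
proof -
  let ?G = icosahedral
  interpret G: group ?G by (rule group_polyhedral)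
  define r where "r = complex_of_real (sqrt 5)"
  have r2: "r^2 = 5" "(- r)^2 = 5" using sqrt5_power2 by (simp_all add: r_def)
  have Re_r: "Re r = sqrt 5" by (simp add: r_def)
  have phi: "phi_plus = (1 + r) / 2" "phi_minus = (1 - r) / 2"
    by (simp_all add: phi_plus_def phi_minus_def r_def)
  have five: "i = 0 \<or> i = 1 \<or> i = 2 \<or> i = 3 \<or> i = 4" if "i < length reps_I" for i using that by auto
  \<comment> \<open>\<open>t\<close> is the normal form realised, \<open>d\<close> and
    \<open>e\<close> are the traces at \<open>gen 5 Ga\<close> and at its square. Passing from
    \<open>r\<close> to \<open>- r\<close> swaps \<open>d\<close> and \<open>e\<close>.\<close>
  define real_hom where "real_hom \<rho> t d e \<longleftrightarrow> \<rho> \<in> mon ?G G2 \<and> \<rho> (gen 5 Gb) = std_s \<and>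
     \<rho> (gen 5 Gc) = std_a ** std_s ** t ** std_a \<and>
     (\<forall>i<length reps_I. trace (\<rho> (reps_I ! i)) = [7, 1, -1, d, e] ! i)" for \<rho> t d e
  have ex: "\<exists>\<rho>. real_hom \<rho> t d e"
    if a: "r'^2 = 5" "(t, d, e) \<in> {(ico_A r', 2 - r', 2 + r'), (ico_B r', - (1 + r') / 2, (r' - 1) / 2)}"
      "r' = r \<or> r' = - r" for r' t d e
  proof -
    obtain \<rho> where \<rho>: "\<rho> \<in> hom icosahedral G2" "\<rho> (gen 5 Gb) = std_s" "\<rho> (gen 5 Gc) = std_a ** std_s ** t ** std_a"
      "\<And>i. i < length reps_I \<Longrightarrow> trace (\<rho> (reps_I ! i)) = [7, 1, -1, d, e] ! i"
      using icosahedral_hom_std[OF a(1,2)] by blast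
    have de: "Re d \<noteq> 7" "Re e \<noteq> 7" using a(2,3) sqrt5_bounds by (auto simp: Re_r simp del: eq_divide_eq_numeral1)
    have "\<rho> \<in> mon ?G G2"
    proof (rule mon_of_traces[OF group_polyhedral \<rho>(1) icosahedral_classes reps_I_subset])
      fix i assume "0 < i" "i < length reps_I"
      then show "trace (\<rho> (reps_I ! i)) \<noteq> 7"
        unfolding \<rho>(4)[OF \<open>i < length reps_I\<close>] using five[of i] de by auto
    qed auto
    with \<rho> show ?thesis by (auto simp: real_hom_def)
  qed
  have chi: "chi_I k x = [[1, 1, 1, 1, 1], [3, 0, -1, phi_minus, phi_plus], [3, 0, -1, phi_plus, phi_minus],
      [4, 1, 0, -1, -1], [5, -1, 1, 0, 0]] ! (k - 1) ! i"
    if x: "x \<in> carrier ?G" "i < length reps_I" "conj_in ?G x (reps_I ! i)" for k x i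
    unfolding chi_I_def
    by (rule class_function_eq[OF group_polyhedral x reps_I_subset])
      (use icosahedral_reps_inequivalent[OF x(2)] in blast)
  have ch: "rep_character ?G \<rho> = (\<lambda>\<gamma>\<in>carrier ?G. F \<gamma>)"
    if \<rho>: "real_hom \<rho> t d e" and F: "\<And>x i. x \<in> carrier ?G \<Longrightarrow> i < length reps_I \<Longrightarrow> conj_in ?G x (reps_I ! i) \<Longrightarrow>
      F x = [7, 1, -1, d, e] ! i" for \<rho> t d e F
    by (rule rep_character_eqI[OF group_polyhedral mon_hom icosahedral_classes reps_I_subset])
      (use \<rho> F in \<open>auto simp: real_hom_def\<close>)
  obtain \<rho>1 where \<rho>1: "real_hom \<rho>1 (ico_A r) (2 - r) (2 + r)" using ex[OF r2(1)] by blast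
  obtain \<rho>2 where \<rho>2: "real_hom \<rho>2 (ico_A (- r)) (2 + r) (2 - r)" using ex[OF r2(2), of "ico_A (- r)" "2 + r" "2 - r"] by auto
  obtain \<rho>3 where \<rho>3: "real_hom \<rho>3 (ico_B r) (- (1 + r) / 2) ((r - 1) / 2)" using ex[OF r2(1)] by blast
  obtain \<rho>4 where \<rho>4: "real_hom \<rho>4 (ico_B (- r)) (- (1 - r) / 2) ((- r - 1) / 2)"
    using ex[OF r2(2), of "ico_B (- r)" "- (1 - r) / 2" "(- r - 1) / 2"] by auto
  let ?R = "{\<rho>1, \<rho>2, \<rho>3, \<rho>4}"
  have ch1: "rep_character ?G \<rho>1 = (\<lambda>\<gamma>\<in>carrier ?G. chi_I 1 \<gamma> + 2 * chi_I 2 \<gamma>)"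
  proof (rule ch[OF \<rho>1])
    fix x i assume x: "x \<in> carrier ?G" "i < length reps_I" "conj_in ?G x (reps_I ! i)"
    show "chi_I 1 x + 2 * chi_I 2 x = [7, 1, -1, 2 - r, 2 + r] ! i"
      unfolding chi[OF x] using five[OF x(2)] by (auto simp: phi field_simps)
  qed
  have ch2: "rep_character ?G \<rho>2 = (\<lambda>\<gamma>\<in>carrier ?G. chi_I 1 \<gamma> + 2 * chi_I 3 \<gamma>)"
  proof (rule ch[OF \<rho>2])
    fix x i assume x: "x \<in> carrier ?G" "i < length reps_I" "conj_in ?G x (reps_I ! i)"
    show "chi_I 1 x + 2 * chi_I 3 x = [7, 1, -1, 2 + r, 2 - r] ! i"
      unfolding chi[OF x] using five[OF x(2)] by (auto simp: phi field_simps)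
  qed
  have ch3: "rep_character ?G \<rho>3 = (\<lambda>\<gamma>\<in>carrier ?G. chi_I 2 \<gamma> + chi_I 4 \<gamma>)"
  proof (rule ch[OF \<rho>3])
    fix x i assume x: "x \<in> carrier ?G" "i < length reps_I" "conj_in ?G x (reps_I ! i)"
    show "chi_I 2 x + chi_I 4 x = [7, 1, -1, - (1 + r) / 2, (r - 1) / 2] ! i"
      unfolding chi[OF x] using five[OF x(2)] by (auto simp: phi field_simps)
  qed
  have ch4: "rep_character ?G \<rho>4 = (\<lambda>\<gamma>\<in>carrier ?G. chi_I 3 \<gamma> + chi_I 4 \<gamma>)"
  proof (rule ch[OF \<rho>4])
    fix x i assume x: "x \<in> carrier ?G" "i < length reps_I" "conj_in ?G x (reps_I ! i)"
    show "chi_I 3 x + chi_I 4 x = [7, 1, -1, - (1 - r) / 2, (- r - 1) / 2] ! i"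
      unfolding chi[OF x] using five[OF x(2)] by (auto simp: phi field_simps)
  qed
  have ga: "trace (\<rho> (gen 5 Ga)) = d" if "real_hom \<rho> t d e" for \<rho> t d e
    using that unfolding real_hom_def by (auto dest!: spec[of _ 3])
  have key: "Re (trace (\<sigma> (gen 5 Ga))) = Re (trace (\<tau> (gen 5 Ga)))" if "rep_character ?G \<sigma> = rep_character ?G \<tau>" for \<sigma> \<tau>
    using fun_cong[OF that, of "gen 5 Ga"] by (simp add: rep_character_def gen_in_carrier)
  have inj: "inj_on (rep_character ?G) ?R"
  proof (rule inj_onI)
    fix \<sigma> \<tau> assume st: "\<sigma> \<in> ?R" "\<tau> \<in> ?R" "rep_character ?G \<sigma> = rep_character ?G \<tau>"
    have "Re (trace (\<rho>1 (gen 5 Ga))) = 2 - sqrt 5" "Re (trace (\<rho>2 (gen 5 Ga))) = 2 + sqrt 5"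
      "Re (trace (\<rho>3 (gen 5 Ga))) = - (1 + sqrt 5) / 2" "Re (trace (\<rho>4 (gen 5 Ga))) = - (1 - sqrt 5) / 2"
      by (simp_all add: ga[OF \<rho>1] ga[OF \<rho>2] ga[OF \<rho>3] ga[OF \<rho>4] Re_r)
    with key[OF st(3)] st(1,2) sqrt5_bounds show "\<sigma> = \<tau>" by (elim insertE emptyE) simp_all
  qed
  have mon: "real_hom \<rho> t d e \<Longrightarrow> \<rho> \<in> mon ?G G2" for \<rho> t d e by (simp add: real_hom_def)
  show ?thesis
  proof (rule classification_by_characters[of ?R])
    fix \<sigma> assume \<sigma>: "\<sigma> \<in> mon ?G G2"
    interpret \<sigma>: group_hom ?G G2 \<sigma>
      using mon_hom[OF \<sigma>] group_polyhedral group_G2 by (simp add: group_hom_def group_hom_axioms_def)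
    have I: "ico_rel G2 (\<sigma> ico_v) (\<sigma> ico_w) (\<sigma> (gen 5 Gb)) (\<sigma> ico_t)"
      by (rule ico_rel_hom[OF group_polyhedral group_G2 mon_hom[OF \<sigma>] ico_words(1)])
    have trace_conj: "trace (\<tau> x) = trace (\<tau> y)"
      if "conj_in ?G x y" "y \<in> carrier ?G" "\<tau> \<in> mon ?G G2" for \<tau> x y
      using trace_conj_in_G2[OF hom_conj_in[OF group_polyhedral group_G2 mon_hom[OF that(3)] that(1,2)]] .
    have "trace (\<rho>1 (gen 5 Gc)) = -1" using \<rho>1 unfolding real_hom_def by (auto dest!: spec[of _ 2])
    then have "trace (\<rho>1 ico_v) = -1"
      using trace_conj[OF icosahedral_conj(1) gen_in_carrier mon[OF \<rho>1]] by simp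
    moreover have "trace (\<rho>1 \<one>\<^bsub>?G\<^esub>) = 7" using \<rho>1 unfolding real_hom_def by (auto dest!: spec[of _ 0])
    ultimately have "ico_v \<noteq> \<one>\<^bsub>?G\<^esub>" by auto
    then have v1: "\<sigma> ico_v \<noteq> mat 1" by (rule mon_not_one[OF group_polyhedral \<sigma> ico_words_closed(1)])
    \<comment> \<open>\<open>ico_t\<close> and \<open>ico_v\<close> are both conjugate to
      \<open>gen 5 Gc\<close>, and their product is conjugate to \<open>gen 5 Gb\<close>. In
      standard position \<open>ico_v\<close> and \<open>gen 5 Gb\<close> become \<open>std_a\<close>
      and \<open>std_s\<close>, of traces -1 and 1, which provides the trace hypotheses of
      \<open>ico_classification\<close>.\<close>
    have tr_t: "trace (\<sigma> ico_t) = trace (\<sigma> ico_v)"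
      using trace_conj[OF icosahedral_conj(1) gen_in_carrier \<sigma>] trace_conj[OF icosahedral_conj(2) gen_in_carrier \<sigma>] by simp
    have tr_tv: "trace (\<sigma> ico_t ** \<sigma> ico_v) = trace (\<sigma> (gen 5 Gb))"
      using trace_conj[OF icosahedral_conj(3) gen_in_carrier \<sigma>] by (simp add: ico_words_closed G2_mult)
    let ?S = "{ico_A r, ico_A (- r), ico_B r, ico_B (- r)}"
    have "\<exists>h\<in>zaut. \<exists>t0\<in>?S. h ** \<sigma> ico_v = std_a ** h \<and> h ** \<sigma> (gen 5 Gb) = std_s ** h \<and> h ** \<sigma> ico_t = t0 ** h"
    proof (rule extension_standard[of _ "\<sigma> ico_w"])
      show "tet_rel G2 (\<sigma> ico_v) (\<sigma> ico_w) (\<sigma> (gen 5 Gb))" "\<sigma> ico_t \<in> carrier G2" "\<sigma> ico_t ** \<sigma> ico_t = mat 1"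
        "\<sigma> ico_t ** \<sigma> (gen 5 Gb) ** \<sigma> ico_t = \<sigma> (gen 5 Gb) ** \<sigma> (gen 5 Gb)"
        using I by (simp_all add: ico_rel_def G2_mult G2_one)
      fix t' assume t': "t' \<in> zaut" "t' ** t' = mat 1" "std_s ** t' ** std_s = t'"
        "\<sigma> ico_t ** \<sigma> ico_v ** \<sigma> ico_t = \<sigma> ico_v ** \<sigma> ico_t ** \<sigma> ico_v \<Longrightarrow> t' ** std_a ** t' = std_a ** t' ** std_a"
        "trace t' = trace (\<sigma> ico_t)" "trace (t' ** std_a) = trace (\<sigma> ico_t ** \<sigma> ico_v)" "trace std_a = trace (\<sigma> ico_v)"
        "trace std_s = trace (\<sigma> (gen 5 Gb))"
      have "\<exists>r'. r'^2 = 5 \<and> (std_equiv t' (ico_A r') \<or> std_equiv t' (ico_B r'))"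
      proof (rule ico_classification[OF t'(1-3)])
        show "t' ** std_a ** t' = std_a ** t' ** std_a" using I by (intro t'(4)) (simp add: ico_rel_def G2_mult)
        show "trace t' = -1" "trace (t' ** std_a) = 1" using t'(5-8) tr_t tr_tv trace_std by simp_all
      qed
      then obtain r' where r': "r'^2 = 5" "std_equiv t' (ico_A r') \<or> std_equiv t' (ico_B r')" by blast
      have "r' = r \<or> r' = - r" using r'(1) r2(1) by (metis power2_eq_iff)
      with r'(2) show "\<exists>t0\<in>?S. std_equiv t' t0" by auto
    qed (rule v1)
    then obtain h t0 where h: "h \<in> zaut" "t0 \<in> ?S" "h ** \<sigma> ico_v = std_a ** h"
      "h ** \<sigma> (gen 5 Gb) = std_s ** h" "h ** \<sigma> ico_t = t0 ** h" by blast
    have push: "h ** (x ** y) = x' ** (h ** y)" if "h ** x = x' ** h" for x x' y :: "complex^7^7"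
      using that by (simp add: matrix_mul_assoc)
    have "h ** (\<sigma> ico_v ** (\<sigma> (gen 5 Gb) ** (\<sigma> ico_t ** \<sigma> ico_v))) = std_a ** (std_s ** (t0 ** (std_a ** h)))"
      by (simp only: push[OF h(3)] push[OF h(4)] push[OF h(5)] h(3))
    then have "h ** (\<sigma> ico_v ** \<sigma> (gen 5 Gb) ** \<sigma> ico_t ** \<sigma> ico_v) = (std_a ** std_s ** t0 ** std_a) ** h"
      by (simp only: matrix_mul_assoc)
    moreover have "\<sigma> (gen 5 Gc) = \<sigma> ico_v ** \<sigma> (gen 5 Gb) ** \<sigma> ico_t ** \<sigma> ico_v"
      by (subst ico_words(2)) (simp add: ico_words_closed gen_in_carrier G2_mult)
    ultimately have c: "h ** \<sigma> (gen 5 Gc) = (std_a ** std_s ** t0 ** std_a) ** h" by simp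
    have fin: "(\<sigma>, \<rho>) \<in> mon_conj ?G G2" if "real_hom \<rho> t0 d e" for \<rho> d e
      by (rule mon_conj_gensI[OF \<sigma> mon[OF that] h(1)]) (use that h(4) c in \<open>simp_all add: real_hom_def\<close>)
    from h(2) show "\<exists>\<rho>\<in>?R. (\<sigma>, \<rho>) \<in> mon_conj ?G G2"
      using fin \<rho>1 \<rho>2 \<rho>3 \<rho>4 by blast
  next
    show "rep_character ?G ` ?R = {\<lambda>\<gamma>\<in>carrier ?G. chi_I 1 \<gamma> + 2 * chi_I 2 \<gamma>, \<lambda>\<gamma>\<in>carrier ?G. chi_I 1 \<gamma> + 2 * chi_I 3 \<gamma>,
       \<lambda>\<gamma>\<in>carrier ?G. chi_I 2 \<gamma> + chi_I 4 \<gamma>, \<lambda>\<gamma>\<in>carrier ?G. chi_I 3 \<gamma> + chi_I 4 \<gamma>}"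
      by (simp only: image_insert image_empty ch1 ch2 ch3 ch4)
  qed (use mon[OF \<rho>1] mon[OF \<rho>2] mon[OF \<rho>3] mon[OF \<rho>4] inj in auto)
qed

theorem theorem3p2:
  fixes \<Gamma> :: "polyhedral monoid" and X :: "(polyhedral \<Rightarrow> complex) set"
  assumes "(\<Gamma>, X) \<in>
    {(tetrahedral,
       {\<lambda>\<gamma>\<in>carrier tetrahedral. chi_T 1 \<gamma> + 2 * chi_T 4 \<gamma>}),
     (octahedral,
       {\<lambda>\<gamma>\<in>carrier octahedral. chi_O 1 \<gamma> + 2 * chi_O 4 \<gamma>,
        \<lambda>\<gamma>\<in>carrier octahedral. chi_O 2 \<gamma> + chi_O 4 \<gamma> + chi_O 5 \<gamma>}),
     (icosahedral,
       {\<lambda>\<gamma>\<in>carrier icosahedral. chi_I 1 \<gamma> + 2 * chi_I 2 \<gamma>,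
        \<lambda>\<gamma>\<in>carrier icosahedral. chi_I 1 \<gamma> + 2 * chi_I 3 \<gamma>,
        \<lambda>\<gamma>\<in>carrier icosahedral. chi_I 2 \<gamma> + chi_I 4 \<gamma>,
        \<lambda>\<gamma>\<in>carrier icosahedral. chi_I 3 \<gamma> + chi_I 4 \<gamma>})}"
  shows "equiv (mon \<Gamma> G2) (mon_conj \<Gamma> G2) \<and>
    rep_character \<Gamma> respects mon_conj \<Gamma> G2 \<and>
    bij_betw (\<lambda>C. the_elem (rep_character \<Gamma> ` C)) (mon \<Gamma> G2 // mon_conj \<Gamma> G2) X"
  using assms tetrahedral_classification octahedral_classification icosahedral_classification
  by (elim insertE emptyE) (simp_all only: prod.inject)

end
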